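(* Let $(X,\{s_j\}_{j=1}^\infty,\{p_j\}_{j=1}^\infty)$ be an infinite conformal uniformly Dini IFS, let $J$ be the limit set of $\{s_j\}_{j=1}^\infty$, let $T:C(\overline J)\to C(\overline J)$ be its Ruelle operator and let $\varrho$ be the spectral radius of $T$. Then there exist a unique $h\in C(\overline J)$ with $h>0$ and a unique probability measure $\mu\in M(\overline J)$ such that $$Th=\varrho h,\qquad T^*\mu=\varrho\mu,\qquad \langle\mu,h\rangle=1.$$ Moreover, for every $f\in C(\overline J)$, $\varrho^{-n}T^nf$ converges to $\langle\mu,f\rangle h$ in the supremum norm as $n\to\infty$, and for every $\xi\in M(\overline J)$, $\varrho^{-n}T^{*n}\xi$ converges weakly to $\langle\xi,h\rangle\mu$ as $n\to\infty$.
   Context: Setting. $X\subset\mathbb{R}^d$ is a locally connected compact set and $U_0\supset X$ is an open set with $\mathrm{diam}(U_0)\le 1$. A self-map $w$ of $X$ is conformal if it is (defined and) continuously differentiable on $U_0$ and for each $x\in U_0$ the derivative $w'(x)$ is a similarity matrix (a scalar multiple of an orthogonal matrix); $|w'(x)|$ denotes its norm. A family $\{p_j\}_{j=1}^\infty$ of positive functions on $U_0$ is uniformly Dini continuous on $U_0$ if $\int_0^1\frac{\alpha(t)}{t}\,dt<+\infty$, where $\alpha(t)=\sup_{j\ge1}\sup_{x,y\in U_0,\,|x-y|\le t}|\log p_j(x)-\log p_j(y)|$, and $\sum_{j=1}^\infty p_j(x)<\infty$ for $x\in U_0$. An infinite conformal IFS is a sequence $\{s_j\}_{j=1}^\infty$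 of conformal self-maps of $X$ such that: (i) each $s_j:X\to X$ is one-to-one and there is $0<s<1$ with $|s_j(x)-s_j(y)|\le s|x-y|$ for all $j\ge 1$ and $x,y\in X$; (ii) for each $j$, $0<\inf_{x\in U_0}|s_j'(x)|\le\sup_{x\in U_0}|s_j'(x)|<1$; (iii) $\{|s_j'(\cdot)|\}_{j=1}^\infty$ is uniformly Dini continuous on $U_0$. If in addition $\{p_j\}_{j=1}^\infty$ is uniformly Dini continuous on $U_0$, the triple $(X,\{s_j\}_{j=1}^\infty,\{p_j\}_{j=1}^\infty)$ is called an infinite conformal uniformly Dini IFS. Limit set. Let $I=\{1,2,3,\dots\}$. For $\mathbf{w}=w_1w_2\cdots\in I^{\infty}$ let $\mathbf{w}|_n=w_1\cdots w_n$ and $s_{\mathbf{w}|_n}=s_{w_1}\circ\cdots\circ s_{w_n}$. The limit set is $J=\bigcup_{\mathbf{w}\in I^\infty}\bigcap_{n=1}^\infty s_{\mathbf{w}|_n}(X)$; $\overline J$ is its closure. Ruelle operator. $T:C(\overline J)\to C(\overline J)$, $Tf(x)=\sum_{j=1}^\infty p_j(s_j(x))f(s_j(x))$, where $C(\overline J)$ is the space of continuous functions on $\overline J$ with the supremum norm. $M(\overline J)$ is the space of finite (regular, signed) Borel measures on $\overline J$, $\langle\mu,f\rangle=\int f\,d\mu$, and $T^*:M(\overline J)\to M(\overline J)$ is the dual operator, $\langle T^*\mu,f\rangle=\langle\mu,Tf\rangle$. *)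

theory Defs
  imports "HOL-Analysis.Analysis" "HOL-Probability.Probability"
begin

section \<open>Infinite conformal iterated function systems\<close>

text \<open>Maps and weights are total functions on \<^typ>\<open>real^'n\<close> of which only the values on the
  open set \<open>U0\<close> matter. Sequences are indexed from 0 instead of 1.\<close>

definition deriv_norm :: "(real^'n \<Rightarrow> real^'n) \<Rightarrow> real^'n \<Rightarrow> real" where
  "deriv_norm w x = onorm (frechet_derivative w (at x))"

definition similarity_matrix :: "real^'n^'n \<Rightarrow> bool" where
  "similarity_matrix A \<longleftrightarrow> (\<exists>c Q. orthogonal_matrix Q \<and> A = c *\<^sub>R Q)"

definition conformal_self_map :: "(real^'n) set \<Rightarrow> (real^'n) set \<Rightarrow> (real^'n \<Rightarrow> real^'n) \<Rightarrow> bool" where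
  "conformal_self_map U0 X w \<longleftrightarrow>
     w ` X \<subseteq> X \<and>
     (\<forall>x\<in>U0. w differentiable (at x)) \<and>
     continuous_on U0 (\<lambda>x. jacobian w (at x)) \<and>
     (\<forall>x\<in>U0. similarity_matrix (jacobian w (at x)))"

text \<open>The modulus takes values in \<^typ>\<open>ennreal\<close>, since the supremum may be infinite.\<close>

definition log_modulus :: "(real^'n) set \<Rightarrow> (nat \<Rightarrow> real^'n \<Rightarrow> real) \<Rightarrow> real \<Rightarrow> ennreal" where
  "log_modulus U0 p t =
     (SUP j. SUP (x, y)\<in>{(x, y). x \<in> U0 \<and> y \<in> U0 \<and> dist x y \<le> t}.
        ennreal \<bar>ln (p j x) - ln (p j y)\<bar>)"

definition uniformly_Dini :: "(real^'n) set \<Rightarrow> (nat \<Rightarrow> real^'n \<Rightarrow> real) \<Rightarrow> bool" where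
  "uniformly_Dini U0 p \<longleftrightarrow>
     (\<forall>j. \<forall>x\<in>U0. 0 < p j x) \<and>
     (\<integral>\<^sup>+t\<in>{0<..1}. (log_modulus U0 p t / ennreal t) \<partial>lborel) < \<infinity> \<and>
     (\<forall>x\<in>U0. summable (\<lambda>j. p j x))"

text \<open>\<open>X\<close> is required to be nonempty; otherwise the limit set is empty and carries no probability
  measure. Boundedness of \<open>U0\<close> is stated because \<^const>\<open>diameter\<close> is only meaningful on bounded sets.\<close>

definition infinite_conformal_IFS ::
    "(real^'n) set \<Rightarrow> (real^'n) set \<Rightarrow> (nat \<Rightarrow> real^'n \<Rightarrow> real^'n) \<Rightarrow> bool" where
  "infinite_conformal_IFS U0 X s \<longleftrightarrow>
     X \<noteq> {} \<and> compact X \<and> locally connected X \<and>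
     open U0 \<and> X \<subseteq> U0 \<and> bounded U0 \<and> diameter U0 \<le> 1 \<and>
     (\<forall>j. conformal_self_map U0 X (s j)) \<and>
     (\<forall>j. inj_on (s j) X) \<and>
     (\<exists>r. 0 < r \<and> r < 1 \<and> (\<forall>j. \<forall>x\<in>X. \<forall>y\<in>X. dist (s j x) (s j y) \<le> r * dist x y)) \<and>
     (\<forall>j. 0 < (INF x\<in>U0. ennreal (deriv_norm (s j) x)) \<and>
          (SUP x\<in>U0. ennreal (deriv_norm (s j) x)) < 1) \<and>
     uniformly_Dini U0 (\<lambda>j. deriv_norm (s j))"

definition infinite_conformal_Dini_IFS ::
    "(real^'n) set \<Rightarrow> (real^'n) set \<Rightarrow> (nat \<Rightarrow> real^'n \<Rightarrow> real^'n) \<Rightarrow> (nat \<Rightarrow> real^'n \<Rightarrow> real) \<Rightarrow> bool" where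
  "infinite_conformal_Dini_IFS U0 X s p \<longleftrightarrow> infinite_conformal_IFS U0 X s \<and> uniformly_Dini U0 p"

primrec prefix_map :: "(nat \<Rightarrow> 'a \<Rightarrow> 'a) \<Rightarrow> (nat \<Rightarrow> nat) \<Rightarrow> nat \<Rightarrow> 'a \<Rightarrow> 'a" where
  "prefix_map s w 0 = id"
| "prefix_map s w (Suc n) = prefix_map s w n \<circ> s (w n)"

definition limit_set :: "'a set \<Rightarrow> (nat \<Rightarrow> 'a \<Rightarrow> 'a) \<Rightarrow> 'a set" where
  "limit_set X s = (\<Union>w. \<Inter>n\<in>{1..}. prefix_map s w n ` X)"

section \<open>Continuous functions and the spectral radius\<close>

text \<open>Elements of \<open>C(K)\<close> are \<^const>\<open>extensional\<close>, so that equality in \<open>C(K)\<close> is equality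
  of functions.\<close>

definition cont_space :: "'a::topological_space set \<Rightarrow> ('a \<Rightarrow> 'b::topological_space) set" where
  "cont_space K = {f \<in> extensional K. continuous_on K f}"

definition sup_norm :: "'a set \<Rightarrow> ('a \<Rightarrow> 'b::real_normed_vector) \<Rightarrow> real" where
  "sup_norm K f = (SUP x\<in>K. norm (f x))"

text \<open>The range type is left open: at type \<^typ>\<open>real\<close> this is the operator on real \<open>C(K)\<close>, at type
  \<^typ>\<open>complex\<close> it is its complexification, which is where the spectrum is taken.\<close>

definition ruelle :: "'a set \<Rightarrow> (nat \<Rightarrow> 'a \<Rightarrow> 'a) \<Rightarrow> (nat \<Rightarrow> 'a \<Rightarrow> real) \<Rightarrow>
    ('a \<Rightarrow> 'b::real_normed_vector) \<Rightarrow> 'a \<Rightarrow> 'b" where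
  "ruelle K s p f = (\<lambda>x\<in>K. \<Sum>j. p j (s j x) *\<^sub>R f (s j x))"

text \<open>The values \<open>z\<close> for which \<open>z I - A\<close> has no bounded two-sided inverse on complex \<open>C(K)\<close>;
  linearity of an inverse of a linear map is automatic.\<close>

definition spectrum :: "'a::topological_space set \<Rightarrow> (('a \<Rightarrow> complex) \<Rightarrow> 'a \<Rightarrow> complex) \<Rightarrow> complex set" where
  "spectrum K A = {z. \<not> (\<exists>R.
     (\<forall>g\<in>cont_space K. R g \<in> cont_space K \<and> (\<lambda>x\<in>K. z * R g x - A (R g) x) = g) \<and>
     (\<forall>f\<in>cont_space K. R (\<lambda>x\<in>K. z * f x - A f x) = f) \<and>
     (\<exists>B. \<forall>g\<in>cont_space K. sup_norm K (R g) \<le> B * sup_norm K g))}"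

definition spectral_radius :: "'a::topological_space set \<Rightarrow> (('a \<Rightarrow> complex) \<Rightarrow> 'a \<Rightarrow> complex) \<Rightarrow> real" where
  "spectral_radius K A = (SUP z\<in>spectrum K A. cmod z)"

section \<open>Finite signed Borel measures and the dual operator\<close>

text \<open>A finite signed Borel measure on \<open>K\<close> is a real-valued countably additive set function on the
  Borel subsets of \<open>K\<close>, extended by 0 to the other sets as \<^const>\<open>measure\<close> is. A nonnegative finite
  measure \<open>\<mu>\<close> on \<open>K\<close> corresponds to \<open>measure \<mu>\<close>. Regularity is not imposed: it is automatic for
  finite Borel measures on compact subsets of Euclidean space.\<close>

abbreviation borel_on :: "'a::topological_space set \<Rightarrow> 'a measure" where
  "borel_on K \<equiv> restrict_space borel K"

definition signed_measures :: "'a::topological_space set \<Rightarrow> ('a set \<Rightarrow> real) set" where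
  "signed_measures K = {\<nu>.
     (\<forall>A. A \<notin> sets (borel_on K) \<longrightarrow> \<nu> A = 0) \<and>
     (\<forall>A :: nat \<Rightarrow> 'a set. range A \<subseteq> sets (borel_on K) \<longrightarrow> disjoint_family A \<longrightarrow>
        (\<lambda>i. \<nu> (A i)) sums \<nu> (\<Union>i. A i))}"

text \<open>The positive part of the Jordan decomposition. Truncation by \<^const>\<open>ennreal\<close> is harmless,
  as the empty set contributes 0 to the supremum.\<close>

definition pos_part :: "'a::topological_space set \<Rightarrow> ('a set \<Rightarrow> real) \<Rightarrow> 'a measure" where
  "pos_part K \<nu> = measure_of K (sets (borel_on K))
     (\<lambda>A. SUP B\<in>{B \<in> sets (borel_on K). B \<subseteq> A}. ennreal (\<nu> B))"

definition pairing :: "'a::topological_space set \<Rightarrow> ('a set \<Rightarrow> real) \<Rightarrow> ('a \<Rightarrow> real) \<Rightarrow> real" where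
  "pairing K \<nu> f = (\<integral>x. f x \<partial>pos_part K \<nu>) - (\<integral>x. f x \<partial>pos_part K (\<lambda>A. - \<nu> A))"

definition dual_op :: "'a::topological_space set \<Rightarrow> (('a \<Rightarrow> real) \<Rightarrow> 'a \<Rightarrow> real) \<Rightarrow>
    ('a set \<Rightarrow> real) \<Rightarrow> 'a set \<Rightarrow> real" where
  "dual_op K A \<xi> = (THE \<nu>. \<nu> \<in> signed_measures K \<and>
     (\<forall>f\<in>cont_space K. pairing K \<nu> f = pairing K \<xi> (A f)))"

definition weakly_converges :: "'a::topological_space set \<Rightarrow> (nat \<Rightarrow> 'a set \<Rightarrow> real) \<Rightarrow> ('a set \<Rightarrow> real) \<Rightarrow> bool" where
  "weakly_converges K \<nu> \<nu>' \<longleftrightarrow>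
     (\<forall>f\<in>cont_space K. (\<lambda>n. pairing K (\<nu> n) f) \<longlonglongrightarrow> pairing K \<nu>' f)"

definition ruelle_eigenpair :: "'a::topological_space set \<Rightarrow> (nat \<Rightarrow> 'a \<Rightarrow> 'a) \<Rightarrow> (nat \<Rightarrow> 'a \<Rightarrow> real) \<Rightarrow>
    real \<Rightarrow> ('a \<Rightarrow> real) \<Rightarrow> 'a measure \<Rightarrow> bool" where
  "ruelle_eigenpair K s p \<rho> h \<mu> \<longleftrightarrow>
     h \<in> cont_space K \<and> (\<forall>x\<in>K. 0 < h x) \<and>
     prob_space \<mu> \<and> sets \<mu> = sets (borel_on K) \<and>
     ruelle K s p h = (\<lambda>x\<in>K. \<rho> * h x) \<and>
     dual_op K (ruelle K s p) (measure \<mu>) = (\<lambda>A. \<rho> * measure \<mu> A) \<and>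
     (\<integral>x. h x \<partial>\<mu>) = 1"

end

theory Submission
  imports Defs "HOL-Complex_Analysis.Great_Picard"
begin

text \<open>
  Write \<open>g j x = p j (s j x)\<close>, so that the Ruelle operator is \<open>T f x = (\<Sum>j. g j x * f (s j x))\<close>. The
  proof rests on bounded distortion. Two orbits that start at \<open>x\<close> and \<open>y\<close> and apply the same maps
  approach each other at a geometric rate \<open>r ^ k\<close>, and the Dini condition says exactly that the moduli of
  \<open>log p\<close> at the scales \<open>r ^ k\<close> have a finite sum. Hence the weights of \<open>x\<close> and \<open>y\<close> along any common word
  differ by a factor at most \<open>exp (V x y)\<close>, where \<open>V\<close> is bounded and tends to 0 at the diagonal. The
  contraction of the maps on \<open>X\<close> provides the geometric rate; this is how the geometry of the system
  enters.

  Growth rate and eigenfunction: all values of \<open>T\<^sup>n 1\<close> agree up to the factor \<open>exp C\<close>, where \<open>C\<close> bounds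
  \<open>V\<close>. So \<open>n \<mapsto> log (T\<^sup>n 1)\<close> is additive up to the error \<open>C\<close>, hence within bounded distance of a linear
  function \<open>n \<mapsto> n * log l\<close> (\<open>quasi_additive_linear\<close>, \<open>ones_growth\<close>). The functions \<open>T\<^sup>n 1 / l\<^sup>n\<close> are
  equicontinuous and bounded away from 0 and infinity; a uniform limit of their averages, which exists
  by the Arzela-Ascoli theorem, is a positive \<open>h\<close> with \<open>T h = l * h\<close> (\<open>eigenfunction\<close>).

  Convergence: for continuous \<open>f\<close>, minimum and maximum of \<open>T\<^sup>n f / (l\<^sup>n * h)\<close> increase and decrease with
  \<open>n\<close>. By bounded distortion, applied to \<open>f\<close> minus its largest minorant \<open>a * h\<close>, the minimum eventually
  gains a fixed proportion of the gap between the two (\<open>iter_distortion\<close>, \<open>ratio_contraction\<close>). So the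
  quotient converges uniformly to a constant (\<open>ratio_converges\<close>). The constant is a positive linear
  functional of \<open>f\<close>, scaled by \<open>l\<close> under composition with \<open>T\<close>. By the Riesz representation theorem,
  proved below for compact metric spaces, it is the integral with respect to a measure, and normalising
  gives the eigenmeasure (\<open>eigenmeasure\<close>). The Riesz theorem also supplies the dual operator on
  signed measures, through the Jordan decomposition (\<open>dual_op\<close>).

  Spectral radius: \<open>l\<close> is an eigenvalue, and for \<open>|z| > l\<close> the Neumann series of \<open>z - T\<close> converges because
  \<open>|T\<^sup>n f| \<le> sup |f| * T\<^sup>n 1\<close> is of order \<open>l\<^sup>n\<close>. So \<open>l\<close> is the spectral radius.

  Uniqueness and the weak convergence follow by pairing the uniform convergence with a measure.
\<close>

section \<open>Continuous functions on compact sets\<close>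

lemma bounded_cont_on_compact:
  fixes f :: "'a::topological_space \<Rightarrow> 'b::real_normed_vector"
  assumes "compact K" "continuous_on K f"
  obtains B where "0 \<le> B" "\<And>x. x \<in> K \<Longrightarrow> norm (f x) \<le> B"
proof -
  obtain B where "\<And>x. x \<in> K \<Longrightarrow> norm (f x) \<le> B"
    using compact_imp_bounded[OF compact_continuous_image[OF assms(2,1)]]
    by (auto simp: bounded_iff)
  then have "\<And>x. x \<in> K \<Longrightarrow> norm (f x) \<le> \<bar>B\<bar>" by fastforce
  then show ?thesis using that[of "\<bar>B\<bar>"] by simp
qed

lemma continuous_approx_open:
  fixes U :: "'a::metric_space set"
  assumes "open U"
  obtains h :: "nat \<Rightarrow> 'a \<Rightarrow> real" where "\<And>m. continuous_on UNIV (h m)"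
    "\<And>m x. 0 \<le> h m x \<and> h m x \<le> 1" "\<And>x. (\<lambda>m. h m x) \<longlonglongrightarrow> indicator U x"
    "\<And>m n x. m \<le> n \<Longrightarrow> h m x \<le> h n x" "\<And>x. h 0 x = 0" "\<And>m x. x \<notin> U \<Longrightarrow> h m x = 0"
proof -
  \<comment> \<open>The distance to the empty set is 0 by convention, which would give the wrong limit.\<close>
  define d where "d x = (if U = UNIV then 1 else infdist x (- U))" for x
  define h where "h m x = min 1 (real m * d x)" for m x
  have d_nonneg: "0 \<le> d x" for x
    by (simp add: d_def infdist_nonneg)
  show ?thesis
  proof (rule that[of h])
    show "continuous_on UNIV (h m)" for m
      unfolding h_def d_def by (cases "U = UNIV") (auto intro!: continuous_intros)
    show "0 \<le> h m x \<and> h m x \<le> 1" for m x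
      using d_nonneg by (simp add: h_def)
    show "h m x \<le> h n x" if "m \<le> n" for m n x
      unfolding h_def using that d_nonneg by (intro min.mono mult_right_mono) auto
    show "h 0 x = 0" for x
      by (simp add: h_def)
    show off: "h m x = 0" if "x \<notin> U" for m x
      using that by (auto simp: h_def d_def)
    show "(\<lambda>m. h m x) \<longlonglongrightarrow> indicator U x" for x
    proof (cases "x \<in> U")
      case True
      have pos: "0 < d x"
        using infdist_pos_not_in_closed[of "- U" x] assms True by (auto simp: d_def)
      have "eventually (\<lambda>m. h m x = 1) sequentially"
      proof (rule eventually_sequentiallyI)
        fix m assume "nat \<lceil>1 / d x\<rceil> \<le> m"
        then have "1 / d x \<le> real m" by linarith
        then show "h m x = 1"
          using pos by (simp add: h_def field_simps)
      qed
      then show ?thesis using True by (simp add: tendsto_eventually)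
    qed (simp add: off)
  qed
qed

lemma continuous_on_contraction:
  fixes f :: "'a::metric_space \<Rightarrow> 'b::metric_space"
  assumes "r < 1" "\<And>x y. x \<in> X \<Longrightarrow> y \<in> X \<Longrightarrow> dist (f x) (f y) \<le> r * dist x y"
  shows "continuous_on X f"
  unfolding continuous_on_iff
proof (intro ballI allI impI)
  fix x and e :: real assume "x \<in> X" "0 < e"
  have "dist (f y) (f x) < e" if "y \<in> X" "dist y x < e" for y
  proof -
    have "dist (f y) (f x) \<le> r * dist y x"
      using that \<open>x \<in> X\<close> by (intro assms(2))
    also have "\<dots> \<le> 1 * dist y x"
      using assms(1) by (intro mult_right_mono) auto
    finally show ?thesis using that by simp
  qed
  then show "\<exists>d>0. \<forall>y\<in>X. dist y x < d \<longrightarrow> dist (f y) (f x) < e"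
    using \<open>0 < e\<close> by blast
qed

section \<open>Positive functionals are integrals\<close>

lemma space_borel_on [simp]: "space (borel_on K) = K"
  by (simp add: space_restrict_space)

locale positive_functional =
  fixes K :: "'a::metric_space set" and L :: "('a \<Rightarrow> real) \<Rightarrow> real"
  assumes compact_K: "compact K"
    and linear: "\<And>f g c. continuous_on K f \<Longrightarrow> continuous_on K g \<Longrightarrow>
      L (\<lambda>x. f x + c * g x) = L f + c * L g"
    and nonneg: "\<And>f. continuous_on K f \<Longrightarrow> (\<And>x. x \<in> K \<Longrightarrow> 0 \<le> f x) \<Longrightarrow> 0 \<le> L f"
begin

lemma L_zero: "L (\<lambda>x. 0) = 0"
  using linear[of "\<lambda>x. 0" "\<lambda>x. 0" 1] by simp

lemma L_cmult: "continuous_on K f \<Longrightarrow> L (\<lambda>x. c * f x) = c * L f"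
  using linear[of "\<lambda>x. 0" f c] by (simp add: L_zero)

lemma L_add: "continuous_on K f \<Longrightarrow> continuous_on K g \<Longrightarrow> L (\<lambda>x. f x + g x) = L f + L g"
  using linear[of f g 1] by simp

lemma L_mono:
  assumes "continuous_on K f" "continuous_on K g" "\<And>x. x \<in> K \<Longrightarrow> f x \<le> g x"
  shows "L f \<le> L g"
proof -
  have "0 \<le> L (\<lambda>x. g x + (-1) * f x)"
    using assms by (intro nonneg continuous_intros) auto
  then show ?thesis
    using linear[OF assms(2,1), of "-1"] by simp
qed

lemma L_cong:
  assumes "continuous_on K f" "\<And>x. x \<in> K \<Longrightarrow> f x = g x"
  shows "L f = L g"
proof -
  have "continuous_on K g"
    using assms continuous_on_cong by metis
  then show ?thesis
    using assms by (intro antisym L_mono) auto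
qed

lemma L_sum:
  "finite I \<Longrightarrow> (\<And>i. i \<in> I \<Longrightarrow> continuous_on K (f i)) \<Longrightarrow> L (\<lambda>x. \<Sum>i\<in>I. f i x) = (\<Sum>i\<in>I. L (f i))"
proof (induction rule: finite_induct)
  case (insert i I)
  then show ?case
    by (simp add: L_add continuous_on_sum)
qed (simp add: L_zero)

text \<open>
  The measure is obtained from coverings by series of nonnegative continuous functions, not by open
  sets. Countable subadditivity of the resulting outer measure is then the rearrangement of a double
  series, and a cover is split along an open set by multiplying it with functions.
\<close>

definition covering :: "'a set \<Rightarrow> (nat \<Rightarrow> 'a \<Rightarrow> real) \<Rightarrow> bool" where
  "covering A F \<longleftrightarrow> (\<forall>n. continuous_on K (F n)) \<and> (\<forall>n. \<forall>x\<in>K. 0 \<le> F n x) \<and>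
     (\<forall>x\<in>A. 1 \<le> (\<Sum>n. ennreal (F n x)))"

definition outer :: "'a set \<Rightarrow> ennreal" where
  "outer A = (INF F\<in>Collect (covering A). \<Sum>n. ennreal (L (F n)))"

lemma outer_le: "covering A F \<Longrightarrow> outer A \<le> (\<Sum>n. ennreal (L (F n)))"
  unfolding outer_def by (rule INF_lower) simp

lemma outer_le_double:
  assumes "\<And>i j. continuous_on K (F i j)" "\<And>i j x. x \<in> K \<Longrightarrow> 0 \<le> F i j x"
    and "\<And>x. x \<in> A \<Longrightarrow> 1 \<le> (\<Sum>i. \<Sum>j. ennreal (F i j x))"
  shows "outer A \<le> (\<Sum>i. \<Sum>j. ennreal (L (F i j)))"
proof -
  define G where "G k = case_prod F (prod_decode k)" for k
  have G: "(\<Sum>k. ennreal (G k x)) = (\<Sum>i. \<Sum>j. ennreal (F i j x))" for x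
    using suminf_ennreal_2dimen[of "\<lambda>i. \<Sum>j. ennreal (F i j x)" "\<lambda>(i, j). ennreal (F i j x)"]
    by (simp add: G_def case_prod_beta)
  have LG: "(\<Sum>k. ennreal (L (G k))) = (\<Sum>i. \<Sum>j. ennreal (L (F i j)))"
    using suminf_ennreal_2dimen[of "\<lambda>i. \<Sum>j. ennreal (L (F i j))" "\<lambda>(i, j). ennreal (L (F i j))"]
    by (simp add: G_def case_prod_beta)
  have "covering A G"
    unfolding covering_def G using assms by (auto simp: G_def split: prod.split)
  from outer_le[OF this] show ?thesis
    by (simp add: LG)
qed

lemma outer_le_single:
  assumes "continuous_on K f" "\<And>x. x \<in> K \<Longrightarrow> 0 \<le> f x" "\<And>x. x \<in> A \<Longrightarrow> 1 \<le> f x"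
  shows "outer A \<le> ennreal (L f)"
proof -
  define F where "F n = (if n = 0 then f else (\<lambda>x. 0))" for n :: nat
  have eq: "(\<Sum>n. ennreal (u (F n))) = ennreal (u f)" if "u (\<lambda>x. 0) = 0" for u :: "('a \<Rightarrow> real) \<Rightarrow> real"
    using suminf_finite[of "{0::nat}" "\<lambda>n. ennreal (u (F n))"] that by (simp add: F_def)
  have "covering A F"
    unfolding covering_def
    using assms eq[of "\<lambda>f. f x" for x] by (auto simp: F_def[of n for n] ennreal_ge_1)
  from outer_le[OF this] show ?thesis
    using eq[of L] by (simp add: L_zero)
qed

lemma outer_empty: "outer {} = 0"
  using outer_le_single[of "\<lambda>x. 0" "{}"] by (simp add: L_zero)

lemma outer_mono: "A \<subseteq> B \<Longrightarrow> outer A \<le> outer B"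
  unfolding outer_def by (rule INF_superset_mono) (auto simp: covering_def subset_eq)

lemma outer_subadditive: "outer (\<Union>i. A i) \<le> (\<Sum>i. outer (A i))" for A :: "nat \<Rightarrow> 'a set"
proof (rule ennreal_le_epsilon)
  fix e :: real assume e: "0 < e" and fin: "(\<Sum>i. outer (A i)) < top"
  have "\<exists>F. covering (A i) F \<and> (\<Sum>n. ennreal (L (F n))) \<le> outer (A i) + e * (1/2) ^ Suc i" for i
  proof -
    have "outer (A i) < outer (A i) + e * (1/2) ^ Suc i"
      using e fin by (auto simp: less_top dest!: ennreal_suminf_lessD)
    then have "\<exists>F\<in>Collect (covering (A i)). (\<Sum>n. ennreal (L (F n))) < outer (A i) + e * (1/2) ^ Suc i"
      unfolding outer_def INF_less_iff by simp
    then show ?thesis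
      by (auto intro: less_imp_le)
  qed
  then obtain F where F: "\<And>i. covering (A i) (F i)"
    and le: "\<And>i. (\<Sum>n. ennreal (L (F i n))) \<le> outer (A i) + e * (1/2) ^ Suc i"
    by metis
  have "outer (\<Union>i. A i) \<le> (\<Sum>i. \<Sum>n. ennreal (L (F i n)))"
  proof (rule outer_le_double)
    fix x assume "x \<in> (\<Union>i. A i)"
    then obtain i where "x \<in> A i" by blast
    then have "1 \<le> (\<Sum>n. ennreal (F i n x))"
      using F by (auto simp: covering_def)
    also have "\<dots> \<le> (\<Sum>i. \<Sum>n. ennreal (F i n x))"
      using sum_le_suminf[of "\<lambda>i. \<Sum>n. ennreal (F i n x)" "{i}"] by simp
    finally show "1 \<le> (\<Sum>i. \<Sum>n. ennreal (F i n x))" .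
  qed (use F in \<open>auto simp: covering_def\<close>)
  also have "\<dots> \<le> (\<Sum>i. outer (A i) + e * (1/2) ^ Suc i)"
    using le by (intro suminf_le) auto
  also have "\<dots> = (\<Sum>i. outer (A i)) + (\<Sum>i. ennreal e * ennreal ((1/2) ^ Suc i))"
    using \<open>0 < e\<close> by (subst suminf_add[symmetric])
      (auto simp del: ennreal_suminf_cmult simp add: ennreal_mult[symmetric])
  also have "\<dots> = (\<Sum>i. outer (A i)) + e"
    unfolding ennreal_suminf_cmult
    by (subst suminf_ennreal_eq[OF zero_le_power power_half_series]) auto
  finally show "outer (\<Union>i. A i) \<le> (\<Sum>i. outer (A i)) + e" .
qed

lemma outer_measure_space_outer: "outer_measure_space (Pow K) outer"
  unfolding outer_measure_space_def positive_def increasing_def countably_subadditive_def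
  using outer_empty outer_mono outer_subadditive by auto

text \<open>
  Let the \<open>h m\<close> increase to the indicator of \<open>U\<close>, starting with 0, and let \<open>F\<close> cover \<open>E\<close>. The functions
  \<open>F n * (h (m + 1) - h m)\<close> cover \<open>E \<inter> U\<close>, with the total \<open>sup m. \<Sum>n. L (F n * h m)\<close>. For each fixed \<open>m\<close>
  the functions \<open>F n * (1 - h m)\<close> cover \<open>E - U\<close>, and their total is what the inner cover at stage \<open>m\<close>
  leaves over. So the open sets satisfy the Caratheodory condition.
\<close>

lemma outer_split_open:
  assumes "open U" "E \<subseteq> K"
  shows "outer (E \<inter> U) + outer (E - U) \<le> outer E"
proof -
  obtain h :: "nat \<Rightarrow> 'a \<Rightarrow> real" where h: "\<And>m. continuous_on UNIV (h m)"
    "\<And>m x. 0 \<le> h m x \<and> h m x \<le> 1" "\<And>x. (\<lambda>m. h m x) \<longlonglongrightarrow> indicator U x"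
    and h_mono: "\<And>m n x. m \<le> n \<Longrightarrow> h m x \<le> h n x"
    and h_0: "\<And>x. h 0 x = 0" and h_off: "\<And>m x. x \<notin> U \<Longrightarrow> h m x = 0"
    using continuous_approx_open[OF assms(1)] by blast
  have h_cont: "continuous_on K (h m)" for m
    using h(1) by (rule continuous_on_subset) simp
  have h01: "0 \<le> h m x" "h m x \<le> 1" for m x
    using h(2) by auto
  have h_lim: "(\<lambda>m. h m x) \<longlonglongrightarrow> 1" if "x \<in> U" for x
    using h(3)[of x] that by simp
  show ?thesis
    unfolding outer_def[of E]
  proof (rule INF_greatest, clarify)
    fix F assume "covering E F"
    then have F: "\<And>n. continuous_on K (F n)" "\<And>n x. x \<in> K \<Longrightarrow> 0 \<le> F n x"
      "\<And>x. x \<in> E \<Longrightarrow> 1 \<le> (\<Sum>n. ennreal (F n x))"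
      by (auto simp: covering_def)
    have Fh_cont: "continuous_on K (\<lambda>x. F n x * h m x)" for n m
      by (intro continuous_intros F h_cont)
    have Fd_cont: "continuous_on K (\<lambda>x. F n x * (h (Suc m) x - h m x))" for n m
      by (intro continuous_intros F h_cont)
    have Fc_cont: "continuous_on K (\<lambda>x. F n x * (1 - h m x))" for n m
      by (intro continuous_intros F h_cont)
    have Fd_nonneg: "0 \<le> F n x * (h (Suc m) x - h m x)" if "x \<in> K" for n m x
      using F(2)[OF that] h_mono[of m "Suc m" x] by simp
    have L_Fh: "0 \<le> L (\<lambda>x. F n x * h m x)" for n m
      by (intro nonneg Fh_cont mult_nonneg_nonneg F h01)
    have L_Fc: "0 \<le> L (\<lambda>x. F n x * (1 - h m x))" for n m
      using h01 F by (intro nonneg Fc_cont mult_nonneg_nonneg) auto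
    have L_Fd: "0 \<le> L (\<lambda>x. F n x * (h (Suc m) x - h m x))" for n m
      by (intro nonneg Fd_cont Fd_nonneg)
    have inside: "outer (E \<inter> U) \<le> (SUP m. \<Sum>n. ennreal (L (\<lambda>x. F n x * h m x)))"
    proof -
      have "outer (E \<inter> U) \<le> (\<Sum>n. \<Sum>m. ennreal (L (\<lambda>x. F n x * (h (Suc m) x - h m x))))"
      proof (rule outer_le_double[OF Fd_cont Fd_nonneg])
        fix x assume x: "x \<in> E \<inter> U"
        then have xK: "x \<in> K" using assms by auto
        have "(\<lambda>m. h (Suc m) x - h m x) sums (1 - h 0 x)"
          using h_lim[of x] x by (intro telescope_sums) auto
        then have "(\<lambda>m. F n x * (h (Suc m) x - h m x)) sums (F n x * 1)" for n
          by (intro sums_mult) (simp add: h_0)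
        then have "(\<Sum>m. ennreal (F n x * (h (Suc m) x - h m x))) = ennreal (F n x)" for n
          using Fd_nonneg[OF xK] suminf_ennreal_eq by fastforce
        then show "1 \<le> (\<Sum>n. \<Sum>m. ennreal (F n x * (h (Suc m) x - h m x)))"
          using F(3) x by simp
      qed
      also have "\<dots> = (\<Sum>n. SUP M. ennreal (L (\<lambda>x. F n x * h M x)))"
      proof (intro suminf_cong)
        fix n
        have tel: "(\<Sum>m<M. L (\<lambda>x. F n x * (h (Suc m) x - h m x))) = L (\<lambda>x. F n x * h M x)" for M
        proof -
          have "(\<Sum>m<M. F n x * (h (Suc m) x - h m x)) = F n x * h M x" for x
            using sum_lessThan_telescope[of "\<lambda>m. h m x" M]
            by (simp add: h_0 sum_distrib_left[symmetric])
          then show ?thesis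
            using L_sum[of "{..<M}" "\<lambda>m x. F n x * (h (Suc m) x - h m x)"] Fd_cont by simp
        qed
        show "(\<Sum>m. ennreal (L (\<lambda>x. F n x * (h (Suc m) x - h m x))))
            = (SUP M. ennreal (L (\<lambda>x. F n x * h M x)))"
          unfolding suminf_eq_SUP by (subst sum_ennreal) (simp_all add: L_Fd tel)
      qed
      also have "\<dots> = (SUP m. \<Sum>n. ennreal (L (\<lambda>x. F n x * h m x)))"
      proof (rule ennreal_suminf_SUP_eq)
        show "incseq (\<lambda>m. ennreal (L (\<lambda>x. F n x * h m x)))" for n
          by (intro incseq_SucI ennreal_leI L_mono Fh_cont mult_left_mono h_mono F) simp_all
      qed
      finally show ?thesis .
    qed
    have outside: "outer (E - U) + (\<Sum>n. ennreal (L (\<lambda>x. F n x * h m x))) \<le> (\<Sum>n. ennreal (L (F n)))" for m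
    proof -
      have "covering (E - U) (\<lambda>n x. F n x * (1 - h m x))"
        unfolding covering_def using Fc_cont F h01 assms(2) h_off
        by (auto simp: subset_iff)
      then have "outer (E - U) \<le> (\<Sum>n. ennreal (L (\<lambda>x. F n x * (1 - h m x))))"
        by (rule outer_le)
      then have "outer (E - U) + (\<Sum>n. ennreal (L (\<lambda>x. F n x * h m x)))
        \<le> (\<Sum>n. ennreal (L (\<lambda>x. F n x * (1 - h m x)))) + (\<Sum>n. ennreal (L (\<lambda>x. F n x * h m x)))"
        by (intro add_right_mono)
      also have "\<dots> = (\<Sum>n. ennreal (L (\<lambda>x. F n x * (1 - h m x))) + ennreal (L (\<lambda>x. F n x * h m x)))"
        by (subst suminf_add) auto
      also have "\<dots> = (\<Sum>n. ennreal (L (F n)))"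
      proof (intro suminf_cong)
        fix n
        have "L (\<lambda>x. F n x * (1 - h m x)) + L (\<lambda>x. F n x * h m x) = L (F n)"
          by (subst L_add[symmetric, OF Fc_cont Fh_cont]) (simp add: algebra_simps)
        then show "ennreal (L (\<lambda>x. F n x * (1 - h m x))) + ennreal (L (\<lambda>x. F n x * h m x)) = ennreal (L (F n))"
          using L_Fc L_Fh by (simp flip: ennreal_plus)
      qed
      finally show ?thesis .
    qed
    have "outer (E \<inter> U) + outer (E - U) \<le> outer (E - U) + (SUP m. \<Sum>n. ennreal (L (\<lambda>x. F n x * h m x)))"
      using inside by (simp add: add.commute add_left_mono)
    also have "\<dots> = (SUP m. outer (E - U) + (\<Sum>n. ennreal (L (\<lambda>x. F n x * h m x))))"
      by (simp add: ennreal_SUP_add_right)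
    also have "\<dots> \<le> (\<Sum>n. ennreal (L (F n)))"
      using outside by (intro SUP_least)
    finally show "outer (E \<inter> U) + outer (E - U) \<le> (\<Sum>n. ennreal (L (F n)))" .
  qed
qed

text \<open>
  If the series of the continuous functions \<open>F n\<close> is at least 1 on \<open>K\<close>, then by compactness a finite
  partial sum exceeds \<open>1 - e\<close> on all of \<open>K\<close>. So no cover of \<open>K\<close> is cheaper than the constant 1.
\<close>

lemma outer_K: "outer K = ennreal (L (\<lambda>x. 1))"
proof (rule antisym)
  show "outer K \<le> ennreal (L (\<lambda>x. 1))"
    by (rule outer_le_single) auto
  show "ennreal (L (\<lambda>x. 1)) \<le> outer K"
    unfolding outer_def
  proof (rule INF_greatest, clarify)
    fix F assume "covering K F"
    then have F: "\<And>n. continuous_on K (F n)" "\<And>n x. x \<in> K \<Longrightarrow> 0 \<le> F n x"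
      "\<And>x. x \<in> K \<Longrightarrow> 1 \<le> (\<Sum>n. ennreal (F n x))"
      by (auto simp: covering_def)
    have L1: "0 \<le> L (\<lambda>x. 1)" by (rule nonneg) auto
    have main: "(1 - e) * L (\<lambda>x. 1) \<le> enn2real (\<Sum>n. ennreal (L (F n)))"
      if e: "0 < e" "e < 1" and fin: "(\<Sum>n. ennreal (L (F n))) < top" for e
    proof -
      define V where "V N = {x \<in> K. 1 - e < (\<Sum>n<N. F n x)}" for N
      have "\<exists>N. K \<subseteq> V N"
      proof -
        have "openin (top_of_set K) (V N)" for N
        proof -
          have "continuous_on K (\<lambda>x. \<Sum>n<N. F n x)"
            by (intro continuous_on_sum F)
          from continuous_openin_preimage_gen[OF this, of "{1 - e <..}"] show ?thesis
            by (simp add: V_def vimage_def Int_def)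
        qed
        then obtain W where W: "\<And>N. open (W N)" "\<And>N. V N = K \<inter> W N"
          unfolding openin_open by metis
        have "K \<subseteq> (\<Union>N. W N)"
        proof
          fix x assume x: "x \<in> K"
          have "ennreal (1 - e) < 1"
            using e by (simp add: ennreal_less_one_iff)
          also have "\<dots> \<le> (SUP N. \<Sum>n<N. ennreal (F n x))"
            using F(3)[OF x] by (simp add: suminf_eq_SUP)
          finally obtain N where "ennreal (1 - e) < (\<Sum>n<N. ennreal (F n x))"
            unfolding less_SUP_iff by auto
          then have "x \<in> V N"
            using x e F(2) by (auto simp: V_def sum_ennreal ennreal_less_iff)
          then show "x \<in> (\<Union>N. W N)" using W by auto
        qed
        then obtain C where C: "finite C" "K \<subseteq> (\<Union>N\<in>C. W N)"
          using compactE_image[OF compact_K, of UNIV W] W by auto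
        have "V M \<subseteq> V N" if "M \<le> N" for M N
          unfolding V_def using that F(2) by (auto elim!: order_less_le_trans intro!: sum_mono2)
        then have "V N \<subseteq> V (Max (insert 0 C))" if "N \<in> C" for N
          using that C(1) by (simp add: max_def)
        moreover have "K \<subseteq> (\<Union>N\<in>C. V N)"
          using C(2) W(2) by blast
        ultimately show ?thesis by blast
      qed
      then obtain N where N: "K \<subseteq> V N" ..
      have "(1 - e) * L (\<lambda>x. 1) = L (\<lambda>x. (1 - e) * 1)"
        by (subst L_cmult) auto
      also have "\<dots> \<le> L (\<lambda>x. \<Sum>n<N. F n x)"
        using N by (intro L_mono continuous_on_sum F) (auto simp: V_def subset_iff intro: less_imp_le)
      also have "\<dots> = (\<Sum>n<N. L (F n))"
        by (intro L_sum F) auto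
      also have "\<dots> = enn2real (\<Sum>n<N. ennreal (L (F n)))"
        by (simp add: sum_ennreal nonneg F sum_nonneg)
      also have "\<dots> \<le> enn2real (\<Sum>n. ennreal (L (F n)))"
        using fin by (intro enn2real_mono sum_le_suminf) auto
      finally show ?thesis .
    qed
    show "ennreal (L (\<lambda>x. 1)) \<le> (\<Sum>n. ennreal (L (F n)))"
    proof (cases "(\<Sum>n. ennreal (L (F n))) < top")
      case True
      have "((\<lambda>e. (1 - e) * L (\<lambda>x. 1)) \<longlongrightarrow> (1 - 0) * L (\<lambda>x. 1)) (at_right 0)"
        by (intro tendsto_intros)
      then have "(1 - 0) * L (\<lambda>x. 1) \<le> enn2real (\<Sum>n. ennreal (L (F n)))"
      proof (rule tendsto_upperbound)
        show "\<forall>\<^sub>F e in at_right 0. (1 - e) * L (\<lambda>x. 1) \<le> enn2real (\<Sum>n. ennreal (L (F n)))"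
          using main True unfolding eventually_at_right_field by (intro exI[of _ 1]) auto
      qed simp
      then show ?thesis
        using True by (metis diff_zero ennreal_enn2real ennreal_leI mult_1)
    next
      case False
      then show ?thesis by (simp add: not_less top_unique)
    qed
  qed
qed


lemma borel_on_eq_sigma: "sets (borel_on K) = sigma_sets K ((\<inter>) K ` {U. open U})"
proof -
  have "K \<in> sigma_sets UNIV {U. open U}"
    using borel_compact[OF compact_K] by (simp add: borel_def)
  then show ?thesis
    by (simp add: sets_restrict_space sigma_sets_Int borel_def)
qed

definition repr_measure :: "'a measure" where
  "repr_measure = measure_of K (sets (borel_on K)) outer"

lemma sets_repr_measure: "sets repr_measure = sets (borel_on K)"
  and emeasure_repr_measure: "A \<in> sets (borel_on K) \<Longrightarrow> emeasure repr_measure A = outer A"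
proof -
  interpret sigma_algebra K "Pow K" by (rule sigma_algebra_Pow)
  let ?S = "lambda_system K (Pow K) outer"
  have ms: "measure_space K ?S outer"
    by (rule caratheodory_lemma[OF outer_measure_space_outer])
  have "K \<inter> U \<in> ?S" if "open U" for U
  proof -
    have "outer (E \<inter> (K \<inter> U)) + outer (E - K \<inter> U) = outer E" if E: "E \<subseteq> K" for E
    proof (rule antisym)
      have "E \<inter> (K \<inter> U) = E \<inter> U" "E - K \<inter> U = E - U"
        using E by auto
      then show "outer (E \<inter> (K \<inter> U)) + outer (E - K \<inter> U) \<le> outer E"
        using outer_split_open[OF \<open>open U\<close> E] by simp
      have "subadditive (Pow K) outer"
        using countably_subadditive_subadditive outer_measure_space_outer
        by (auto simp: outer_measure_space_def)
      from subadditiveD[OF this, of "E \<inter> (K \<inter> U)" "E - K \<inter> U"]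
      show "outer E \<le> outer (E \<inter> (K \<inter> U)) + outer (E - K \<inter> U)"
        using E by (auto simp: Int_Diff_Un)
    qed
    then show ?thesis
      by (auto simp: lambda_system_eq)
  qed
  then have sub: "sigma_sets K ((\<inter>) K ` {U. open U}) \<subseteq> ?S"
    using ms by (intro sigma_algebra.sigma_sets_subset) (auto simp: measure_space_def)
  have "measure_space K (sets (borel_on K)) outer"
    using measure_down[OF ms sets.sigma_algebra_axioms[of "borel_on K", unfolded space_borel_on]] sub
    by (simp add: borel_on_eq_sigma)
  then have *: "measure_space (space (borel_on K)) (sets (borel_on K)) outer"
    by (simp add: space_borel_on)
  show "sets repr_measure = sets (borel_on K)"
    using sets.sets_measure_of_eq[of "borel_on K"] by (simp add: repr_measure_def)
  show "emeasure repr_measure A = outer A" if "A \<in> sets (borel_on K)"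
    using emeasure_measure_of[OF repr_measure_def, of A] that * sets.space_closed[of "borel_on K"]
    by (simp add: space_borel_on measure_space_def sets.sigma_sets_eq \<open>sets repr_measure = _\<close>)
qed

lemma space_repr_measure: "space repr_measure = K"
  using sets_eq_imp_space_eq[OF sets_repr_measure] by (simp add: space_borel_on)

lemma finite_repr_measure: "finite_measure repr_measure"
  using emeasure_repr_measure[of K] sets.top[of "borel_on K"]
  by (intro finite_measureI) (simp add: space_repr_measure space_borel_on outer_K)

lemma measurable_repr_measure: "continuous_on K f \<Longrightarrow> f \<in> borel_measurable repr_measure" for f :: "'a \<Rightarrow> real"
  using borel_measurable_continuous_on_restrict[of K f] measurable_cong_sets[OF sets_repr_measure refl] by blast

lemma integrable_repr_measure:
  fixes f :: "'a \<Rightarrow> real"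
  assumes "continuous_on K f"
  shows "integrable repr_measure f"
proof -
  obtain B where "\<And>x. x \<in> K \<Longrightarrow> norm (f x) \<le> B"
    using bounded_cont_on_compact[OF compact_K assms] by blast
  then show ?thesis
    using measurable_repr_measure[OF assms]
    by (intro finite_measure.integrable_const_bound[OF finite_repr_measure, of _ B]) (auto simp: space_repr_measure)
qed

lemma integral_one: "(\<integral>x. 1 \<partial>repr_measure) = L (\<lambda>x. 1)"
proof -
  have "0 \<le> L (\<lambda>x. 1)" by (rule nonneg) auto
  then show ?thesis
    using emeasure_repr_measure[of K] sets.top[of "borel_on K"]
    by (simp add: space_repr_measure space_borel_on outer_K measure_def)
qed

text \<open>
  Cut the graph of \<open>f\<close> into \<open>N\<close> horizontal layers. The layer function \<open>c k\<close> is at least 1 where the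
  next layer \<open>A (k + 1)\<close> begins, so \<open>c k\<close> covers \<open>A (k + 1)\<close>; the layers add up to \<open>N * f\<close>. The shift
  by one layer costs \<open>L 1 / N\<close>.
\<close>

lemma integral_le_aux:
  assumes f: "continuous_on K f" and f01: "\<And>x. x \<in> K \<Longrightarrow> 0 \<le> f x \<and> f x \<le> 1" and N: "0 < N"
  shows "(\<integral>x. f x \<partial>repr_measure) \<le> L f + L (\<lambda>x. 1) / real N"
proof -
  interpret finite_measure repr_measure by (rule finite_repr_measure)
  define c where "c k x = max 0 (min 1 (real N * f x - real k))" for k x
  define A where "A k = {x \<in> K. real k < real N * f x}" for k :: nat
  have c_cont: "continuous_on K (c k)" for k
    unfolding c_def by (intro continuous_intros f)
  have A_sets: "A k \<in> sets repr_measure" for k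
  proof -
    have "{x \<in> space repr_measure. real k < real N * f x} \<in> sets repr_measure"
      using measurable_repr_measure[OF f] by measurable
    then show ?thesis by (simp add: A_def space_repr_measure)
  qed
  have sum_c: "(\<Sum>k<m. max 0 (min 1 (t - real k))) = min t (real m)" if "0 \<le> t" for t :: real and m
    using that by (induction m) (auto simp: min_def max_def)
  have meas_A: "measure repr_measure (A (Suc k)) \<le> L (c k)" for k
  proof -
    have "outer (A (Suc k)) \<le> ennreal (L (c k))"
      by (rule outer_le_single[OF c_cont]) (auto simp: c_def A_def)
    moreover have "0 \<le> L (c k)"
      by (rule nonneg[OF c_cont]) (simp add: c_def)
    ultimately show ?thesis
      using emeasure_repr_measure[of "A (Suc k)"] A_sets
      by (metis emeasure_eq_measure ennreal_le_iff sets_repr_measure)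
  qed
  have f_le: "f x \<le> (\<Sum>k<N. indicator (A k) x) / real N" if x: "x \<in> K" for x
  proof -
    have "max 0 (min 1 (real N * f x - real k)) \<le> indicator (A k) x" for k
      using x by (auto simp: A_def indicator_def)
    then have "(\<Sum>k<N. max 0 (min 1 (real N * f x - real k))) \<le> (\<Sum>k<N. indicator (A k) x)"
      by (intro sum_mono)
    then have "real N * f x \<le> (\<Sum>k<N. indicator (A k) x)"
      using sum_c[of "real N * f x" N] f01[OF x] N by (simp add: mult_left_le)
    then show ?thesis using N by (simp add: field_simps)
  qed
  have "integrable repr_measure (\<lambda>x. (\<Sum>k<N. indicator (A k) x) / real N :: real)"
    using A_sets
    by (intro integrable_divide_zero Bochner_Integration.integrable_sum)
      (auto simp: integrable_indicator_iff less_top[symmetric])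
  then have "(\<integral>x. f x \<partial>repr_measure) \<le> (\<integral>x. (\<Sum>k<N. indicator (A k) x) / real N \<partial>repr_measure)"
    using f_le by (intro integral_mono integrable_repr_measure[OF f]) (auto simp: space_repr_measure)
  also have "\<dots> = (\<Sum>k<N. measure repr_measure (A k)) / real N"
    using A_sets by (simp add: Bochner_Integration.integral_sum less_top[symmetric])
  also have "\<dots> \<le> (L (\<lambda>x. 1) + (\<Sum>k<N. L (c k))) / real N"
  proof -
    obtain m where m: "N = Suc m" using N by (cases N) auto
    have "measure repr_measure (A 0) \<le> L (\<lambda>x. 1)"
      using bounded_measure[of "A 0"] integral_one by simp
    moreover have "(\<Sum>k<m. measure repr_measure (A (Suc k))) \<le> (\<Sum>k<m. L (c k))"
      by (intro sum_mono meas_A)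
    moreover have "0 \<le> L (c m)"
      by (rule nonneg[OF c_cont]) (simp add: c_def)
    ultimately show ?thesis
      unfolding m sum.lessThan_Suc_shift[of "\<lambda>k. measure repr_measure (A k)"]
      by (intro divide_right_mono) simp_all
  qed
  also have "(\<Sum>k<N. L (c k)) = L (\<lambda>x. real N * f x)"
    using sum_c f01 N c_cont
    by (subst L_sum[symmetric]) (auto intro!: L_cong continuous_on_sum simp: c_def mult_left_le)
  also have "(L (\<lambda>x. 1) + L (\<lambda>x. real N * f x)) / real N = L f + L (\<lambda>x. 1) / real N"
    using N by (simp add: L_cmult[OF f] add_divide_distrib)
  finally show ?thesis .
qed

text \<open>
  For \<open>0 \<le> f \<le> 1\<close> the layers give one inequality; applied to \<open>1 - f\<close> they give the other, since the
  total masses agree. The general case follows by an affine change of \<open>f\<close>.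
\<close>

lemma integral_eq:
  assumes f: "continuous_on K f"
  shows "(\<integral>x. f x \<partial>repr_measure) = L f"
proof -
  interpret finite_measure repr_measure by (rule finite_repr_measure)
  have le: "(\<integral>x. g x \<partial>repr_measure) \<le> L g"
    if g: "continuous_on K g" "\<And>x. x \<in> K \<Longrightarrow> 0 \<le> g x \<and> g x \<le> 1" for g
  proof (rule field_le_epsilon)
    fix e :: real assume "0 < e"
    have "(\<lambda>N. L (\<lambda>x. 1) / real N) \<longlonglongrightarrow> 0"
      by (rule lim_const_over_n)
    from order_tendstoD(2)[OF this \<open>0 < e\<close>] eventually_gt_at_top[of 0]
    have "eventually (\<lambda>N. L (\<lambda>x. 1) / real N < e \<and> 0 < N) sequentially"
      by (rule eventually_conj)
    then obtain N where "L (\<lambda>x. 1) / real N < e" "0 < N"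
      unfolding eventually_sequentially by auto
    then show "(\<integral>x. g x \<partial>repr_measure) \<le> L g + e"
      using integral_le_aux[OF g, of N] by linarith
  qed
  have eq: "(\<integral>x. g x \<partial>repr_measure) = L g"
    if g: "continuous_on K g" "\<And>x. x \<in> K \<Longrightarrow> 0 \<le> g x \<and> g x \<le> 1" for g
  proof -
    have "(\<integral>x. 1 + (-1) * g x \<partial>repr_measure) \<le> L (\<lambda>x. 1 + (-1) * g x)"
      using g by (intro le continuous_intros) auto
    also have "\<dots> = L (\<lambda>x. 1) - L g"
      using linear[of "\<lambda>x. 1" g "-1"] g by simp
    also have "(\<integral>x. 1 + (-1) * g x \<partial>repr_measure) = L (\<lambda>x. 1) - (\<integral>x. g x \<partial>repr_measure)"
      using integrable_repr_measure[OF g(1)] integral_one by simp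
    finally show ?thesis
      using le[OF g] by simp
  qed
  obtain B where B: "\<And>x. x \<in> K \<Longrightarrow> norm (f x) \<le> B"
    using bounded_cont_on_compact[OF compact_K f] by blast
  define b where "b = \<bar>B\<bar> + 1"
  have b: "0 < b" "\<And>x. x \<in> K \<Longrightarrow> \<bar>f x\<bar> \<le> b"
    using B by (force simp: b_def)+
  have "(\<integral>x. 1/2 + (1/(2*b)) * f x \<partial>repr_measure) = L (\<lambda>x. 1/2 + (1/(2*b)) * f x)"
  proof (rule eq)
    show "continuous_on K (\<lambda>x. 1/2 + (1/(2*b)) * f x)"
      by (intro continuous_intros f)
    show "0 \<le> 1/2 + (1/(2*b)) * f x \<and> 1/2 + (1/(2*b)) * f x \<le> 1" if "x \<in> K" for x
      using b(1) b(2)[OF that] by (auto simp: field_simps)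
  qed
  also have "\<dots> = L (\<lambda>x. 1/2) + (1/(2*b)) * L f"
    by (rule linear) (auto intro: f)
  also have "L (\<lambda>x. 1/2) = (1/2) * L (\<lambda>x. 1)"
    using L_cmult[of "\<lambda>x. 1" "1/2"] by simp
  also have "(\<integral>x. 1/2 + (1/(2*b)) * f x \<partial>repr_measure) = (1/2) * L (\<lambda>x. 1) + (1/(2*b)) * (\<integral>x. f x \<partial>repr_measure)"
    using integrable_repr_measure[OF f] integral_one by simp
  finally show ?thesis using b by simp
qed

theorem representation:
  "\<exists>\<mu>. finite_measure \<mu> \<and> sets \<mu> = sets (borel_on K) \<and>
     (\<forall>f. continuous_on K f \<longrightarrow> (\<integral>x. f x \<partial>\<mu>) = L f)"
  using finite_repr_measure sets_repr_measure integral_eq by blast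

end

section \<open>Finite signed measures and dual operators\<close>

lemma Int_in_borel_on: "A \<in> sets (borel_on K) \<Longrightarrow> K \<inter> A = A"
  using sets.sets_into_space[of A "borel_on K"] by auto

context
  fixes K :: "'a::topological_space set" and \<nu> :: "'a set \<Rightarrow> real"
  assumes \<nu>: "\<nu> \<in> signed_measures K"
begin

lemma signed_sums:
  "range A \<subseteq> sets (borel_on K) \<Longrightarrow> disjoint_family A \<Longrightarrow> (\<lambda>i. \<nu> (A i)) sums \<nu> (\<Union>i. A i)"
  for A :: "nat \<Rightarrow> 'a set"
  using \<nu> unfolding signed_measures_def by blast

lemma signed_outside: "A \<notin> sets (borel_on K) \<Longrightarrow> \<nu> A = 0"
  using \<nu> unfolding signed_measures_def by blast

lemma signed_empty: "\<nu> {} = 0"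
proof -
  have "(\<lambda>i::nat. \<nu> {}) sums \<nu> (\<Union>i::nat. {})"
    by (rule signed_sums) (auto simp: disjoint_family_on_def)
  then show ?thesis
    using sums_summable summable_LIMSEQ_zero LIMSEQ_const_iff by blast
qed

lemma signed_Un:
  assumes "A \<in> sets (borel_on K)" "B \<in> sets (borel_on K)" "A \<inter> B = {}"
  shows "\<nu> (A \<union> B) = \<nu> A + \<nu> B"
proof -
  have "(\<lambda>i. \<nu> (binaryset A B i)) sums \<nu> (\<Union>i. binaryset A B i)"
    using assms by (intro signed_sums) (auto simp: binaryset_def disjoint_family_on_def)
  then show ?thesis
    using binaryset_sums[of \<nu> A B] signed_empty sums_unique2 by (metis UN_binaryset_eq)
qed

lemma signed_Diff:
  assumes "A \<in> sets (borel_on K)" "B \<in> sets (borel_on K)" "A \<subseteq> B"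
  shows "\<nu> (B - A) = \<nu> B - \<nu> A"
proof -
  have "A \<union> (B - A) = B" using assms by auto
  then show ?thesis
    using signed_Un[of A "B - A"] assms by auto
qed

lemma signed_uminus: "(\<lambda>A. - \<nu> A) \<in> signed_measures K"
  using \<nu> by (auto simp: signed_measures_def intro: sums_minus)

text \<open>
  Subsets of disjoint sets with nonnegative mass can be united; a subset with negative mass contributes
  0 after truncation and is dropped.
\<close>

lemma pos_superadditive:
  assumes "A \<in> sets (borel_on K)" "B \<in> sets (borel_on K)" "A \<inter> B = {}"
  shows "(SUP C\<in>{C \<in> sets (borel_on K). C \<subseteq> A}. ennreal (\<nu> C)) +
    (SUP C\<in>{C \<in> sets (borel_on K). C \<subseteq> B}. ennreal (\<nu> C))
    \<le> (SUP C\<in>{C \<in> sets (borel_on K). C \<subseteq> A \<union> B}. ennreal (\<nu> C))"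
proof -
  have ne: "{C \<in> sets (borel_on K). C \<subseteq> D} \<noteq> {}" for D
    by (auto intro: exI[of _ "{}"])
  have "ennreal (\<nu> C) + ennreal (\<nu> D) \<le> (SUP C\<in>{C \<in> sets (borel_on K). C \<subseteq> A \<union> B}. ennreal (\<nu> C))"
    if C: "C \<in> sets (borel_on K)" "C \<subseteq> A" and D: "D \<in> sets (borel_on K)" "D \<subseteq> B" for C D
  proof -
    define E where "E = (if \<nu> C < 0 then D else if \<nu> D < 0 then C else C \<union> D)"
    have "ennreal (\<nu> C) + ennreal (\<nu> D) \<le> ennreal (\<nu> E)"
    proof -
      have "\<nu> (C \<union> D) = \<nu> C + \<nu> D"
        using C D assms by (intro signed_Un) auto
      then show ?thesis
        by (auto simp: E_def ennreal_neg simp flip: ennreal_plus)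
    qed
    also have "\<dots> \<le> (SUP C\<in>{C \<in> sets (borel_on K). C \<subseteq> A \<union> B}. ennreal (\<nu> C))"
      using C D by (intro SUP_upper) (auto simp: E_def)
    finally show ?thesis .
  qed
  then show ?thesis
    by (subst ennreal_SUP_add_left[OF ne, symmetric], intro SUP_least)
      (subst ennreal_SUP_add_right[OF ne], intro SUP_least, auto)
qed

lemma pos_countably_additive:
  "countably_additive (sets (borel_on K))
    (\<lambda>A. SUP B\<in>{B \<in> sets (borel_on K). B \<subseteq> A}. ennreal (\<nu> B))"
  (is "countably_additive _ ?p")
proof (rule countably_additiveI)
  fix A :: "nat \<Rightarrow> 'a set"
  assume A: "range A \<subseteq> sets (borel_on K)" "disjoint_family A" "(\<Union>i. A i) \<in> sets (borel_on K)"
  have mono: "?p C \<le> ?p D" if "C \<subseteq> D" for C D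
    using that by (intro SUP_subset_mono) auto
  show "(\<Sum>i. ?p (A i)) = ?p (\<Union>i. A i)"
  proof (rule antisym)
    have part: "(\<Sum>i<n. ?p (A i)) \<le> ?p (\<Union>i<n. A i)" for n
    proof (induction n)
      case (Suc n)
      have disj: "(\<Union>i<n. A i) \<inter> A n = {}"
      proof -
        have "A i \<inter> A n = {}" if "i < n" for i
          using A(2) that by (auto simp: disjoint_family_on_def)
        then show ?thesis by blast
      qed
      have "(\<Sum>i<Suc n. ?p (A i)) \<le> ?p (\<Union>i<n. A i) + ?p (A n)"
        using Suc by (simp add: add_right_mono)
      also have "\<dots> \<le> ?p ((\<Union>i<n. A i) \<union> A n)"
        using A disj by (intro pos_superadditive) auto
      also have "(\<Union>i<n. A i) \<union> A n = (\<Union>i<Suc n. A i)"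
        by (auto simp: lessThan_Suc)
      finally show ?case .
    qed simp
    have "(\<Sum>i<n. ?p (A i)) \<le> ?p (\<Union>i. A i)" for n
      by (rule order_trans[OF part mono]) auto
    then show "(\<Sum>i. ?p (A i)) \<le> ?p (\<Union>i. A i)"
      unfolding suminf_eq_SUP by (rule SUP_least)
  next
    show "?p (\<Union>i. A i) \<le> (\<Sum>i. ?p (A i))"
    proof (rule SUP_least, clarify)
      fix B assume B: "B \<in> sets (borel_on K)" "B \<subseteq> (\<Union>i. A i)"
      have "(\<lambda>i. \<nu> (B \<inter> A i)) sums \<nu> (\<Union>i. B \<inter> A i)"
        using A B by (intro signed_sums) (auto simp: disjoint_family_on_def)
      also have "(\<Union>i. B \<inter> A i) = B" using B by auto
      finally have lim: "(\<lambda>n. ennreal (\<Sum>i<n. \<nu> (B \<inter> A i))) \<longlonglongrightarrow> ennreal (\<nu> B)"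
        unfolding sums_def by (rule tendsto_ennrealI)
      have part: "ennreal (\<Sum>i<n. \<nu> (B \<inter> A i)) \<le> (\<Sum>i. ?p (A i))" for n
      proof -
        have "ennreal (\<Sum>i<n. \<nu> (B \<inter> A i)) \<le> (\<Sum>i<n. ennreal (\<nu> (B \<inter> A i)))"
        proof (induction n)
          case (Suc n)
          have "ennreal (a + b) \<le> ennreal a + ennreal b" for a b
          proof -
            have "ennreal (a + b) \<le> ennreal (max 0 a + max 0 b)"
              by (intro ennreal_leI) auto
            then show ?thesis by (simp add: ennreal_plus)
          qed
          then have "ennreal (\<Sum>i<Suc n. \<nu> (B \<inter> A i))
              \<le> ennreal (\<Sum>i<n. \<nu> (B \<inter> A i)) + ennreal (\<nu> (B \<inter> A n))"
            by simp
          also have "\<dots> \<le> (\<Sum>i<Suc n. ennreal (\<nu> (B \<inter> A i)))"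
            using Suc by (simp add: add_right_mono)
          finally show ?case .
        qed simp
        also have "\<dots> \<le> (\<Sum>i<n. ?p (A i))"
          using A B by (intro sum_mono SUP_upper) auto
        also have "\<dots> \<le> (\<Sum>i. ?p (A i))"
          by (intro sum_le_suminf) auto
        finally show ?thesis .
      qed
      show "ennreal (\<nu> B) \<le> (\<Sum>i. ?p (A i))"
        by (rule LIMSEQ_le_const2[OF lim]) (intro exI allI impI part)
    qed
  qed
qed

lemma sets_pos_part: "sets (pos_part K \<nu>) = sets (borel_on K)"
  using sets.sets_measure_of_eq[of "borel_on K"] by (simp add: pos_part_def)

lemma emeasure_pos_part:
  assumes "A \<in> sets (borel_on K)"
  shows "emeasure (pos_part K \<nu>) A = (SUP B\<in>{B \<in> sets (borel_on K). B \<subseteq> A}. ennreal (\<nu> B))"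
proof (rule emeasure_measure_of[OF pos_part_def])
  have "{B \<in> sets (borel_on K). B \<subseteq> {}} = {{}}" by auto
  then show "positive (sets (pos_part K \<nu>)) (\<lambda>A. SUP B\<in>{B \<in> sets (borel_on K). B \<subseteq> A}. ennreal (\<nu> B))"
    using signed_empty by (simp add: positive_def)
  show "countably_additive (sets (pos_part K \<nu>)) (\<lambda>A. SUP B\<in>{B \<in> sets (borel_on K). B \<subseteq> A}. ennreal (\<nu> B))"
    unfolding sets_pos_part by (rule pos_countably_additive)
  show "sets (borel_on K) \<subseteq> Pow K"
    using sets.space_closed[of "borel_on K"] by simp
  show "A \<in> sets (pos_part K \<nu>)"
    unfolding sets_pos_part by (rule assms)
qed

text \<open>
  Call a set unbounded if its subsets have masses of arbitrarily large absolute value. An unbounded set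
  splits into two parts of large mass, at least one of which is unbounded again. Iterating yields a
  decreasing sequence of sets with masses tending to infinity, which contradicts continuity from above.
\<close>

lemma signed_bounded: "\<exists>c. \<forall>B\<in>sets (borel_on K). \<bar>\<nu> B\<bar> \<le> c"
proof (rule ccontr)
  let ?S = "sets (borel_on K)"
  define unb where "unb A \<longleftrightarrow> (\<forall>c. \<exists>B\<in>?S. B \<subseteq> A \<and> c < \<bar>\<nu> B\<bar>)" for A
  assume unbounded: "\<not> ?thesis"
  have K: "unb K"
    unfolding unb_def
  proof
    fix c
    obtain B where "B \<in> ?S" "c < \<bar>\<nu> B\<bar>"
      using unbounded by (meson not_le)
    moreover have "B \<subseteq> K"
      using sets.sets_into_space[OF \<open>B \<in> ?S\<close>] by simp
    ultimately show "\<exists>B\<in>?S. B \<subseteq> K \<and> c < \<bar>\<nu> B\<bar>"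
      by blast
  qed
  have KS: "K \<in> ?S"
    using sets.top[of "borel_on K"] by simp
  have step: "\<exists>A'. (A' \<in> ?S \<and> unb A' \<and> N \<le> \<bar>\<nu> A'\<bar>) \<and> A' \<subseteq> A" if A: "A \<in> ?S" "unb A" for A and N :: real
  proof -
    obtain B where B: "B \<in> ?S" "B \<subseteq> A" "\<bar>\<nu> A\<bar> + \<bar>N\<bar> < \<bar>\<nu> B\<bar>"
      using A(2) unfolding unb_def by blast
    have "\<nu> (A - B) = \<nu> A - \<nu> B"
      using A B by (intro signed_Diff)
    then have AB: "N \<le> \<bar>\<nu> (A - B)\<bar>" "N \<le> \<bar>\<nu> B\<bar>"
      using B by linarith+
    \<comment> \<open>Bounds for the two parts would add up to a bound for \<open>A\<close>.\<close>
    have "unb B \<or> unb (A - B)"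
    proof (rule ccontr)
      assume "\<not> (unb B \<or> unb (A - B))"
      then obtain c d where c: "\<And>C. C \<in> ?S \<Longrightarrow> C \<subseteq> B \<Longrightarrow> \<bar>\<nu> C\<bar> \<le> c"
        and d: "\<And>C. C \<in> ?S \<Longrightarrow> C \<subseteq> A - B \<Longrightarrow> \<bar>\<nu> C\<bar> \<le> d"
        unfolding unb_def by (metis not_le)
      obtain C where C: "C \<in> ?S" "C \<subseteq> A" "c + d < \<bar>\<nu> C\<bar>"
        using A(2) unfolding unb_def by blast
      have "\<nu> ((C \<inter> B) \<union> (C - B)) = \<nu> (C \<inter> B) + \<nu> (C - B)"
        using B C by (intro signed_Un) auto
      then have "\<nu> C = \<nu> (C \<inter> B) + \<nu> (C - B)"
        by (simp add: Int_Diff_Un)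
      moreover have "\<bar>\<nu> (C \<inter> B)\<bar> \<le> c" "\<bar>\<nu> (C - B)\<bar> \<le> d"
        using B C by (auto intro!: c d)
      ultimately show False using C by linarith
    qed
    then show ?thesis
      using A B AB by auto
  qed
  have "\<exists>A. \<forall>n. (A n \<in> ?S \<and> unb (A n) \<and> real n \<le> \<bar>\<nu> (A n)\<bar>) \<and> A (Suc n) \<subseteq> A n"
    using K KS step by (intro dependent_nat_choice) auto
  then obtain A where A: "\<And>n. A n \<in> ?S" "\<And>n. real n \<le> \<bar>\<nu> (A n)\<bar>" "\<And>n. A (Suc n) \<subseteq> A n"
    by blast
  \<comment> \<open>Passing to complements turns \<open>A\<close> into an increasing sequence.\<close>
  have "disjoint_family (\<lambda>i. (K - A (Suc i)) - (K - A i))"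
    by (rule disjoint_family_Suc) (use A(3) in auto)
  moreover have "(K - A (Suc i)) - (K - A i) = A i - A (Suc i)" for i
    using Int_in_borel_on[OF A(1)[of i]] by auto
  ultimately have "(\<lambda>i. \<nu> (A i - A (Suc i))) sums \<nu> (\<Union>i. A i - A (Suc i))"
    using A(1) by (intro signed_sums) auto
  then have "(\<lambda>i. \<nu> (A i) - \<nu> (A (Suc i))) sums \<nu> (\<Union>i. A i - A (Suc i))"
    using A by (simp add: signed_Diff)
  then have "(\<lambda>n. \<nu> (A 0) - \<nu> (A n)) \<longlonglongrightarrow> \<nu> (\<Union>i. A i - A (Suc i))"
    unfolding sums_def sum_lessThan_telescope'[of "\<lambda>i. \<nu> (A i)"] .
  then have "Bseq (\<lambda>n. \<nu> (A 0) - \<nu> (A n))"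
    by (intro convergent_imp_Bseq) (auto simp: convergent_def)
  then obtain c where c: "\<And>n. \<bar>\<nu> (A 0) - \<nu> (A n)\<bar> \<le> c"
    by (auto simp: Bseq_def)
  have "real n \<le> c + \<bar>\<nu> (A 0)\<bar>" for n
    using A(2)[of n] c[of n] by linarith
  then show False
    using reals_Archimedean2[of "c + \<bar>\<nu> (A 0)\<bar>"] by (meson not_le)
qed

lemma finite_pos_part: "finite_measure (pos_part K \<nu>)"
proof (rule finite_measureI)
  obtain c where c: "\<And>B. B \<in> sets (borel_on K) \<Longrightarrow> \<bar>\<nu> B\<bar> \<le> c"
    using signed_bounded by blast
  have space: "space (pos_part K \<nu>) = K"
    using sets_eq_imp_space_eq[OF sets_pos_part] by simp
  have "emeasure (pos_part K \<nu>) K \<le> ennreal c"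
    unfolding emeasure_pos_part[OF sets.top[of "borel_on K", unfolded space_borel_on]]
    using c by (intro SUP_least ennreal_leI) (auto dest: abs_le_D1)
  then have "emeasure (pos_part K \<nu>) K < top"
    using ennreal_less_top by (rule le_less_trans)
  then show "emeasure (pos_part K \<nu>) (space (pos_part K \<nu>)) \<noteq> \<infinity>"
    unfolding space infinity_ennreal_def by (rule less_imp_neq)
qed

end

text \<open>
  For \<open>B \<subseteq> A\<close>, the identity \<open>\<nu> B = \<nu> A - \<nu> (A - B)\<close> compares the supremum that defines the positive part
  with the one that defines the negative part.
\<close>

lemma jordan_le:
  assumes \<nu>: "\<nu> \<in> signed_measures K" and A: "A \<in> sets (borel_on K)"
  shows "measure (pos_part K \<nu>) A \<le> \<nu> A + measure (pos_part K (\<lambda>A. - \<nu> A)) A"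
proof -
  interpret P: finite_measure "pos_part K \<nu>"
    by (rule finite_pos_part[OF \<nu>])
  interpret N: finite_measure "pos_part K (\<lambda>A. - \<nu> A)"
    by (rule finite_pos_part[OF signed_uminus[OF \<nu>]])
  have N: "- \<nu> B \<le> measure (pos_part K (\<lambda>A. - \<nu> A)) A" if "B \<in> sets (borel_on K)" "B \<subseteq> A" for B
  proof -
    have "ennreal (- \<nu> B) \<le> emeasure (pos_part K (\<lambda>A. - \<nu> A)) A"
      unfolding emeasure_pos_part[OF signed_uminus[OF \<nu>] A] using that by (intro SUP_upper) auto
    then show ?thesis
      by (simp add: N.emeasure_eq_measure)
  qed
  have "emeasure (pos_part K \<nu>) A \<le> ennreal (\<nu> A + measure (pos_part K (\<lambda>A. - \<nu> A)) A)"
    unfolding emeasure_pos_part[OF \<nu> A]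
  proof (rule SUP_least, clarify)
    fix B assume B: "B \<in> sets (borel_on K)" "B \<subseteq> A"
    have "\<nu> (A - B) = \<nu> A - \<nu> B"
      using A B by (intro signed_Diff[OF \<nu>])
    then show "ennreal (\<nu> B) \<le> ennreal (\<nu> A + measure (pos_part K (\<lambda>A. - \<nu> A)) A)"
      using N[of "A - B"] A B by (intro ennreal_leI) auto
  qed
  then show ?thesis
    using N[of A] A unfolding P.emeasure_eq_measure by (subst (asm) ennreal_le_iff) auto
qed

lemma jordan_decomposition:
  assumes "\<nu> \<in> signed_measures K"
  shows "\<nu> A = measure (pos_part K \<nu>) A - measure (pos_part K (\<lambda>A. - \<nu> A)) A"
proof (cases "A \<in> sets (borel_on K)")
  case True
  show ?thesis
    using jordan_le[OF assms True] jordan_le[OF signed_uminus[OF assms] True]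
    unfolding minus_minus by linarith
next
  case False
  then show ?thesis
    using signed_outside[OF assms] sets_pos_part[OF assms] sets_pos_part[OF signed_uminus[OF assms]]
    by (simp add: measure_notin_sets)
qed

definition finite_borel :: "'a::topological_space set \<Rightarrow> 'a measure \<Rightarrow> bool" where
  "finite_borel K P \<longleftrightarrow> finite_measure P \<and> sets P = sets (borel_on K)"

lemma space_finite_borel: "finite_borel K P \<Longrightarrow> space P = K"
  using sets_eq_imp_space_eq[of P "borel_on K"] by (simp add: finite_borel_def)

lemma finite_borel_pos_part: "\<nu> \<in> signed_measures K \<Longrightarrow> finite_borel K (pos_part K \<nu>)"
  by (simp add: finite_borel_def finite_pos_part sets_pos_part)

lemma signed_measure_diff:
  assumes P: "finite_borel K P" and N: "finite_borel K N"
  shows "(\<lambda>A. measure P A - measure N A) \<in> signed_measures K"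
proof -
  interpret P: finite_measure P using P by (simp add: finite_borel_def)
  interpret N: finite_measure N using N by (simp add: finite_borel_def)
  show ?thesis
    unfolding signed_measures_def
    using P N by (auto simp: finite_borel_def measure_notin_sets
        intro!: sums_diff P.finite_measure_UNION N.finite_measure_UNION)
qed

lemma integrable_finite_borel:
  fixes f :: "'a::topological_space \<Rightarrow> real"
  assumes "finite_borel K P" "f \<in> borel_measurable (borel_on K)" "\<And>x. x \<in> K \<Longrightarrow> \<bar>f x\<bar> \<le> B"
  shows "integrable P f"
proof -
  have "f \<in> borel_measurable P"
    using assms(1,2) measurable_cong_sets[of P "borel_on K" borel borel] by (auto simp: finite_borel_def)
  then show ?thesis
    using assms space_finite_borel[OF assms(1)]
    by (intro finite_measure.integrable_const_bound[of P _ B]) (auto simp: finite_borel_def)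
qed

text \<open>
  A signed measure is a difference of finite measures in many ways, and \<^const>\<open>pairing\<close> refers to one of
  them. Since \<open>P - N' = P' - N\<close> is equivalent to \<open>P + N = P' + N'\<close>, independence of the choice amounts to
  an identity between sums of integrals of positive measures.
\<close>

lemma nn_integral_add_cong:
  assumes fin: "finite_borel K P" "finite_borel K N" "finite_borel K P'" "finite_borel K N'"
    and eq: "\<And>A. A \<in> sets (borel_on K) \<Longrightarrow> measure P A + measure N A = measure P' A + measure N' A"
    and f: "f \<in> borel_measurable (borel_on K)"
  shows "(\<integral>\<^sup>+x. f x \<partial>P) + (\<integral>\<^sup>+x. f x \<partial>N) = (\<integral>\<^sup>+x. f x \<partial>P') + (\<integral>\<^sup>+x. f x \<partial>N')"
  using f
proof (induction rule: borel_measurable_induct)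
  case (cong f g)
  have "(\<integral>\<^sup>+x. f x \<partial>Q) = (\<integral>\<^sup>+x. g x \<partial>Q)" if "finite_borel K Q" for Q
    using cong(3) space_finite_borel[OF that] by (intro nn_integral_cong) simp
  then show ?case using cong(4) fin by simp
next
  case (set A)
  have "emeasure P A + emeasure N A = emeasure P' A + emeasure N' A"
    using eq[OF set] fin
    by (simp add: finite_borel_def finite_measure.emeasure_eq_measure flip: ennreal_plus)
  then show ?case
    using fin set by (simp add: finite_borel_def)
next
  case (mult u c)
  have "u \<in> borel_measurable Q" if "finite_borel K Q" for Q
    using mult(2) that measurable_cong_sets[of Q "borel_on K" borel borel] by (auto simp: finite_borel_def)
  then show ?case
    using mult(4) fin by (simp add: nn_integral_cmult flip: distrib_left)
next
  case (add u v)
  have "u \<in> borel_measurable Q" "v \<in> borel_measurable Q" if "finite_borel K Q" for Q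
    using add that measurable_cong_sets[of Q "borel_on K" borel borel] by (auto simp: finite_borel_def)
  then show ?case
    using add(3,6) fin by (simp add: nn_integral_add) (metis (no_types, lifting) add.assoc add.commute add(3,6,7))
next
  case (seq U)
  have m: "U i \<in> borel_measurable Q" if "finite_borel K Q" for Q i
    using seq(1) that measurable_cong_sets[of Q "borel_on K" borel borel] by (auto simp: finite_borel_def)
  have "(\<integral>\<^sup>+x. (SUP i. U i) x \<partial>Q) = (SUP i. \<integral>\<^sup>+x. U i x \<partial>Q)" if "finite_borel K Q" for Q
    using nn_integral_monotone_convergence_SUP[OF seq(3) m[OF that]] by (simp add: image_image)
  moreover have "(SUP i. \<integral>\<^sup>+x. U i x \<partial>Q) + (SUP i. \<integral>\<^sup>+x. U i x \<partial>R) = (SUP i. (\<integral>\<^sup>+x. U i x \<partial>Q) + (\<integral>\<^sup>+x. U i x \<partial>R))" for Q R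
    using seq(3) by (intro ennreal_SUP_add[symmetric]) (auto simp: incseq_def le_fun_def intro!: nn_integral_mono)
  ultimately show ?case
    using fin seq by simp
qed

lemma integral_add_cong:
  fixes f :: "'a::topological_space \<Rightarrow> real"
  assumes fin: "finite_borel K P" "finite_borel K N" "finite_borel K P'" "finite_borel K N'"
    and eq: "\<And>A. A \<in> sets (borel_on K) \<Longrightarrow> measure P A + measure N A = measure P' A + measure N' A"
    and f: "f \<in> borel_measurable (borel_on K)" "\<And>x. x \<in> K \<Longrightarrow> \<bar>f x\<bar> \<le> B"
  shows "(\<integral>x. f x \<partial>P) + (\<integral>x. f x \<partial>N) = (\<integral>x. f x \<partial>P') + (\<integral>x. f x \<partial>N')"
proof -
  have nn: "(\<integral>\<^sup>+x. ennreal (f x + B) \<partial>Q) = ennreal ((\<integral>x. f x \<partial>Q) + B * measure Q K)"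
    and nn0: "0 \<le> (\<integral>x. f x \<partial>Q) + B * measure Q K"
    if Q: "finite_borel K Q" for Q
  proof -
    interpret Q: finite_measure Q using Q by (simp add: finite_borel_def)
    have nonneg: "AE x in Q. 0 \<le> f x + B"
      using f(2) space_finite_borel[OF Q] by (intro AE_I2) fastforce
    have int: "integrable Q (\<lambda>x. f x + B)"
      using integrable_finite_borel[OF Q f] by (intro Bochner_Integration.integrable_add) auto
    have *: "(\<integral>x. f x + B \<partial>Q) = (\<integral>x. f x \<partial>Q) + B * measure Q K"
      using integrable_finite_borel[OF Q f] space_finite_borel[OF Q] by simp
    show "(\<integral>\<^sup>+x. ennreal (f x + B) \<partial>Q) = ennreal ((\<integral>x. f x \<partial>Q) + B * measure Q K)"
      using nn_integral_eq_integral[OF int nonneg] * by simp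
    show "0 \<le> (\<integral>x. f x \<partial>Q) + B * measure Q K"
      using integral_nonneg_AE[OF nonneg] * by simp
  qed
  have "ennreal ((\<integral>x. f x \<partial>P) + B * measure P K) + ennreal ((\<integral>x. f x \<partial>N) + B * measure N K)
    = ennreal ((\<integral>x. f x \<partial>P') + B * measure P' K) + ennreal ((\<integral>x. f x \<partial>N') + B * measure N' K)"
    unfolding nn[OF fin(1), symmetric] nn[OF fin(2), symmetric] nn[OF fin(3), symmetric] nn[OF fin(4), symmetric]
    using f(1) by (intro nn_integral_add_cong[OF fin eq]) auto
  then have "((\<integral>x. f x \<partial>P) + B * measure P K) + ((\<integral>x. f x \<partial>N) + B * measure N K)
    = ((\<integral>x. f x \<partial>P') + B * measure P' K) + ((\<integral>x. f x \<partial>N') + B * measure N' K)"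
    using nn0 fin by (simp add: ennreal_inj flip: ennreal_plus)
  moreover have "B * (measure P K + measure N K) = B * (measure P' K + measure N' K)"
    using eq[of K] sets.top[of "borel_on K"] by simp
  ultimately show ?thesis
    by (simp add: distrib_left)
qed

lemma pairing_diff:
  fixes f :: "'a::topological_space \<Rightarrow> real"
  assumes K: "compact K" and P: "finite_borel K P" and N: "finite_borel K N" and f: "continuous_on K f"
  shows "pairing K (\<lambda>A. measure P A - measure N A) f = (\<integral>x. f x \<partial>P) - (\<integral>x. f x \<partial>N)"
proof -
  let ?\<nu> = "\<lambda>A. measure P A - measure N A"
  have \<nu>: "?\<nu> \<in> signed_measures K" by (rule signed_measure_diff[OF P N])
  obtain B where B: "\<And>x. x \<in> K \<Longrightarrow> norm (f x) \<le> B"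
    using bounded_cont_on_compact[OF K f] by blast
  have "(\<integral>x. f x \<partial>pos_part K ?\<nu>) + (\<integral>x. f x \<partial>N) = (\<integral>x. f x \<partial>P) + (\<integral>x. f x \<partial>pos_part K (\<lambda>A. - ?\<nu> A))"
    using jordan_decomposition[OF \<nu>] B
    by (intro integral_add_cong[of K _ _ _ _ _ B] finite_borel_pos_part \<nu> signed_uminus[OF \<nu>] P N
        borel_measurable_continuous_on_restrict f) (auto simp: algebra_simps)
  then show ?thesis
    by (simp add: pairing_def)
qed

lemma finite_borel_null: "finite_borel K (null_measure (borel_on K))"
  by (auto simp: finite_borel_def intro: finite_measureI)

lemma finite_borel_scale: "finite_borel K P \<Longrightarrow> finite_borel K (scale_measure (ennreal c) P)"
  by (auto simp: finite_borel_def emeasure_scale_measure finite_measure.emeasure_finite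
      ennreal_mult_eq_top_iff intro!: finite_measureI)

lemma measure_scale: "0 \<le> c \<Longrightarrow> measure (scale_measure (ennreal c) P) A = c * measure P A"
  by (simp add: measure_def enn2real_mult)

lemma signed_cmult: "\<nu> \<in> signed_measures K \<Longrightarrow> (\<lambda>A. c * \<nu> A) \<in> signed_measures K"
  by (auto simp: signed_measures_def intro: sums_mult)

lemma measure_signed: "finite_borel K P \<Longrightarrow> measure P \<in> signed_measures K"
  using signed_measure_diff[OF _ finite_borel_null, of K P] by simp

lemma pairing_measure:
  fixes f :: "'a::topological_space \<Rightarrow> real"
  assumes "compact K" "finite_borel K P" "continuous_on K f"
  shows "pairing K (measure P) f = (\<integral>x. f x \<partial>P)"
  using pairing_diff[OF assms(1,2) finite_borel_null assms(3)] by (simp add: integral_null_measure)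


lemma integral_scale:
  fixes f :: "'a \<Rightarrow> real"
  assumes "0 \<le> c" "f \<in> borel_measurable P"
  shows "(\<integral>x. f x \<partial>scale_measure (ennreal c) P) = c * (\<integral>x. f x \<partial>P)"
proof -
  have "scale_measure (ennreal c) P = density P (\<lambda>x. ennreal c)"
    by (intro measure_eqI) (simp_all add: emeasure_density_const)
  then show ?thesis
    using assms by (simp add: integral_real_density)
qed

lemma measurable_finite_borel:
  "finite_borel K P \<Longrightarrow> continuous_on K f \<Longrightarrow> f \<in> borel_measurable P"
  for f :: "'a::topological_space \<Rightarrow> real"
  using borel_measurable_continuous_on_restrict[of K f] measurable_cong_sets[of P "borel_on K" borel borel]
  by (auto simp: finite_borel_def)

lemma integrable_continuous:
  fixes f :: "'a::topological_space \<Rightarrow> real"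
  assumes "compact K" "finite_borel K P" "continuous_on K f"
  shows "integrable P f"
proof -
  obtain B where "\<And>x. x \<in> K \<Longrightarrow> norm (f x) \<le> B"
    using bounded_cont_on_compact[OF assms(1,3)] by blast
  then show ?thesis
    using assms by (intro integrable_finite_borel[of K _ _ B] borel_measurable_continuous_on_restrict) auto
qed

lemma pairing_cmult:
  fixes f :: "'a::topological_space \<Rightarrow> real"
  assumes K: "compact K" and \<nu>: "\<nu> \<in> signed_measures K" and f: "continuous_on K f"
  shows "pairing K (\<lambda>A. c * \<nu> A) f = c * pairing K \<nu> f"
proof -
  define P N where "P = pos_part K \<nu>" and "N = pos_part K (\<lambda>A. - \<nu> A)"
  have P: "finite_borel K P" and N: "finite_borel K N"
    using \<nu> by (simp_all add: P_def N_def finite_borel_pos_part signed_uminus)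
  have \<nu>_eq: "\<nu> A = measure P A - measure N A" for A
    unfolding P_def N_def by (rule jordan_decomposition[OF \<nu>])
  have pair: "pairing K \<nu> f = (\<integral>x. f x \<partial>P) - (\<integral>x. f x \<partial>N)"
    by (simp add: pairing_def P_def N_def)
  note meas = measurable_finite_borel[OF P f] measurable_finite_borel[OF N f]
  show ?thesis
  proof (cases "0 \<le> c")
    case True
    have "(\<lambda>A. c * \<nu> A) = (\<lambda>A. measure (scale_measure (ennreal c) P) A - measure (scale_measure (ennreal c) N) A)"
      using True by (simp add: measure_scale \<nu>_eq right_diff_distrib)
    then show ?thesis
      using True meas
      by (simp only: pairing_diff[OF K finite_borel_scale[OF P] finite_borel_scale[OF N] f]
          integral_scale pair right_diff_distrib)
  next
    case False
    then have c: "0 \<le> - c" by simp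
    have "(\<lambda>A. c * \<nu> A) = (\<lambda>A. measure (scale_measure (ennreal (- c)) N) A - measure (scale_measure (ennreal (- c)) P) A)"
      unfolding measure_scale[OF c] by (simp add: \<nu>_eq algebra_simps)
    then show ?thesis
      using c meas
      by (simp only: pairing_diff[OF K finite_borel_scale[OF N] finite_borel_scale[OF P] f]
          integral_scale pair) (simp add: algebra_simps)
  qed
qed

lemma pairing_Lipschitz:
  fixes \<nu> :: "'a::topological_space set \<Rightarrow> real"
  assumes K: "compact K" and \<nu>: "\<nu> \<in> signed_measures K"
  obtains c where "0 \<le> c" "\<And>f g e. continuous_on K f \<Longrightarrow> continuous_on K g \<Longrightarrow>
    (\<And>x. x \<in> K \<Longrightarrow> \<bar>f x - g x\<bar> \<le> e) \<Longrightarrow> \<bar>pairing K \<nu> f - pairing K \<nu> g\<bar> \<le> c * e"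
proof
  define P N where "P = pos_part K \<nu>" and "N = pos_part K (\<lambda>A. - \<nu> A)"
  have P: "finite_borel K P" and N: "finite_borel K N"
    using \<nu> by (simp_all add: P_def N_def finite_borel_pos_part signed_uminus)
  show "0 \<le> measure P K + measure N K" by simp
  fix f g :: "'a \<Rightarrow> real" and e
  assume f: "continuous_on K f" and g: "continuous_on K g" and fg: "\<And>x. x \<in> K \<Longrightarrow> \<bar>f x - g x\<bar> \<le> e"
  have *: "\<bar>(\<integral>x. f x \<partial>Q) - (\<integral>x. g x \<partial>Q)\<bar> \<le> measure Q K * e" if Q: "finite_borel K Q" for Q
  proof -
    interpret Q: finite_measure Q using Q by (simp add: finite_borel_def)
    note int = integrable_continuous[OF K Q f] integrable_continuous[OF K Q g]
    have "\<bar>\<integral>x. f x - g x \<partial>Q\<bar> \<le> (\<integral>x. \<bar>f x - g x\<bar> \<partial>Q)"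
      by (rule integral_abs_bound)
    also have "\<dots> \<le> (\<integral>x. e \<partial>Q)"
      using int fg space_finite_borel[OF Q] by (intro integral_mono) auto
    also have "\<dots> = measure Q K * e"
      using space_finite_borel[OF Q] by simp
    finally show ?thesis
      using int by simp
  qed
  show "\<bar>pairing K \<nu> f - pairing K \<nu> g\<bar> \<le> (measure P K + measure N K) * e"
    using *[OF P] *[OF N] by (simp add: pairing_def P_def N_def distrib_right)
qed

text \<open>
  Continuous functions determine the mass of relatively open sets by dominated convergence. These sets
  are stable under intersection and generate the Borel sets of \<open>K\<close>.
\<close>

lemma signed_measure_eqI:
  fixes \<nu> \<nu>' :: "'a::metric_space set \<Rightarrow> real"
  assumes K: "compact K" and \<nu>: "\<nu> \<in> signed_measures K" and \<nu>': "\<nu>' \<in> signed_measures K"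
    and eq: "\<And>f. f \<in> cont_space K \<Longrightarrow> pairing K \<nu> f = pairing K \<nu>' f"
  shows "\<nu> = \<nu>'"
proof
  fix A
  have gen: "sets (borel_on K) = sigma_sets K ((\<inter>) K ` {U. open U})"
    using K by (intro positive_functional.borel_on_eq_sigma[of _ "\<lambda>_. 0"]) (simp add: positive_functional_def)
  have lim: "(\<lambda>m. pairing K \<xi> (restrict (h m) K)) \<longlonglongrightarrow> \<xi> (K \<inter> U)"
    if \<xi>: "\<xi> \<in> signed_measures K" and U: "open U" and h: "\<And>m. continuous_on UNIV (h m)"
      "\<And>m x. 0 \<le> h m x \<and> h m x \<le> 1" "\<And>x. (\<lambda>m. h m x) \<longlonglongrightarrow> indicator U x" for \<xi> h U
  proof -
    have hK: "continuous_on K (h m)" for m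
      using h(1) continuous_on_subset by blast
    have conv: "(\<lambda>m. \<integral>x. restrict (h m) K x \<partial>Q) \<longlonglongrightarrow> measure Q (K \<inter> U)" if Q: "finite_borel K Q" for Q
    proof -
      interpret Q: finite_measure Q using Q by (simp add: finite_borel_def)
      have KU: "K \<inter> U \<in> sets Q"
        using Q U by (auto simp: finite_borel_def gen)
      have "(\<lambda>m. \<integral>x. h m x \<partial>Q) \<longlonglongrightarrow> (\<integral>x. indicator (K \<inter> U) x \<partial>Q)"
      proof (rule integral_dominated_convergence[where w = "\<lambda>_. 1"])
        show "AE x in Q. (\<lambda>m. h m x) \<longlonglongrightarrow> indicator (K \<inter> U) x"
          using h(3) space_finite_borel[OF Q] by (intro AE_I2) (simp add: indicator_def)
      qed (use h(2) KU measurable_finite_borel[OF Q hK] in auto)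
      also have "(\<integral>x. indicator (K \<inter> U) x \<partial>Q) = measure Q (K \<inter> U)"
        using space_finite_borel[OF Q] by (simp add: Int_ac)
      also have "(\<lambda>m. \<integral>x. h m x \<partial>Q) = (\<lambda>m. \<integral>x. restrict (h m) K x \<partial>Q)"
        using space_finite_borel[OF Q] by (intro ext Bochner_Integration.integral_cong) auto
      finally show ?thesis .
    qed
    show ?thesis
      unfolding pairing_def jordan_decomposition[OF \<xi>, of "K \<inter> U"]
      by (intro tendsto_diff conv finite_borel_pos_part \<xi> signed_uminus[OF \<xi>])
  qed
  have opens: "\<nu> (K \<inter> U) = \<nu>' (K \<inter> U)" if U: "open U" for U
  proof -
    obtain h :: "nat \<Rightarrow> 'a \<Rightarrow> real" where h: "\<And>m. continuous_on UNIV (h m)"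
      "\<And>m x. 0 \<le> h m x \<and> h m x \<le> 1" "\<And>x. (\<lambda>m. h m x) \<longlonglongrightarrow> indicator U x"
      and "\<And>m n x. m \<le> n \<Longrightarrow> h m x \<le> h n x" "\<And>x. h 0 x = 0" "\<And>m x. x \<notin> U \<Longrightarrow> h m x = 0"
      using continuous_approx_open[OF U] by blast
    have "restrict (h m) K \<in> cont_space K" for m
      using continuous_on_subset[OF h(1), of K] by (simp add: cont_space_def cong: continuous_on_cong)
    then have "pairing K \<nu> (restrict (h m) K) = pairing K \<nu>' (restrict (h m) K)" for m
      by (rule eq)
    then show ?thesis
      using lim[OF \<nu> U h] lim[OF \<nu>' U h] LIMSEQ_unique by simp
  qed
  show "\<nu> A = \<nu>' A"
  proof (cases "A \<in> sets (borel_on K)")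
    case True
    have "Int_stable ((\<inter>) K ` {U. open U})"
    proof (rule Int_stableI, clarsimp)
      fix U V :: "'a set" assume "open U" "open V"
      then show "K \<inter> U \<inter> (K \<inter> V) \<in> (\<inter>) K ` {U. open U}"
        by (intro image_eqI[of _ _ "U \<inter> V"]) auto
    qed
    then show ?thesis
      using _ True[unfolded gen]
    proof (rule sigma_sets_induct_disjoint)
      show "\<nu> B = \<nu>' B" if "B \<in> (\<inter>) K ` {U. open U}" for B
        using that opens by auto
      show "\<nu> {} = \<nu>' {}"
        using signed_empty[OF \<nu>] signed_empty[OF \<nu>'] by simp
    next
      have KS: "K \<in> sets (borel_on K)" using sets.top[of "borel_on K"] by simp
      have "\<nu> K = \<nu>' K" using opens[OF open_UNIV] by simp
      then show "\<nu> (K - B) = \<nu>' (K - B)"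
        if "B \<in> sigma_sets K ((\<inter>) K ` {U. open U})" "\<nu> B = \<nu>' B" for B
        using that KS signed_Diff[OF \<nu>, of B K] signed_Diff[OF \<nu>', of B K]
          sets.sets_into_space[of B "borel_on K"]
        unfolding gen[symmetric] by auto
    next
      fix B :: "nat \<Rightarrow> 'a set"
      assume B: "disjoint_family B" "range B \<subseteq> sigma_sets K ((\<inter>) K ` {U. open U})" "\<And>i. \<nu> (B i) = \<nu>' (B i)"
      then show "\<nu> (\<Union>i. B i) = \<nu>' (\<Union>i. B i)"
        using signed_sums[OF \<nu>, of B] signed_sums[OF \<nu>', of B] sums_unique2 unfolding gen by auto
    qed auto
  next
    case False
    then show ?thesis
      using signed_outside[OF \<nu>] signed_outside[OF \<nu>'] by simp
  qed
qed

locale positive_operator =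
  fixes K :: "'a::metric_space set" and T :: "('a \<Rightarrow> real) \<Rightarrow> 'a \<Rightarrow> real"
  assumes compact_K: "compact K"
    and T_cont: "\<And>f. continuous_on K f \<Longrightarrow> continuous_on K (T f)"
    and T_linear: "\<And>f g c x. continuous_on K f \<Longrightarrow> continuous_on K g \<Longrightarrow> x \<in> K \<Longrightarrow>
      T (\<lambda>x. f x + c * g x) x = T f x + c * T g x"
    and T_nonneg: "\<And>f x. continuous_on K f \<Longrightarrow> (\<And>x. x \<in> K \<Longrightarrow> 0 \<le> f x) \<Longrightarrow> x \<in> K \<Longrightarrow> 0 \<le> T f x"
begin

text \<open>
  The functional \<open>f \<mapsto> \<integral> T f dP\<close> is positive and linear, hence given by a measure.
\<close>

lemma dual_measure:
  assumes P: "finite_borel K P"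
  shows "\<exists>Q. finite_borel K Q \<and> (\<forall>f. continuous_on K f \<longrightarrow> (\<integral>x. f x \<partial>Q) = (\<integral>x. T f x \<partial>P))"
proof -
  interpret positive_functional K "\<lambda>f. \<integral>x. T f x \<partial>P"
  proof
    fix f g :: "'a \<Rightarrow> real" and c assume f: "continuous_on K f" and g: "continuous_on K g"
    have "(\<integral>x. T (\<lambda>x. f x + c * g x) x \<partial>P) = (\<integral>x. T f x + c * T g x \<partial>P)"
      using T_linear[OF f g] space_finite_borel[OF P] by (intro Bochner_Integration.integral_cong) auto
    also have "\<dots> = (\<integral>x. T f x \<partial>P) + c * (\<integral>x. T g x \<partial>P)"
      using integrable_continuous[OF compact_K P T_cont[OF f]] integrable_continuous[OF compact_K P T_cont[OF g]]
      by simp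
    finally show "(\<integral>x. T (\<lambda>x. f x + c * g x) x \<partial>P) = (\<integral>x. T f x \<partial>P) + c * (\<integral>x. T g x \<partial>P)" .
  next
    fix f :: "'a \<Rightarrow> real" assume "continuous_on K f" "\<And>x. x \<in> K \<Longrightarrow> 0 \<le> f x"
    then show "0 \<le> (\<integral>x. T f x \<partial>P)"
      using T_nonneg space_finite_borel[OF P] by (intro integral_nonneg_AE AE_I2) auto
  qed (rule compact_K)
  from representation show ?thesis
    by (simp add: finite_borel_def conj_assoc)
qed

lemma dual_op:
  assumes \<xi>: "\<xi> \<in> signed_measures K"
  shows dual_op_signed: "dual_op K T \<xi> \<in> signed_measures K"
    and pairing_dual_op: "f \<in> cont_space K \<Longrightarrow> pairing K (dual_op K T \<xi>) f = pairing K \<xi> (T f)"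
proof -
  define P N where "P = pos_part K \<xi>" and "N = pos_part K (\<lambda>A. - \<xi> A)"
  have P: "finite_borel K P" and N: "finite_borel K N"
    using \<xi> by (simp_all add: P_def N_def finite_borel_pos_part signed_uminus)
  obtain P' where P': "finite_borel K P'" "\<And>f. continuous_on K f \<Longrightarrow> (\<integral>x. f x \<partial>P') = (\<integral>x. T f x \<partial>P)"
    using dual_measure[OF P] by blast
  obtain N' where N': "finite_borel K N'" "\<And>f. continuous_on K f \<Longrightarrow> (\<integral>x. f x \<partial>N') = (\<integral>x. T f x \<partial>N)"
    using dual_measure[OF N] by blast
  let ?\<nu> = "\<lambda>A. measure P' A - measure N' A"
  have \<nu>: "?\<nu> \<in> signed_measures K"
    by (rule signed_measure_diff[OF P'(1) N'(1)])
  have pair: "pairing K ?\<nu> f = pairing K \<xi> (T f)" if "f \<in> cont_space K" for f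
    using that P'(2) N'(2) pairing_diff[OF compact_K P'(1) N'(1), of f]
    by (simp add: cont_space_def pairing_def P_def N_def)
  let ?Q = "\<lambda>\<nu>. \<nu> \<in> signed_measures K \<and> (\<forall>f\<in>cont_space K. pairing K \<nu> f = pairing K \<xi> (T f))"
  have "?Q (THE \<nu>. ?Q \<nu>)"
  proof (rule theI[of ?Q])
    show "?Q ?\<nu>"
      using \<nu> pair by blast
    fix \<nu>' assume "\<nu>' \<in> signed_measures K \<and> (\<forall>f\<in>cont_space K. pairing K \<nu>' f = pairing K \<xi> (T f))"
    then show "\<nu>' = ?\<nu>"
      using pair \<nu> by (intro signed_measure_eqI[OF compact_K]) auto
  qed
  then have "?Q (dual_op K T \<xi>)"
    unfolding dual_op_def .
  then show "dual_op K T \<xi> \<in> signed_measures K"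
    and "f \<in> cont_space K \<Longrightarrow> pairing K (dual_op K T \<xi>) f = pairing K \<xi> (T f)"
    by auto
qed

end
lemma pairing_scale:
  "pairing K \<nu> (\<lambda>x. c * f x) = c * pairing K \<nu> f"
  by (simp add: pairing_def right_diff_distrib)

lemma pairing_tendsto:
  fixes \<nu> :: "'a::topological_space set \<Rightarrow> real"
  assumes K: "compact K" and \<nu>: "\<nu> \<in> signed_measures K"
    and lim: "uniform_limit K F f sequentially" and F: "\<And>n. continuous_on K (F n)"
  shows "(\<lambda>n. pairing K \<nu> (F n)) \<longlonglongrightarrow> pairing K \<nu> f"
proof (rule tendstoI)
  fix e :: real assume e: "0 < e"
  have f: "continuous_on K f"
    by (rule uniform_limit_theorem[OF _ lim]) (auto simp: F)
  obtain c where c: "0 \<le> c" "\<And>f g e. continuous_on K f \<Longrightarrow> continuous_on K g \<Longrightarrow>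
    (\<And>x. x \<in> K \<Longrightarrow> \<bar>f x - g x\<bar> \<le> e) \<Longrightarrow> \<bar>pairing K \<nu> f - pairing K \<nu> g\<bar> \<le> c * e"
    using pairing_Lipschitz[OF K \<nu>] by blast
  define d where "d = e / (c + 1)"
  have d: "0 < d" using e c by (simp add: d_def)
  have "\<forall>\<^sub>F n in sequentially. \<forall>x\<in>K. dist (F n x) (f x) < d"
    using lim d by (auto simp: uniform_limit_iff)
  then show "\<forall>\<^sub>F n in sequentially. dist (pairing K \<nu> (F n)) (pairing K \<nu> f) < e"
  proof eventually_elim
    case (elim n)
    have "\<bar>pairing K \<nu> (F n) - pairing K \<nu> f\<bar> \<le> c * d"
      using elim by (intro c(2) F f) (auto simp: dist_real_def less_imp_le)
    also have "\<dots> < (c + 1) * d" using d by simp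
    also have "\<dots> = e" using c by (simp add: d_def)
    finally show ?case by (simp add: dist_real_def)
  qed
qed

section \<open>Transfer operators with summable distortion\<close>

text \<open>
  \<open>u + C\<close> is subadditive and \<open>u - C\<close> is superadditive, so every slope \<open>(u n - C) / n\<close> lies below every slope
  \<open>(u m + C) / m\<close>. Any \<open>l\<close> between the two families works.
\<close>

lemma quasi_additive_linear:
  fixes u :: "nat \<Rightarrow> real"
  assumes qa: "\<And>m n. \<bar>u (m + n) - u m - u n\<bar> \<le> C"
  obtains l where "\<And>n. \<bar>u n - real n * l\<bar> \<le> C"
proof -
  have lower: "real (Suc n) * (u m - C) \<le> u (Suc n * m) - C" for n m
  proof (induction n)
    case (Suc n)
    then show ?case using qa[of m "Suc n * m"] by (simp add: algebra_simps abs_le_iff)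
  qed simp
  have upper: "u (Suc n * m) + C \<le> real (Suc n) * (u m + C)" for n m
  proof (induction n)
    case (Suc n)
    then show ?case using qa[of m "Suc n * m"] by (simp add: algebra_simps abs_le_iff)
  qed simp
  have C: "0 \<le> C" using qa[of 0 0] by linarith
  have cross: "(u (Suc n) - C) / Suc n \<le> (u (Suc m) + C) / Suc m" for m n
  proof -
    have "real (Suc m) * (u (Suc n) - C) \<le> u (Suc m * Suc n) - C" by (rule lower)
    also have "\<dots> \<le> u (Suc n * Suc m) + C" using C by (simp add: mult.commute)
    also have "\<dots> \<le> real (Suc n) * (u (Suc m) + C)" by (rule upper)
    finally show ?thesis by (simp add: field_simps)
  qed
  define l where "l = (SUP n. (u (Suc n) - C) / Suc n)"
  have "bdd_above (range (\<lambda>n. (u (Suc n) - C) / Suc n))"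
    using cross[of _ 0] by (intro bdd_aboveI) auto
  then have "(u (Suc n) - C) / Suc n \<le> l" for n
    unfolding l_def by (rule cSUP_upper[rotated]) simp
  moreover have "l \<le> (u (Suc n) + C) / Suc n" for n
    unfolding l_def using cross by (intro cSUP_least) auto
  ultimately have "\<bar>u (Suc n) - real (Suc n) * l\<bar> \<le> C" for n
    by (simp add: abs_le_iff field_simps del: of_nat_Suc)
  moreover have "\<bar>u 0 - real 0 * l\<bar> \<le> C" using qa[of 0 0] by simp
  ultimately have "\<bar>u n - real n * l\<bar> \<le> C" for n by (cases n) auto
  then show ?thesis using that by blast
qed

text \<open>
  \<open>V x y\<close> bounds the distortion along whole orbits: it stands for the sum of the moduli of the logarithms
  of the weights over all later steps. The hypothesis \<open>distortion\<close> says that one step uses up its share,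
  so that the inequality telescopes along an orbit without mention of words.
\<close>

locale ruelle_system =
  fixes K :: "'a::euclidean_space set" and s :: "nat \<Rightarrow> 'a \<Rightarrow> 'a" and p :: "nat \<Rightarrow> 'a \<Rightarrow> real"
    and r :: real and V :: "'a \<Rightarrow> 'a \<Rightarrow> real" and C :: real
  assumes compact_K: "compact K" and K_ne: "K \<noteq> {}"
    and s_in: "\<And>j x. x \<in> K \<Longrightarrow> s j x \<in> K"
    and r: "0 < r" "r < 1"
    and contraction: "\<And>j x y. x \<in> K \<Longrightarrow> y \<in> K \<Longrightarrow> dist (s j x) (s j y) \<le> r * dist x y"
    and p_pos: "\<And>j x. x \<in> K \<Longrightarrow> 0 < p j x"
    and p_summable: "\<And>x. x \<in> K \<Longrightarrow> summable (\<lambda>j. p j (s j x))"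
    and V_nonneg: "\<And>x y. x \<in> K \<Longrightarrow> y \<in> K \<Longrightarrow> 0 \<le> V x y"
    and V_bound: "\<And>x y. x \<in> K \<Longrightarrow> y \<in> K \<Longrightarrow> V x y \<le> C"
    and V_small: "\<And>e. 0 < e \<Longrightarrow> \<exists>d>0. \<forall>x\<in>K. \<forall>y\<in>K. dist x y < d \<longrightarrow> V x y < e"
    and distortion: "\<And>j x y. x \<in> K \<Longrightarrow> y \<in> K \<Longrightarrow>
      p j (s j x) * exp (V (s j x) (s j y)) \<le> exp (V x y) * p j (s j y)"
begin

abbreviation g :: "nat \<Rightarrow> 'a \<Rightarrow> real" where "g j x \<equiv> p j (s j x)"

abbreviation T :: "('a \<Rightarrow> 'b::banach) \<Rightarrow> 'a \<Rightarrow> 'b" where "T \<equiv> ruelle K s p"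

lemma C_nonneg: "0 \<le> C"
  using K_ne V_nonneg V_bound order_trans by blast

lemma g_pos: "x \<in> K \<Longrightarrow> 0 < g j x"
  by (intro p_pos s_in)

lemma g_le:
  assumes "x \<in> K" "y \<in> K"
  shows "g j x \<le> exp (V x y) * g j y"
proof -
  have "g j x * 1 \<le> g j x * exp (V (s j x) (s j y))"
    using g_pos[OF assms(1), of j] V_nonneg[of "s j x" "s j y"] s_in assms
    by (intro mult_left_mono) auto
  also have "\<dots> \<le> exp (V x y) * g j y"
    by (rule distortion[OF assms])
  finally show ?thesis by simp
qed

lemma g_dominated:
  obtains G where "summable G" "\<And>j. 0 \<le> G j" "\<And>j x. x \<in> K \<Longrightarrow> g j x \<le> G j"
proof -
  obtain x0 where x0: "x0 \<in> K" using K_ne by blast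
  show ?thesis
  proof (rule that[of "\<lambda>j. exp C * g j x0"])
    show "summable (\<lambda>j. exp C * g j x0)"
      by (intro summable_mult p_summable x0)
    show "0 \<le> exp C * g j x0" for j
      using g_pos[OF x0] by (simp add: less_imp_le)
    show "g j x \<le> exp C * g j x0" if "x \<in> K" for j x
    proof -
      have "g j x \<le> exp (V x x0) * g j x0" by (rule g_le[OF that x0])
      also have "\<dots> \<le> exp C * g j x0"
        using V_bound[OF that x0] g_pos[OF x0] by (intro mult_right_mono) (auto simp: less_imp_le)
      finally show ?thesis .
    qed
  qed
qed

lemma s_cont: "continuous_on K (s j)"
  using contraction by (rule continuous_on_contraction[OF r(2)])

lemma g_cont: "continuous_on K (g j)"
proof -
  have "continuous_on K (\<lambda>x. ln (g j x))"
    unfolding continuous_on_iff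
  proof (intro ballI allI impI)
    fix x and e :: real assume x: "x \<in> K" and "0 < e"
    then obtain d where d: "0 < d" "\<And>x y. x \<in> K \<Longrightarrow> y \<in> K \<Longrightarrow> dist x y < d \<Longrightarrow> V x y < e"
      using V_small[of e] by blast
    have le: "ln (g j y) - ln (g j z) \<le> V y z" if "y \<in> K" "z \<in> K" for y z
    proof -
      have "ln (g j y) \<le> ln (exp (V y z) * g j z)"
        using g_le[OF that, of j] g_pos[OF that(1), of j] g_pos[OF that(2), of j]
        by (subst ln_le_cancel_iff) auto
      also have "\<dots> = V y z + ln (g j z)"
        using g_pos[OF that(2), of j] by (simp add: ln_mult)
      finally show ?thesis by simp
    qed
    have "dist (ln (g j y)) (ln (g j x)) < e" if "y \<in> K" "dist y x < d" for y
      using le[OF that(1) x] le[OF x that(1)] d(2)[OF that(1) x] d(2)[OF x that(1)] that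
      by (auto simp: dist_real_def dist_commute abs_less_iff)
    then show "\<exists>d>0. \<forall>y\<in>K. dist y x < d \<longrightarrow> dist (ln (g j y)) (ln (g j x)) < e"
      using d(1) by blast
  qed
  then have "continuous_on K (\<lambda>x. exp (ln (g j x)))"
    by (rule continuous_on_exp)
  then show ?thesis
    by (rule continuous_on_eq) (simp add: g_pos)
qed

lemma T_apply: "x \<in> K \<Longrightarrow> T f x = (\<Sum>j. g j x *\<^sub>R f (s j x))"
  by (simp add: ruelle_def)

lemma T_cong: "(\<And>x. x \<in> K \<Longrightarrow> f x = f' x) \<Longrightarrow> T f = T f'"
  unfolding ruelle_def by (intro restrict_ext suminf_cong) (simp add: s_in)

lemma terms_summable_norm:
  fixes f :: "'a \<Rightarrow> 'b::banach"
  assumes f: "continuous_on K f" and x: "x \<in> K"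
  shows "summable (\<lambda>j. norm (g j x *\<^sub>R f (s j x)))"
proof -
  obtain B where B: "0 \<le> B" "\<And>x. x \<in> K \<Longrightarrow> norm (f x) \<le> B" using bounded_cont_on_compact[OF compact_K f] by blast
  have "summable (\<lambda>j. g j x * B)"
    by (intro summable_mult2 p_summable x)
  then show ?thesis
  proof (rule summable_comparison_test')
    show "norm (norm (g j x *\<^sub>R f (s j x))) \<le> g j x * B" for j
      using B(2)[OF s_in[OF x]] g_pos[OF x, of j] by (simp add: mult_left_mono)
  qed
qed

lemma terms_summable:
  fixes f :: "'a \<Rightarrow> 'b::banach"
  assumes "continuous_on K f" "x \<in> K"
  shows "summable (\<lambda>j. g j x *\<^sub>R f (s j x))"
  by (rule summable_norm_cancel[OF terms_summable_norm[OF assms]])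

lemma T_cont:
  fixes f :: "'a \<Rightarrow> 'b::banach"
  assumes f: "continuous_on K f"
  shows "continuous_on K (T f)"
proof -
  obtain B where B: "0 \<le> B" "\<And>x. x \<in> K \<Longrightarrow> norm (f x) \<le> B" using bounded_cont_on_compact[OF compact_K f] by blast
  obtain G where G: "summable G" "\<And>j. 0 \<le> G j" "\<And>j x. x \<in> K \<Longrightarrow> g j x \<le> G j"
    using g_dominated by blast
  have "uniform_limit K (\<lambda>n x. \<Sum>j<n. g j x *\<^sub>R f (s j x)) (\<lambda>x. \<Sum>j. g j x *\<^sub>R f (s j x)) sequentially"
  proof (rule Weierstrass_m_test)
    show "summable (\<lambda>j. G j * B)"
      by (intro summable_mult2 G)
    show "norm (g j x *\<^sub>R f (s j x)) \<le> G j * B" if "x \<in> K" for j x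
      using B(2)[OF s_in[OF that]] G(3)[OF that] g_pos[OF that, of j] B(1) G(2)
      by (simp add: mult_mono)
  qed
  moreover have "continuous_on K (\<lambda>x. f (s j x))" for j
    using continuous_on_compose2[OF f s_cont] s_in by blast
  ultimately have "continuous_on K (\<lambda>x. \<Sum>j. g j x *\<^sub>R f (s j x))"
    by (rule_tac uniform_limit_theorem)
      (auto intro!: always_eventually continuous_on_sum continuous_on_scaleR g_cont)
  then show ?thesis
    by (simp add: T_apply cong: continuous_on_cong)
qed

lemma T_cont_space: "continuous_on K f \<Longrightarrow> T f \<in> cont_space K"
  for f :: "'a \<Rightarrow> 'b::banach"
  using T_cont[of f] by (simp add: cont_space_def ruelle_def)

lemma T_add:
  fixes f :: "'a \<Rightarrow> 'b::banach"
  assumes "continuous_on K f" "continuous_on K f'" "x \<in> K"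
  shows "T (\<lambda>x. f x + f' x) x = T f x + T f' x"
  using assms by (simp add: T_apply scaleR_add_right suminf_add[OF terms_summable terms_summable])

lemma T_bounded_linear:
  fixes f :: "'a \<Rightarrow> 'b::banach" and L :: "'b \<Rightarrow> 'c::banach"
  assumes L: "bounded_linear L" and f: "continuous_on K f" and x: "x \<in> K"
  shows "T (\<lambda>x. L (f x)) x = L (T f x)"
  using bounded_linear.suminf[OF L terms_summable[OF f x]] x
  by (simp add: T_apply linear_cmul[OF bounded_linear.linear[OF L]])

lemma T_cmult: "continuous_on K f \<Longrightarrow> x \<in> K \<Longrightarrow> T (\<lambda>x. c * f x) x = c * T f x"
  for f :: "'a \<Rightarrow> 'b::{banach, real_normed_algebra}"
  by (rule T_bounded_linear[OF bounded_linear_mult_right])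

lemma T_mono:
  fixes f f' :: "'a \<Rightarrow> real"
  assumes "continuous_on K f" "continuous_on K f'" "x \<in> K" "\<And>y. y \<in> K \<Longrightarrow> f y \<le> f' y"
  shows "T f x \<le> T f' x"
  unfolding T_apply[OF assms(3)]
  using assms g_pos[OF assms(3)] s_in[OF assms(3)]
  by (intro suminf_le terms_summable) (auto simp: mult_left_mono less_imp_le)

lemma T_norm:
  fixes f :: "'a \<Rightarrow> 'b::banach"
  assumes "continuous_on K f" "x \<in> K"
  shows "norm (T f x) \<le> T (\<lambda>x. norm (f x)) x"
  using summable_norm[OF terms_summable_norm[OF assms]] g_pos[OF assms(2)] assms(2)
  by (simp add: T_apply less_imp_le abs_of_pos)

lemma T_pos:
  fixes f :: "'a \<Rightarrow> real"
  assumes "continuous_on K f" "x \<in> K" "\<And>y. y \<in> K \<Longrightarrow> 0 < f y"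
  shows "0 < T f x"
  unfolding T_apply[OF assms(2)]
  using assms g_pos[OF assms(2)] s_in[OF assms(2)] by (intro suminf_pos terms_summable) auto

lemma T_zero: "x \<in> K \<Longrightarrow> T (\<lambda>x. 0) x = 0"
  by (simp add: T_apply)

lemma iter_cont: "continuous_on K f \<Longrightarrow> continuous_on K ((T ^^ n) f)"
  for f :: "'a \<Rightarrow> 'b::banach"
  by (induction n) (auto intro: T_cont)

lemma iter_cong: "(\<And>x. x \<in> K \<Longrightarrow> f x = f' x) \<Longrightarrow> x \<in> K \<Longrightarrow> (T ^^ n) f x = (T ^^ n) f' x"
proof (induction n arbitrary: x)
  case (Suc n)
  have "T ((T ^^ n) f) = T ((T ^^ n) f')"
    by (rule T_cong) (use Suc in auto)
  then show ?case by simp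
qed simp

lemma iter_add:
  fixes f :: "'a \<Rightarrow> 'b::banach"
  assumes "continuous_on K f" "continuous_on K f'" "x \<in> K"
  shows "(T ^^ n) (\<lambda>x. f x + f' x) x = (T ^^ n) f x + (T ^^ n) f' x"
  using assms(3)
proof (induction n arbitrary: x)
  case (Suc n)
  have "T ((T ^^ n) (\<lambda>x. f x + f' x)) = T (\<lambda>x. (T ^^ n) f x + (T ^^ n) f' x)"
    by (rule T_cong) (rule Suc.IH)
  then show ?case
    using T_add[OF iter_cont[OF assms(1)] iter_cont[OF assms(2)] Suc.prems] by simp
qed simp

lemma iter_cmult:
  fixes f :: "'a \<Rightarrow> 'b::{banach, real_normed_algebra}"
  assumes "continuous_on K f" "x \<in> K"
  shows "(T ^^ n) (\<lambda>x. c * f x) x = c * (T ^^ n) f x"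
  using assms(2)
proof (induction n arbitrary: x)
  case (Suc n)
  have "T ((T ^^ n) (\<lambda>x. c * f x)) = T (\<lambda>x. c * (T ^^ n) f x)"
    by (rule T_cong) (rule Suc.IH)
  then show ?case
    using T_cmult[OF iter_cont[OF assms(1)] Suc.prems] by simp
qed simp

lemma iter_mono:
  fixes f f' :: "'a \<Rightarrow> real"
  assumes "continuous_on K f" "continuous_on K f'" "\<And>y. y \<in> K \<Longrightarrow> f y \<le> f' y" "x \<in> K"
  shows "(T ^^ n) f x \<le> (T ^^ n) f' x"
  using assms(4)
proof (induction n arbitrary: x)
  case (Suc n)
  then show ?case
    using T_mono[OF iter_cont[OF assms(1)] iter_cont[OF assms(2)] Suc.prems] by simp
qed (use assms in simp)

lemma iter_zero: "x \<in> K \<Longrightarrow> (T ^^ n) (\<lambda>x. 0 :: real) x = 0"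
proof (induction n arbitrary: x)
  case (Suc n)
  have "T ((T ^^ n) (\<lambda>x. 0 :: real)) = T (\<lambda>x. 0)"
    by (rule T_cong) (rule Suc.IH)
  then show ?case using Suc.prems by (simp add: T_zero)
qed simp

lemma iter_nonneg: "continuous_on K f \<Longrightarrow> (\<And>y. y \<in> K \<Longrightarrow> 0 \<le> f y) \<Longrightarrow> x \<in> K \<Longrightarrow> 0 \<le> (T ^^ n) f x"
  for f :: "'a \<Rightarrow> real"
  using iter_mono[of "\<lambda>x. 0" f x n] by (simp add: iter_zero)

lemma iter_norm:
  fixes f :: "'a \<Rightarrow> 'b::banach"
  assumes "continuous_on K f" "x \<in> K"
  shows "norm ((T ^^ n) f x) \<le> (T ^^ n) (\<lambda>x. norm (f x)) x"
  using assms(2)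
proof (induction n arbitrary: x)
  case (Suc n)
  have cn: "continuous_on K (\<lambda>x. norm (f x))" by (intro continuous_intros assms)
  have "norm (T ((T ^^ n) f) x) \<le> T (\<lambda>x. norm ((T ^^ n) f x)) x"
    by (rule T_norm[OF iter_cont[OF assms(1)] Suc.prems])
  also have "\<dots> \<le> T ((T ^^ n) (\<lambda>x. norm (f x))) x"
    using Suc.IH by (intro T_mono continuous_on_norm iter_cont assms(1) cn Suc.prems)
  finally show ?case by simp
qed simp

definition ones :: "nat \<Rightarrow> 'a \<Rightarrow> real" where
  "ones n = (T ^^ n) (\<lambda>x. 1)"

lemma ones_cont: "continuous_on K (ones n)"
  unfolding ones_def by (intro iter_cont continuous_intros)

lemma ones_pos: "x \<in> K \<Longrightarrow> 0 < ones n x"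
proof (induction n arbitrary: x)
  case (Suc n)
  then show ?case
    using T_pos[OF ones_cont[of n] Suc.prems] by (simp add: ones_def)
qed (simp add: ones_def)

text \<open>
  For \<open>e = 0\<close> this is the bounded distortion of \<open>T\<^sup>n f\<close> for a constant \<open>f\<close>. In general the values of \<open>f\<close> at the
  end points of two orbits with the same maps differ by at most \<open>e\<close> once \<open>n\<close> steps have brought them
  within \<open>t\<close> of each other, and the error \<open>e\<close> is weighted by \<open>T\<^sup>n 1\<close>. The induction on \<open>n\<close> adds the first
  step, so sums over words do not occur.
\<close>

lemma iter_distortion:
  fixes f :: "'a \<Rightarrow> real"
  assumes f: "continuous_on K f" "\<And>x. x \<in> K \<Longrightarrow> 0 \<le> f x" and e: "0 \<le> e"
    and osc: "\<And>x y. x \<in> K \<Longrightarrow> y \<in> K \<Longrightarrow> dist x y \<le> t \<Longrightarrow> f y - e \<le> f x"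
  shows "x \<in> K \<Longrightarrow> y \<in> K \<Longrightarrow> r ^ n * dist x y \<le> t \<Longrightarrow>
    exp (- V y x) * ((T ^^ n) f y - e * ones n y) \<le> (T ^^ n) f x"
proof (induction n arbitrary: x y)
  case 0
  then have "f y - e \<le> f x" by (intro osc) auto
  moreover have "exp (- V y x) * (f y - e) \<le> f y - e" if "0 \<le> f y - e"
    using that V_nonneg[OF 0(2,1)] by (intro mult_left_le_one_le) auto
  moreover have "exp (- V y x) * (f y - e) \<le> 0" if "\<not> 0 \<le> f y - e"
    using that by (simp add: mult_nonneg_nonpos)
  ultimately show ?case
    using f(2)[OF 0(1)] by (cases "0 \<le> f y - e") (auto simp: ones_def)
next
  case (Suc n)
  define F where "F = (\<lambda>z. (T ^^ n) f z + (- e) * ones n z)"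
  have F_cont: "continuous_on K F"
    unfolding F_def by (intro continuous_intros iter_cont f ones_cont)
  have nonneg: "0 \<le> (T ^^ n) f z" if "z \<in> K" for z
    by (rule iter_nonneg[OF f that])
  have TF: "T F y = (T ^^ Suc n) f y - e * ones (Suc n) y"
    unfolding F_def using Suc.prems iter_cont[OF f(1)] ones_cont[of n]
    by (simp only: T_add continuous_on_mult_left T_cmult) (simp add: ones_def)
  have summand: "exp (- V y x) * (g j y * F (s j y)) \<le> g j x * (T ^^ n) f (s j x)" for j
  proof (cases "0 \<le> F (s j y)")
    case True
    have xj: "s j x \<in> K" "s j y \<in> K" using Suc.prems s_in by auto
    have "r ^ n * dist (s j x) (s j y) \<le> r ^ n * (r * dist x y)"
      using contraction[OF Suc.prems(1,2)] r by (intro mult_left_mono) auto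
    also have "\<dots> \<le> t" using Suc.prems(3) by (simp add: mult.assoc mult.left_commute)
    finally have IH: "exp (- V (s j y) (s j x)) * F (s j y) \<le> (T ^^ n) f (s j x)"
      using Suc.IH[OF xj] by (simp add: F_def)
    have "exp (- V y x) * g j y \<le> g j x * exp (- V (s j y) (s j x))"
      using distortion[OF Suc.prems(2,1), of j] by (simp add: exp_minus field_simps)
    then have "exp (- V y x) * g j y * F (s j y) \<le> g j x * exp (- V (s j y) (s j x)) * F (s j y)"
      using True by (rule mult_right_mono)
    also have "\<dots> \<le> g j x * (T ^^ n) f (s j x)"
      using IH g_pos[OF Suc.prems(1), of j] by (simp add: mult.assoc mult_left_mono)
    finally show ?thesis by (simp add: mult.assoc)
  next
    case False
    then have "exp (- V y x) * (g j y * F (s j y)) \<le> 0"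
      using g_pos[OF Suc.prems(2), of j] by (intro mult_nonneg_nonpos) (auto simp: mult_nonneg_nonpos)
    also have "0 \<le> g j x * (T ^^ n) f (s j x)"
      using g_pos[OF Suc.prems(1), of j] nonneg[OF s_in[OF Suc.prems(1)]] by simp
    finally show ?thesis .
  qed
  have sF: "summable (\<lambda>j. g j y * F (s j y))"
    using terms_summable[OF F_cont Suc.prems(2)] by simp
  have "exp (- V y x) * T F y = (\<Sum>j. exp (- V y x) * (g j y * F (s j y)))"
    using suminf_mult[OF sF] Suc.prems(2) by (simp add: T_apply)
  also have "\<dots> \<le> (\<Sum>j. g j x * (T ^^ n) f (s j x))"
    using summand terms_summable[OF iter_cont[OF f(1)] Suc.prems(1)]
    by (intro suminf_le summable_mult sF) simp_all
  also have "\<dots> = (T ^^ Suc n) f x"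
    using Suc.prems(1) by (simp add: T_apply)
  finally show ?case by (simp add: TF)
qed

lemma ones_compare: "x \<in> K \<Longrightarrow> y \<in> K \<Longrightarrow> exp (- V y x) * ones n y \<le> ones n x"
  using iter_distortion[of "\<lambda>x. 1" 0 "r ^ n * dist x y" x y n] by (simp add: ones_def)

lemma ones_compare_C: assumes "x \<in> K" "y \<in> K" shows "ones n y \<le> exp C * ones n x"
proof -
  have "exp (- C) * ones n y \<le> exp (- V y x) * ones n y"
    using V_bound[OF assms(2,1)] ones_pos[OF assms(2), of n] by (intro mult_right_mono) auto
  also have "\<dots> \<le> ones n x" by (rule ones_compare[OF assms])
  finally show ?thesis by (simp add: exp_minus field_simps)
qed

lemma ones_add: "ones (m + n) x = (T ^^ m) (ones n) x"
  by (simp add: ones_def funpow_add)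

lemma ones_growth:
  obtains l where "0 < l" "\<And>n x. x \<in> K \<Longrightarrow> ones n x \<le> exp (2 * C) * l ^ n"
    "\<And>n x. x \<in> K \<Longrightarrow> exp (- (2 * C)) * l ^ n \<le> ones n x"
proof -
  obtain x0 where x0: "x0 \<in> K" using K_ne by blast
  have "ones (m + n) x0 \<le> exp C * ones n x0 * ones m x0"
    and "ones n x0 * ones m x0 \<le> exp C * ones (m + n) x0" for m n
  proof -
    have "(T ^^ m) (ones n) x0 \<le> (T ^^ m) (\<lambda>x. (exp C * ones n x0) * 1) x0"
      using ones_compare_C x0 by (intro iter_mono ones_cont continuous_intros) auto
    then show "ones (m + n) x0 \<le> exp C * ones n x0 * ones m x0"
      using iter_cmult[of "\<lambda>x. 1" x0 m "exp C * ones n x0"] x0 by (simp add: ones_add ones_def[of m])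
    have "(T ^^ m) (\<lambda>x. ones n x0 * 1) x0 \<le> (T ^^ m) (\<lambda>x. exp C * ones n x) x0"
      using ones_compare_C x0 by (intro iter_mono ones_cont continuous_intros) auto
    then show "ones n x0 * ones m x0 \<le> exp C * ones (m + n) x0"
      using iter_cmult[of "\<lambda>x. 1" x0 m "ones n x0"] iter_cmult[OF ones_cont x0, of m "exp C" n] x0
      by (simp add: ones_add ones_def[of m])
  qed
  then have up: "ln (ones (m + n) x0) \<le> ln (exp C * ones n x0 * ones m x0)"
    and lo: "ln (ones n x0 * ones m x0) \<le> ln (exp C * ones (m + n) x0)" for m n
    using ones_pos[OF x0] by (auto intro!: ln_mono)
  have "\<bar>ln (ones (m + n) x0) - ln (ones m x0) - ln (ones n x0)\<bar> \<le> C" for m n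
    using up[of m n] lo[of n m] ones_pos[OF x0, of n] ones_pos[OF x0, of m] ones_pos[OF x0, of "m + n"]
    by (simp add: ln_mult abs_le_iff)
  then obtain L where L: "\<And>n. \<bar>ln (ones n x0) - real n * L\<bar> \<le> C"
    using quasi_additive_linear[of "\<lambda>n. ln (ones n x0)" C] by blast
  have "ones n x0 = exp (ln (ones n x0))" for n
    using ones_pos[OF x0] by simp
  then have up0: "ones n x0 \<le> exp (C + real n * L)" and lo0: "exp (real n * L - C) \<le> ones n x0" for n
    using L[of n] by (metis abs_le_iff diff_le_eq exp_le_cancel_iff, metis abs_le_iff add.commute diff_le_eq exp_le_cancel_iff le_diff_eq minus_diff_eq)
  have pow: "exp (real n * L) = exp L ^ n" for n
    by (simp add: exp_of_nat_mult)
  show ?thesis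
  proof (rule that[of "exp L"])
    show "ones n x \<le> exp (2 * C) * exp L ^ n" if "x \<in> K" for n x
    proof -
      have "ones n x \<le> exp C * ones n x0" by (rule ones_compare_C[OF x0 that])
      also have "\<dots> \<le> exp C * exp (C + real n * L)" by (intro mult_left_mono up0) simp
      also have "\<dots> = exp (2 * C) * exp L ^ n" by (simp add: pow[symmetric] flip: exp_add)
      finally show ?thesis .
    qed
    show "exp (- (2 * C)) * exp L ^ n \<le> ones n x" if "x \<in> K" for n x
    proof -
      have "exp (real n * L - C) \<le> exp C * ones n x"
        using lo0 ones_compare_C[OF that x0] by (rule order_trans)
      then have "exp (- C) * exp (real n * L - C) \<le> exp (- C) * (exp C * ones n x)"
        by (intro mult_left_mono) auto
      also have "\<dots> = ones n x"
        by (simp add: exp_minus)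
      finally show ?thesis
        by (simp add: pow[symmetric] flip: exp_add)
    qed
  qed simp
qed

end

section \<open>The eigenfunction, and convergence to it\<close>

context ruelle_system
begin

lemma T_dist:
  fixes f f' :: "'a \<Rightarrow> 'b::banach"
  assumes f: "continuous_on K f" "continuous_on K f'" and x: "x \<in> K"
    and le: "\<And>y. y \<in> K \<Longrightarrow> norm (f y - f' y) \<le> e"
  shows "norm (T f x - T f' x) \<le> e * ones 1 x"
proof -
  have "T (\<lambda>y. f y + - f' y) x = T f x + T (\<lambda>y. - f' y) x"
    using f by (intro T_add x continuous_intros)
  also have "T (\<lambda>y. - f' y) x = - T f' x"
    by (rule T_bounded_linear[OF bounded_linear_minus[OF bounded_linear_ident] f(2) x])
  finally have "norm (T f x - T f' x) = norm (T (\<lambda>y. f y - f' y) x)"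
    by simp
  also have "\<dots> \<le> T (\<lambda>y. norm (f y - f' y)) x"
    using f by (intro T_norm x continuous_intros)
  also have "\<dots> \<le> T (\<lambda>y. e * 1) x"
    using f le by (intro T_mono x continuous_intros) auto
  also have "\<dots> = e * ones 1 x"
    using T_cmult[of "\<lambda>x. 1" x e] x by (simp add: ones_def)
  finally show ?thesis .
qed

lemma T_tendsto:
  fixes f :: "'a \<Rightarrow> 'b::banach"
  assumes lim: "uniform_limit K F f sequentially" and F: "\<And>n. continuous_on K (F n)" and x: "x \<in> K"
  shows "(\<lambda>n. T (F n) x) \<longlonglongrightarrow> T f x"
proof (rule tendstoI)
  fix e :: real assume e: "0 < e"
  have f: "continuous_on K f"
    by (rule uniform_limit_theorem[OF _ lim]) (auto simp: F)
  define d where "d = e / (2 * ones 1 x)"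
  have d: "0 < d" using e ones_pos[OF x] by (simp add: d_def)
  have "eventually (\<lambda>n. \<forall>y\<in>K. dist (F n y) (f y) < d) sequentially"
    using lim d by (auto simp: uniform_limit_iff)
  then show "eventually (\<lambda>n. dist (T (F n) x) (T f x) < e) sequentially"
  proof eventually_elim
    case (elim n)
    have "norm (T (F n) x - T f x) \<le> d * ones 1 x"
      using elim by (intro T_dist F f x) (auto simp: dist_norm less_imp_le)
    also have "\<dots> < e" using e ones_pos[OF x, of 1] by (simp add: d_def)
    finally show ?case by (simp add: dist_norm)
  qed
qed

text \<open>
  With \<open>u n = T\<^sup>n 1 / l\<^sup>n\<close>, the averages \<open>A n\<close> of \<open>u 0, \<dots>, u n\<close> satisfy
  \<open>T (A n) = l * (A n + (u (n + 1) - 1) / (n + 1))\<close>. The defect vanishes in the limit, because \<open>u\<close> is bounded;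
  so every uniform limit of a subsequence is an eigenfunction.
\<close>

theorem eigenfunction:
  obtains l :: real and h :: "'a \<Rightarrow> real" where "0 < l" "continuous_on K h" "\<And>x. x \<in> K \<Longrightarrow> 0 < h x"
    "\<And>x. x \<in> K \<Longrightarrow> T h x = l * h x"
proof -
  obtain l where l: "0 < l" and ones_le: "\<And>n x. x \<in> K \<Longrightarrow> ones n x \<le> exp (2 * C) * l ^ n"
    and ones_ge: "\<And>n x. x \<in> K \<Longrightarrow> exp (- (2 * C)) * l ^ n \<le> ones n x"
    using ones_growth by blast
  define D where "D = exp (2 * C)"
  have D: "0 < D" by (simp add: D_def)
  define u where "u n x = ones n x / l ^ n" for n x
  have u_le: "u n x \<le> D" and u_ge: "1 / D \<le> u n x" and u_pos: "0 < u n x" if "x \<in> K" for n x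
    using ones_le[OF that, of n] ones_ge[OF that, of n] ones_pos[OF that, of n] l
    by (simp_all add: u_def D_def exp_minus field_simps)
  have u_cont: "continuous_on K (u n)" for n
    unfolding u_def using l by (intro continuous_intros ones_cont) auto
  have u_step: "T (u n) x = l * u (Suc n) x" if "x \<in> K" for n x
    using T_cmult[OF ones_cont that, of "1 / l ^ n" n] l by (simp add: u_def[abs_def] ones_def)
  have u_diff: "u n y - u n x \<le> D * V y x" if "x \<in> K" "y \<in> K" for n x y
  proof -
    have "exp (- V y x) * ones n y / l ^ n \<le> ones n x / l ^ n"
      using ones_compare[OF that] l by (intro divide_right_mono) auto
    then have "exp (- V y x) * u n y \<le> u n x"
      by (simp add: u_def)
    moreover have "(1 - V y x) * u n y \<le> exp (- V y x) * u n y"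
      using exp_ge_add_one_self[of "- V y x"] u_pos[OF that(2), of n] by (intro mult_right_mono) auto
    ultimately have "u n y - u n x \<le> u n y * V y x"
      by (simp add: algebra_simps)
    also have "\<dots> \<le> D * V y x"
      by (intro mult_right_mono u_le V_nonneg that)
    finally show ?thesis .
  qed
  define A where "A n x = (\<Sum>k<Suc n. u k x) / real (Suc n)" for n x
  have A_cont: "continuous_on K (A n)" for n
    unfolding A_def by (intro continuous_intros u_cont) auto
  have A_le: "A n x \<le> D" if "x \<in> K" for n x
    using sum_bounded_above[of "{..<Suc n}" "\<lambda>k. u k x" D] u_le[OF that]
    by (simp add: A_def divide_le_eq mult.commute del: sum.lessThan_Suc of_nat_Suc)
  have A_ge: "1 / D \<le> A n x" if "x \<in> K" for n x
    using sum_bounded_below[of "{..<Suc n}" "1 / D" "\<lambda>k. u k x"] u_ge[OF that]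
    by (simp add: A_def le_divide_eq mult.commute del: sum.lessThan_Suc of_nat_Suc)
  have A_diff: "A n y - A n x \<le> D * V y x" if "x \<in> K" "y \<in> K" for n x y
  proof -
    have "A n y - A n x = (\<Sum>k<Suc n. u k y - u k x) / real (Suc n)"
      by (simp add: A_def sum_subtractf diff_divide_distrib del: sum.lessThan_Suc of_nat_Suc)
    also have "\<dots> \<le> D * V y x"
      using sum_bounded_above[of "{..<Suc n}" "\<lambda>k. u k y - u k x" "D * V y x"] u_diff[OF that]
      by (simp add: divide_le_eq mult.commute del: sum.lessThan_Suc of_nat_Suc)
    finally show ?thesis .
  qed
  have T_sum: "T (\<lambda>x. \<Sum>k<n. u k x) x = l * ((\<Sum>k<n. u k x) + u n x - 1)" if "x \<in> K" for n x
  proof (induction n)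
    case 0
    show ?case using that by (simp add: T_zero u_def ones_def)
  next
    case (Suc n)
    have "T (\<lambda>x. (\<Sum>k<n. u k x) + u n x) x = T (\<lambda>x. \<Sum>k<n. u k x) x + T (u n) x"
      by (intro T_add continuous_on_sum u_cont that)
    then show ?case using Suc u_step[OF that] by (simp add: algebra_simps)
  qed
  have T_A: "T (A n) x = l * (A n x + (u (Suc n) x - 1) / real (Suc n))" if "x \<in> K" for n x
  proof -
    have "T (A n) x = T (\<lambda>x. (1 / real (Suc n)) * (\<Sum>k<Suc n. u k x)) x"
      by (simp add: A_def[abs_def])
    also have "\<dots> = (1 / real (Suc n)) * (l * ((\<Sum>k<Suc n. u k x) + u (Suc n) x - 1))"
      unfolding T_sum[OF that, symmetric] by (intro T_cmult that continuous_on_sum u_cont)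
    finally show ?thesis
      by (simp add: A_def add_divide_distrib diff_divide_distrib algebra_simps del: sum.lessThan_Suc of_nat_Suc)
  qed
  have A_bound: "norm (A n x) \<le> D" if "x \<in> K" for n x
    using A_le[OF that, of n] A_ge[OF that, of n] D divide_pos_pos[of 1 D]
    unfolding real_norm_def abs_le_iff by linarith
  have A_equicont: "\<exists>d. 0 < d \<and> (\<forall>n y. y \<in> K \<and> norm (x - y) < d \<longrightarrow> norm (A n x - A n y) < e)"
    if x: "x \<in> K" and e: "0 < e" for x and e :: real
  proof -
    obtain d where d: "0 < d" "\<And>x y. x \<in> K \<Longrightarrow> y \<in> K \<Longrightarrow> dist x y < d \<Longrightarrow> V x y < e / D"
      using V_small[of "e / D"] e D by auto
    have "norm (A n x - A n y) < e" if "y \<in> K" "norm (x - y) < d" for n y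
    proof -
      have "V x y < e / D" "V y x < e / D"
        using d(2) x that by (auto simp: dist_norm norm_minus_commute)
      then have "D * V x y < e" "D * V y x < e"
        using D by (simp_all add: field_simps)
      then show ?thesis
        using A_diff[OF x that(1), of n] A_diff[OF that(1) x, of n] by (simp add: abs_less_iff)
    qed
    then show "\<exists>d. 0 < d \<and> (\<forall>n y. y \<in> K \<and> norm (x - y) < d \<longrightarrow> norm (A n x - A n y) < e)"
      using d(1) by blast
  qed
  obtain h k where h: "continuous_on K h" and k: "strict_mono (k :: nat \<Rightarrow> nat)"
    and lim: "\<And>e. 0 < e \<Longrightarrow> \<exists>N. \<forall>n x. n \<ge> N \<and> x \<in> K \<longrightarrow> norm (A (k n) x - h x) < e"
    using Arzela_Ascoli[of K A D, OF compact_K A_bound A_equicont] by metis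
  have unif: "uniform_limit K (\<lambda>n. A (k n)) h sequentially"
    unfolding uniform_limit_iff eventually_sequentially dist_norm using lim by blast
  show ?thesis
  proof (rule that[OF l h])
    fix x assume x: "x \<in> K"
    have Alim: "(\<lambda>n. A (k n) x) \<longlonglongrightarrow> h x"
      by (rule tendsto_uniform_limitI[OF unif x])
    have "1 / D \<le> h x"
      using A_ge[OF x] by (intro LIMSEQ_le_const[OF Alim]) auto
    then show "0 < h x" using D divide_pos_pos[of 1 D] by linarith
    have err: "(\<lambda>n. (u (Suc (k n)) x - 1) / real (Suc (k n))) \<longlonglongrightarrow> 0"
    proof (rule Lim_null_comparison[of _ "\<lambda>n. (D + 1) / real (Suc n)"])
      show "(\<lambda>n. (D + 1) / real (Suc n)) \<longlonglongrightarrow> 0"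
        using LIMSEQ_Suc[OF lim_const_over_n[of "D + 1"]] .
      have "norm ((u (Suc (k n)) x - 1) / real (Suc (k n))) \<le> (D + 1) / real (Suc n)" for n
      proof -
        have "\<bar>u (Suc (k n)) x - 1\<bar> \<le> D + 1"
          using u_le[OF x, of "Suc (k n)"] u_pos[OF x, of "Suc (k n)"] D by (simp add: abs_le_iff)
        moreover have "n \<le> k n" by (rule seq_suble[OF k])
        ultimately show ?thesis
          unfolding norm_divide by (simp add: frac_le D less_imp_le)
      qed
      then show "\<forall>\<^sub>F n in sequentially. norm ((u (Suc (k n)) x - 1) / real (Suc (k n))) \<le> (D + 1) / real (Suc n)"
        by simp
    qed
    have "(\<lambda>n. T (A (k n)) x) \<longlonglongrightarrow> l * (h x + 0)"
      unfolding T_A[OF x] by (intro tendsto_intros Alim err)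
    moreover have "(\<lambda>n. T (A (k n)) x) \<longlonglongrightarrow> T h x"
      by (rule T_tendsto[OF unif A_cont x])
    ultimately show "T h x = l * h x"
      using LIMSEQ_unique by fastforce
  qed
qed

end

locale ruelle_eigen = ruelle_system +
  fixes l :: real and h :: "'a \<Rightarrow> real"
  assumes l: "0 < l" and h_cont: "continuous_on K h" and h_pos: "\<And>x. x \<in> K \<Longrightarrow> 0 < h x"
    and T_h: "\<And>x. x \<in> K \<Longrightarrow> T h x = l * h x"
begin

lemma iter_h: "x \<in> K \<Longrightarrow> (T ^^ n) h x = l ^ n * h x"
proof (induction n arbitrary: x)
  case (Suc n)
  have "T ((T ^^ n) h) = T (\<lambda>x. l ^ n * h x)"
    by (rule T_cong) (rule Suc.IH)
  then show ?case
    using T_cmult[OF h_cont Suc.prems] T_h[OF Suc.prems] by simp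
qed simp

lemma h_bounds:
  obtains a b where "0 < a" "0 < b" "\<And>x. x \<in> K \<Longrightarrow> a \<le> h x" "\<And>x. x \<in> K \<Longrightarrow> h x \<le> b"
proof -
  obtain x where x: "x \<in> K" "\<And>y. y \<in> K \<Longrightarrow> h x \<le> h y"
    using continuous_attains_inf[OF compact_K K_ne h_cont] by blast
  obtain z where z: "z \<in> K" "\<And>y. y \<in> K \<Longrightarrow> h y \<le> h z"
    using continuous_attains_sup[OF compact_K K_ne h_cont] by blast
  show ?thesis
    by (rule that[of "h x" "h z"]) (use x z h_pos in auto)
qed

lemma ones_le_power:
  obtains D where "0 < D" "\<And>n x. x \<in> K \<Longrightarrow> ones n x \<le> D * l ^ n"
proof -
  obtain a b where ab: "0 < a" "0 < b" "\<And>x. x \<in> K \<Longrightarrow> a \<le> h x" "\<And>x. x \<in> K \<Longrightarrow> h x \<le> b"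
    using h_bounds by blast
  show ?thesis
  proof (rule that[of "b / a"])
    show "ones n x \<le> b / a * l ^ n" if "x \<in> K" for n x
    proof -
      have "ones n x \<le> (T ^^ n) (\<lambda>x. (1 / a) * h x) x"
        unfolding ones_def using ab by (intro iter_mono continuous_intros h_cont that) (auto simp: field_simps)
      also have "\<dots> = (1 / a) * (l ^ n * h x)"
        using iter_cmult[OF h_cont that, of n "1 / a"] iter_h[OF that] by simp
      also have "\<dots> \<le> (1 / a) * (l ^ n * b)"
        using ab l that by (intro mult_left_mono) auto
      finally show ?thesis by (simp add: mult.commute mult.left_commute)
    qed
  qed (use ab in simp)
qed

text \<open>
  Dividing by the eigenfunction makes the operator Markovian: constants are fixed, and bounds on the
  quotient are inherited by all later quotients.
\<close>

definition ratio :: "('a \<Rightarrow> real) \<Rightarrow> nat \<Rightarrow> 'a \<Rightarrow> real" where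
  "ratio f n x = (T ^^ n) f x / (l ^ n * h x)"

lemma ratio_cont: "continuous_on K f \<Longrightarrow> continuous_on K (ratio f n)"
  unfolding ratio_def using l h_pos by (intro continuous_intros iter_cont h_cont) (auto simp: less_imp_neq[symmetric])

lemma ratio_le:
  assumes f: "continuous_on K f" and le: "\<And>y. y \<in> K \<Longrightarrow> ratio f n y \<le> b" and x: "x \<in> K"
  shows "ratio f (n + m) x \<le> b"
proof -
  have "(T ^^ m) ((T ^^ n) f) x \<le> (T ^^ m) (\<lambda>x. (b * l ^ n) * h x) x"
    using le l h_pos by (intro iter_mono iter_cont f continuous_intros h_cont x)
      (auto simp: ratio_def pos_divide_le_eq mult.assoc)
  also have "\<dots> = (b * l ^ n) * (l ^ m * h x)"
    using iter_cmult[OF h_cont x] iter_h[OF x] by simp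
  also have "(T ^^ m) ((T ^^ n) f) = (T ^^ (n + m)) f"
    by (simp add: funpow_add add.commute[of n m])
  finally show ?thesis
    using l h_pos[OF x] by (simp add: ratio_def pos_divide_le_eq power_add mult_ac)
qed

lemma ratio_ge:
  assumes f: "continuous_on K f" and le: "\<And>y. y \<in> K \<Longrightarrow> a \<le> ratio f n y" and x: "x \<in> K"
  shows "a \<le> ratio f (n + m) x"
proof -
  have "(a * l ^ n) * (l ^ m * h x) = (T ^^ m) (\<lambda>x. (a * l ^ n) * h x) x"
    using iter_cmult[OF h_cont x] iter_h[OF x] by simp
  also have "\<dots> \<le> (T ^^ m) ((T ^^ n) f) x"
    using le l h_pos by (intro iter_mono iter_cont f continuous_intros h_cont x)
      (auto simp: ratio_def pos_le_divide_eq mult.assoc)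
  also have "(T ^^ m) ((T ^^ n) f) = (T ^^ (n + m)) f"
    by (simp add: funpow_add add.commute[of n m])
  finally show ?thesis
    using l h_pos[OF x] by (simp add: ratio_def pos_le_divide_eq power_add mult_ac)
qed

text \<open>
  The function \<open>f - a * h\<close> is nonnegative, so its iterates at any two points are comparable up to the
  constant \<open>exp C\<close> and an error that is small for large \<open>n\<close> by uniform continuity. The quotient \<open>H1 / H2\<close> of
  the bounds for \<open>h\<close> enters on dividing by \<open>h\<close>. It matters that \<open>c\<close> does not depend on \<open>f\<close> and \<open>a\<close>: the
  estimate will be applied to all iterates of a function.
\<close>

lemma ratio_contraction:
  obtains c where "0 < c" "\<And>f a e. continuous_on K f \<Longrightarrow> (\<And>x. x \<in> K \<Longrightarrow> a * h x \<le> f x) \<Longrightarrow> 0 < e \<Longrightarrow>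
    eventually (\<lambda>n. \<forall>x\<in>K. \<forall>y\<in>K. c * (ratio f n y - a) - e \<le> ratio f n x - a) sequentially"
proof -
  obtain H1 H2 where H: "0 < H1" "0 < H2" "\<And>x. x \<in> K \<Longrightarrow> H1 \<le> h x" "\<And>x. x \<in> K \<Longrightarrow> h x \<le> H2"
    using h_bounds by blast
  obtain D where D: "0 < D" "\<And>n x. x \<in> K \<Longrightarrow> ones n x \<le> D * l ^ n"
    using ones_le_power by blast
  define c where "c = exp (- C) * H1 / H2"
  show ?thesis
  proof (rule that[of c])
    show "0 < c" using H by (simp add: c_def)
    fix f a and e :: real
    assume f: "continuous_on K f" and fa: "\<And>x. x \<in> K \<Longrightarrow> a * h x \<le> f x" and e: "0 < e"
    define F where "F = (\<lambda>x. f x + (- a) * h x)"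
    have F_cont: "continuous_on K F"
      unfolding F_def by (intro continuous_intros f h_cont)
    have F_nonneg: "0 \<le> F x" if "x \<in> K" for x using fa[OF that] by (simp add: F_def)
    have F_ratio: "(T ^^ n) F x / l ^ n = h x * (ratio f n x - a)" if "x \<in> K" for n x
    proof -
      have "(T ^^ n) F x = (T ^^ n) f x + (T ^^ n) (\<lambda>x. (- a) * h x) x"
        unfolding F_def by (intro iter_add f continuous_intros h_cont that)
      also have "(T ^^ n) (\<lambda>x. (- a) * h x) x = (- a) * (l ^ n * h x)"
        by (simp only: iter_cmult[OF h_cont that] iter_h[OF that])
      finally have "(T ^^ n) F x = (T ^^ n) f x + (- a) * (l ^ n * h x)" .
      moreover have "(T ^^ n) f x = ratio f n x * (l ^ n * h x)"
        using l h_pos[OF that] by (simp add: ratio_def)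
      ultimately have "(T ^^ n) F x = l ^ n * (h x * (ratio f n x - a))"
        by (simp add: algebra_simps)
      then show ?thesis using l by simp
    qed
    \<comment> \<open>Chosen so that the error \<open>e' * ones n / l ^ n \<le> e' * D\<close> becomes \<open>e\<close> after division by \<open>H1\<close>.\<close>
    define e' where "e' = e * H1 / D"
    have e': "0 < e'" using e H D by (simp add: e'_def)
    obtain t where t: "0 < t" "\<And>x y. x \<in> K \<Longrightarrow> y \<in> K \<Longrightarrow> dist y x < t \<Longrightarrow> dist (F y) (F x) < e'"
      using compact_uniformly_continuous[OF F_cont compact_K] e' unfolding uniformly_continuous_on_def by metis
    obtain d where d: "\<And>x y. x \<in> K \<Longrightarrow> y \<in> K \<Longrightarrow> dist x y \<le> d"
      using compact_imp_bounded[OF compact_K] diameter_bounded_bound by metis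
    have "(\<lambda>n. r ^ n * d) \<longlonglongrightarrow> 0"
      using r by (intro tendsto_mult_left_zero LIMSEQ_realpow_zero) auto
    then have "eventually (\<lambda>n. r ^ n * d < t / 2) sequentially"
      by (rule order_tendstoD) (use t in simp)
    then show "eventually (\<lambda>n. \<forall>x\<in>K. \<forall>y\<in>K. c * (ratio f n y - a) - e \<le> ratio f n x - a) sequentially"
    proof eventually_elim
      case (elim n)
      show ?case
      proof (intro ballI)
        fix x y assume x: "x \<in> K" and y: "y \<in> K"
        have Fx: "0 \<le> (T ^^ n) F x" by (rule iter_nonneg[OF F_cont F_nonneg x])
        define B where "B = (T ^^ n) F y - e' * ones n y"
        have "r ^ n * dist x y \<le> t / 2"
        proof -
          have "r ^ n * dist x y \<le> r ^ n * d"
            using d[OF x y] r by (intro mult_left_mono) auto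
          then show ?thesis using elim by linarith
        qed
        then have "exp (- V y x) * B \<le> (T ^^ n) F x"
          unfolding B_def using t e'
          by (intro iter_distortion[OF F_cont F_nonneg _ _ x y, where t = "t / 2"])
            (force simp: dist_real_def dist_commute abs_less_iff)+
        moreover have "exp (- C) * B \<le> exp (- V y x) * B" if "0 \<le> B"
          using that V_bound[OF y x] by (intro mult_right_mono) auto
        moreover have "exp (- C) * B \<le> 0" if "\<not> 0 \<le> B"
          using that by (simp add: mult_nonneg_nonpos)
        ultimately have "exp (- C) * B \<le> (T ^^ n) F x"
          using Fx by linarith
        then have "exp (- C) * B / l ^ n \<le> (T ^^ n) F x / l ^ n"
          using l by (intro divide_right_mono) auto
        also have "\<dots> = h x * (ratio f n x - a)" by (rule F_ratio[OF x])
        finally have 1: "exp (- C) * (B / l ^ n) \<le> h x * (ratio f n x - a)" by simp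
        have "B / l ^ n = h y * (ratio f n y - a) - e' * (ones n y / l ^ n)"
          using F_ratio[OF y] by (simp add: B_def diff_divide_distrib)
        moreover have "e' * (ones n y / l ^ n) \<le> e' * D"
          using D(2)[OF y, of n] l e' by (intro mult_left_mono) (auto simp: divide_le_eq)
        moreover have "e' * D = e * H1" using D by (simp add: e'_def)
        ultimately have 2: "h y * (ratio f n y - a) - e * H1 \<le> B / l ^ n" by linarith
        have ry: "0 \<le> ratio f n y - a"
          using F_ratio[OF y, of n] iter_nonneg[OF F_cont F_nonneg y, of n] l h_pos[OF y]
          by (metis divide_nonneg_pos linorder_not_less mult_pos_neg zero_less_power)
        have "H1 * (ratio f n y - a) - e * H1 \<le> B / l ^ n"
          using 2 mult_right_mono[OF H(3)[OF y] ry] by linarith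
        then have "exp (- C) * (H1 * (ratio f n y - a) - e * H1) \<le> h x * (ratio f n x - a)"
          using 1 mult_left_mono[of _ _ "exp (- C)"] by fastforce
        moreover have "exp (- C) * (e * H1) \<le> 1 * (e * H1)"
          using C_nonneg e H by (intro mult_right_mono) auto
        ultimately have 3: "exp (- C) * H1 * (ratio f n y - a) \<le> h x * (ratio f n x - a) + e * H1"
          by (simp add: algebra_simps)
        have rx: "0 \<le> ratio f n x - a"
          using F_ratio[OF x, of n] Fx l h_pos[OF x]
          by (metis divide_nonneg_pos linorder_not_less mult_pos_neg zero_less_power)
        have "h x * (ratio f n x - a) + e * H1 \<le> H2 * (ratio f n x - a + e)"
        proof -
          have "h x * (ratio f n x - a) \<le> H2 * (ratio f n x - a)"
            by (intro mult_right_mono H x rx)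
          moreover have "e * H1 \<le> H2 * e"
            using H(3)[OF x] H(4)[OF x] e by (simp add: mult.commute mult_right_mono)
          ultimately show ?thesis by (simp add: distrib_left)
        qed
        with 3 have "exp (- C) * H1 * (ratio f n y - a) \<le> (ratio f n x - a + e) * H2"
          by (simp add: mult.commute)
        then have "exp (- C) * H1 * (ratio f n y - a) / H2 \<le> ratio f n x - a + e"
          using H(2) by (simp add: pos_divide_le_eq)
        then show "c * (ratio f n y - a) - e \<le> ratio f n x - a"
          by (simp add: c_def)
      qed
    qed
  qed
qed

text \<open>
  The minima \<open>m n\<close> increase to \<open>L1\<close> and the maxima \<open>M n\<close> decrease to \<open>L2\<close>. Contraction from the stage \<open>k\<close> on
  gives \<open>c * (L2 - m k) \<le> L1 - m k\<close>; letting \<open>k\<close> tend to infinity yields \<open>L2 \<le> L1\<close>.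
\<close>

lemma ratio_converges:
  assumes f: "continuous_on K f"
  shows "\<exists>L. uniform_limit K (ratio f) (\<lambda>_. L) sequentially"
proof -
  obtain c where c: "0 < c" "\<And>f a e. continuous_on K f \<Longrightarrow> (\<And>x. x \<in> K \<Longrightarrow> a * h x \<le> f x) \<Longrightarrow> 0 < e \<Longrightarrow>
    eventually (\<lambda>n. \<forall>x\<in>K. \<forall>y\<in>K. c * (ratio f n y - a) - e \<le> ratio f n x - a) sequentially"
    using ratio_contraction by blast
  have "\<exists>x\<in>K. \<forall>y\<in>K. ratio f n x \<le> ratio f n y" for n
    by (rule continuous_attains_inf[OF compact_K K_ne ratio_cont[OF f]])
  then obtain lo where lo: "\<And>n. lo n \<in> K" "\<And>n y. y \<in> K \<Longrightarrow> ratio f n (lo n) \<le> ratio f n y"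
    by metis
  have "\<exists>x\<in>K. \<forall>y\<in>K. ratio f n y \<le> ratio f n x" for n
    by (rule continuous_attains_sup[OF compact_K K_ne ratio_cont[OF f]])
  then obtain hi where hi: "\<And>n. hi n \<in> K" "\<And>n y. y \<in> K \<Longrightarrow> ratio f n y \<le> ratio f n (hi n)"
    by metis
  define m M where "m n = ratio f n (lo n)" and "M n = ratio f n (hi n)" for n
  have m_le: "m n \<le> ratio f n x" and le_M: "ratio f n x \<le> M n" if "x \<in> K" for n x
    using lo(2)[OF that] hi(2)[OF that] by (simp_all add: m_def M_def)
  have "m n \<le> m (Suc n)" for n
    unfolding m_def[of "Suc n"] using ratio_ge[OF f m_le lo(1), of n 1] by simp
  then have "incseq m" by (rule incseq_SucI)
  have "M (Suc n) \<le> M n" for n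
    unfolding M_def[of "Suc n"] using ratio_le[OF f le_M hi(1), of n 1] by simp
  then have "decseq M" by (rule decseq_SucI)
  have m_le_M: "m n \<le> M n" for n
    using m_le[OF hi(1)] by (simp add: M_def)
  have "m n \<le> M 0" for n
    using m_le_M[of n] decseqD[OF \<open>decseq M\<close>, of 0 n] by simp
  then obtain L1 where L1: "m \<longlonglongrightarrow> L1" "\<And>n. m n \<le> L1"
    using incseq_convergent[OF \<open>incseq m\<close>] by blast
  have "m 0 \<le> M n" for n
    using m_le_M[of n] incseqD[OF \<open>incseq m\<close>, of 0 n] by simp
  then obtain L2 where L2: "M \<longlonglongrightarrow> L2" "\<And>n. L2 \<le> M n"
    using decseq_convergent[OF \<open>decseq M\<close>] by blast
  have "c * (L2 - m k) \<le> L1 - m k" for k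
  proof (rule field_le_epsilon)
    fix e :: real assume e: "0 < e"
    have lk: "0 < l ^ k" using l by simp
    \<comment> \<open>Restarting at the function \<open>(T ^^ k) f\<close> multiplies all quotients by \<open>l ^ k\<close>.\<close>
    have scale: "ratio ((T ^^ k) f) n x = l ^ k * ratio f (n + k) x" for n x
      using l by (simp add: ratio_def funpow_add power_add)
    have "\<forall>\<^sub>F n in sequentially. \<forall>x\<in>K. \<forall>y\<in>K.
      c * (ratio ((T ^^ k) f) n y - m k * l ^ k) - e * l ^ k \<le> ratio ((T ^^ k) f) n x - m k * l ^ k"
    proof (rule c(2)[OF iter_cont[OF f]])
      show "m k * l ^ k * h x \<le> (T ^^ k) f x" if "x \<in> K" for x
        using m_le[OF that, of k] l h_pos[OF that] by (simp add: ratio_def pos_le_divide_eq mult.assoc)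
    qed (use e lk in simp)
    then have "\<forall>\<^sub>F n in sequentially. c * (M (n + k) - m k) - e \<le> m (n + k) - m k"
    proof eventually_elim
      case (elim n)
      then have "c * (ratio ((T ^^ k) f) n (hi (n + k)) - m k * l ^ k) - e * l ^ k
        \<le> ratio ((T ^^ k) f) n (lo (n + k)) - m k * l ^ k"
        using lo hi by blast
      then have "l ^ k * (c * (M (n + k) - m k) - e) \<le> l ^ k * (m (n + k) - m k)"
        by (simp add: scale m_def M_def algebra_simps)
      then show ?case using lk by (simp add: mult_le_cancel_left_pos)
    qed
    moreover have "(\<lambda>n. c * (M (n + k) - m k) - e) \<longlonglongrightarrow> c * (L2 - m k) - e"
      by (intro tendsto_intros LIMSEQ_ignore_initial_segment L2)
    moreover have "(\<lambda>n. m (n + k) - m k) \<longlonglongrightarrow> L1 - m k"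
      by (intro tendsto_intros LIMSEQ_ignore_initial_segment L1)
    ultimately have "c * (L2 - m k) - e \<le> L1 - m k"
      by (intro tendsto_le[OF sequentially_bot])
    then show "c * (L2 - m k) \<le> L1 - m k + e" by simp
  qed
  then have "c * (L2 - L1) \<le> L1 - L1"
    by (intro LIMSEQ_le[of "\<lambda>k. c * (L2 - m k)" _ "\<lambda>k. L1 - m k"] tendsto_intros L1) auto
  then have "L2 \<le> L1"
    using c(1) by (simp add: mult_le_0_iff)
  have "uniform_limit K (ratio f) (\<lambda>_. L1) sequentially"
    unfolding uniform_limit_iff
  proof (intro allI impI)
    fix e :: real assume e: "0 < e"
    have "eventually (\<lambda>n. L1 - e < m n) sequentially"
      by (rule order_tendstoD(1)[OF L1(1)]) (use e in simp)
    moreover have "eventually (\<lambda>n. M n < L1 + e) sequentially"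
      by (rule order_tendstoD(2)[OF L2(1)]) (use e \<open>L2 \<le> L1\<close> in simp)
    ultimately show "\<forall>\<^sub>F n in sequentially. \<forall>x\<in>K. dist (ratio f n x) L1 < e"
    proof eventually_elim
      case (elim n)
      show ?case
      proof
        fix x assume "x \<in> K"
        then show "dist (ratio f n x) L1 < e"
          using m_le[of x n] le_M[of x n] elim by (simp add: dist_real_def abs_less_iff)
      qed
    qed
  qed
  then show ?thesis ..
qed

definition functional :: "('a \<Rightarrow> real) \<Rightarrow> real" where
  "functional f = (THE L. uniform_limit K (ratio f) (\<lambda>_. L) sequentially)"

lemma functional_eqI:
  assumes "uniform_limit K (ratio f) (\<lambda>_. L) sequentially"
  shows "functional f = L"
  unfolding functional_def
proof (rule the_equality)
  show "uniform_limit K (ratio f) (\<lambda>_. L) sequentially" by (rule assms)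
  fix L' assume L': "uniform_limit K (ratio f) (\<lambda>_. L') sequentially"
  obtain x where "x \<in> K" using K_ne by blast
  then show "L' = L"
    using tendsto_uniform_limitI[OF L'] tendsto_uniform_limitI[OF assms] LIMSEQ_unique by blast
qed

lemma ratio_limit:
  assumes "continuous_on K f"
  shows "uniform_limit K (ratio f) (\<lambda>_. functional f) sequentially"
  using ratio_converges[OF assms] functional_eqI by metis

lemma ratio_tendsto: "continuous_on K f \<Longrightarrow> x \<in> K \<Longrightarrow> (\<lambda>n. ratio f n x) \<longlonglongrightarrow> functional f"
  by (rule tendsto_uniform_limitI[OF ratio_limit])

lemma iter_limit:
  assumes "continuous_on K f"
  shows "uniform_limit K (\<lambda>n x. (1 / l ^ n) * (T ^^ n) f x) (\<lambda>x. functional f * h x) sequentially"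
  unfolding uniform_limit_iff
proof (intro allI impI)
  fix e :: real assume e: "0 < e"
  obtain a b where ab: "0 < b" "\<And>x. x \<in> K \<Longrightarrow> h x \<le> b"
    using h_bounds by metis
  have "\<forall>\<^sub>F n in sequentially. \<forall>x\<in>K. dist (ratio f n x) (functional f) < e / b"
    using ratio_limit[OF assms] e ab(1) unfolding uniform_limit_iff by simp
  then show "\<forall>\<^sub>F n in sequentially. \<forall>x\<in>K. dist ((1 / l ^ n) * (T ^^ n) f x) (functional f * h x) < e"
  proof eventually_elim
    case (elim n)
    show ?case
    proof
      fix x assume x: "x \<in> K"
      have "(1 / l ^ n) * (T ^^ n) f x - functional f * h x = (ratio f n x - functional f) * h x"
        using h_pos[OF x] l by (simp add: ratio_def field_simps)
      then have "dist ((1 / l ^ n) * (T ^^ n) f x) (functional f * h x) = dist (ratio f n x) (functional f) * h x"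
        using h_pos[OF x] by (simp add: dist_real_def abs_mult)
      also have "\<dots> < (e / b) * h x"
        using elim x h_pos[OF x] by (intro mult_strict_right_mono) auto
      also have "\<dots> \<le> (e / b) * b"
        using ab e x by (intro mult_left_mono) auto
      finally show "dist ((1 / l ^ n) * (T ^^ n) f x) (functional f * h x) < e"
        using ab by simp
    qed
  qed
qed

lemma functional_T:
  assumes f: "continuous_on K f"
  shows "functional (T f) = l * functional f"
proof -
  obtain x where x: "x \<in> K" using K_ne by blast
  have "ratio (T f) n x = l * ratio f (Suc n) x" for n
    using l by (simp add: ratio_def funpow_swap1)
  then have "(\<lambda>n. l * ratio f (Suc n) x) \<longlonglongrightarrow> functional (T f)"
    using ratio_tendsto[OF T_cont[OF f] x] by simp
  moreover have "(\<lambda>n. l * ratio f (Suc n) x) \<longlonglongrightarrow> l * functional f"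
    by (intro tendsto_intros LIMSEQ_Suc ratio_tendsto f x)
  ultimately show ?thesis by (rule LIMSEQ_unique)
qed

lemma functional_h: "functional h = 1"
proof (rule functional_eqI, rule uniform_limit_cong'[THEN iffD1, OF _ _ uniform_limit_const])
  show "1 = ratio h n x" if "x \<in> K" for n x
    using iter_h[OF that] l h_pos[OF that] by (simp add: ratio_def)
qed simp

sublocale positive_functional K functional
proof
  obtain x where x: "x \<in> K" using K_ne by blast
  show "functional (\<lambda>x. f x + c * f' x) = functional f + c * functional f'"
    if f: "continuous_on K f" "continuous_on K f'" for f f' c
  proof -
    have "ratio (\<lambda>x. f x + c * f' x) n x = ratio f n x + c * ratio f' n x" for n
    proof -
      have "(T ^^ n) (\<lambda>x. f x + c * f' x) x = (T ^^ n) f x + (T ^^ n) (\<lambda>x. c * f' x) x"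
        using f by (intro iter_add continuous_intros x)
      then show ?thesis
        by (simp add: ratio_def iter_cmult[OF f(2) x] add_divide_distrib)
    qed
    then have "(\<lambda>n. ratio f n x + c * ratio f' n x) \<longlonglongrightarrow> functional (\<lambda>x. f x + c * f' x)"
      using ratio_tendsto[of "\<lambda>x. f x + c * f' x" x] f x by (simp add: continuous_on_add continuous_on_mult_left)
    moreover have "(\<lambda>n. ratio f n x + c * ratio f' n x) \<longlonglongrightarrow> functional f + c * functional f'"
      by (intro tendsto_intros ratio_tendsto f x)
    ultimately show ?thesis by (rule LIMSEQ_unique)
  qed
  show "0 \<le> functional f" if f: "continuous_on K f" "\<And>x. x \<in> K \<Longrightarrow> 0 \<le> f x" for f
  proof (rule LIMSEQ_le_const[OF ratio_tendsto[OF f(1) x]])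
    have "0 \<le> ratio f n x" for n
      using iter_nonneg[OF f x] l h_pos[OF x] by (simp add: ratio_def)
    then show "\<exists>N. \<forall>n\<ge>N. 0 \<le> ratio f n x" by blast
  qed
qed (rule compact_K)

end

section \<open>Spectral radius and eigenmeasure\<close>

context ruelle_eigen
begin

lemma eigenvalue_in_spectrum: "complex_of_real l \<in> spectrum K (ruelle K s p)"
proof -
  define f where "f = (\<lambda>x\<in>K. complex_of_real (h x))"
  define Z where "Z = (\<lambda>x\<in>K. 0 :: complex)"
  have hc: "continuous_on K (\<lambda>x. complex_of_real (h x))"
    by (intro continuous_intros h_cont)
  have f: "f \<in> cont_space K"
    using hc by (simp add: cont_space_def f_def cong: continuous_on_cong)
  have Z: "Z \<in> cont_space K"
    by (simp add: cont_space_def Z_def cong: continuous_on_cong)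
  have "T f x = complex_of_real l * f x" if "x \<in> K" for x
  proof -
    have "T f = T (\<lambda>x. complex_of_real (h x))"
      by (rule T_cong) (simp add: f_def)
    moreover have "T (\<lambda>x. complex_of_real (h x)) x = complex_of_real (T h x)"
      by (rule T_bounded_linear[OF bounded_linear_of_real h_cont that])
    ultimately show ?thesis using T_h[OF that] that by (simp add: f_def)
  qed
  then have f0: "(\<lambda>x\<in>K. complex_of_real l * f x - T f x) = Z"
    unfolding Z_def by (intro restrict_ext) simp
  have "T Z = T (\<lambda>x. 0 :: complex)"
    by (rule T_cong) (simp add: Z_def)
  then have Z0: "(\<lambda>x\<in>K. complex_of_real l * Z x - T Z x) = Z"
    unfolding Z_def by (intro restrict_ext) (simp add: T_zero)
  have "f \<noteq> Z"
  proof
    assume eq: "f = Z"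
    obtain x where "x \<in> K" using K_ne by blast
    then show False
      using fun_cong[OF eq, of x] h_pos[of x] by (simp add: f_def Z_def)
  qed
  then have "\<not> (\<forall>f\<in>cont_space K. R (\<lambda>x\<in>K. complex_of_real l * f x - T f x) = f)" for R
    using f Z f0 Z0 by metis
  then show ?thesis
    unfolding spectrum_def by blast
qed

text \<open>
  The inverse of \<open>z - T\<close> is the Neumann series \<open>\<Sum>n. T\<^sup>n / z\<^sup>n\<^sup>+\<^sup>1\<close>. With \<open>v f n = T\<^sup>n f / z\<^sup>n\<close>, which tends to 0, both
  compositions of the partial sums with \<open>z - T\<close> telescope.
\<close>

lemma not_in_spectrum:
  assumes z: "l < cmod z"
  shows "z \<notin> spectrum K (ruelle K s p)"
proof -
  define q where "q = l / cmod z"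
  have z0: "z \<noteq> 0" using z l by auto
  have "0 < cmod z" using z l by linarith
  then have q: "0 \<le> q" "q < 1" using z l by (auto simp: q_def)
  obtain D where D: "0 < D" "\<And>n x. x \<in> K \<Longrightarrow> ones n x \<le> D * l ^ n"
    using ones_le_power by blast
  define v where "v f n x = (T ^^ n) f x / z ^ n" for f n x
  have v_bound: "cmod (v f n x) \<le> B * (D * q ^ n)"
    if f: "continuous_on K f" and B: "0 \<le> B" "\<And>x. x \<in> K \<Longrightarrow> cmod (f x) \<le> B" and x: "x \<in> K" for f B n x
  proof -
    have "cmod ((T ^^ n) f x) \<le> (T ^^ n) (\<lambda>x. cmod (f x)) x"
      by (rule iter_norm[OF f x])
    also have "\<dots> \<le> (T ^^ n) (\<lambda>x. B * 1) x"
      using f B by (intro iter_mono continuous_intros x) auto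
    also have "\<dots> = B * ones n x"
      using iter_cmult[of "\<lambda>x. 1 :: real" x n B] x by (simp add: ones_def)
    also have "\<dots> \<le> B * (D * l ^ n)"
      using B D(2)[OF x] by (intro mult_left_mono) auto
    finally have "cmod ((T ^^ n) f x) / cmod z ^ n \<le> B * (D * l ^ n) / cmod z ^ n"
      by (intro divide_right_mono) auto
    then show ?thesis
      by (simp add: v_def norm_divide norm_power q_def power_divide)
  qed
  define W where "W n = D * q ^ n / cmod z" for n
  have W: "summable W"
    unfolding W_def using q by (intro summable_divide summable_mult summable_geometric) simp
  have W_nonneg: "0 \<le> W n" for n
    using D q by (simp add: W_def)
  have term_bound: "cmod (v f n x / z) \<le> B * W n"
    if f: "continuous_on K f" and B: "0 \<le> B" "\<And>x. x \<in> K \<Longrightarrow> cmod (f x) \<le> B" and x: "x \<in> K" for f B n x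
    using divide_right_mono[OF v_bound[OF that, of n], of "cmod z"] by (simp add: W_def norm_divide)
  have v_lim: "(\<lambda>n. v f n x) \<longlonglongrightarrow> 0" if f: "continuous_on K f" and x: "x \<in> K" for f x
  proof -
    obtain B where B: "0 \<le> B" "\<And>x. x \<in> K \<Longrightarrow> cmod (f x) \<le> B" using bounded_cont_on_compact[OF compact_K f] by blast
    have "(\<lambda>n. B * (D * q ^ n)) \<longlonglongrightarrow> B * (D * 0)"
      by (rule tendsto_mult[OF tendsto_const tendsto_mult[OF tendsto_const LIMSEQ_realpow_zero[OF q]]])
    then have "(\<lambda>n. B * (D * q ^ n)) \<longlonglongrightarrow> 0"
      by simp
    then show ?thesis
      by (rule Lim_null_comparison[rotated]) (intro always_eventually allI v_bound[OF f B x])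
  qed
  define S where "S f x = (\<Sum>n. v f n x / z)" for f x
  have S_lim: "uniform_limit K (\<lambda>N x. \<Sum>n<N. v f n x / z) (S f) sequentially" if f: "continuous_on K f" for f
  proof -
    obtain B where B: "0 \<le> B" "\<And>x. x \<in> K \<Longrightarrow> cmod (f x) \<le> B" using bounded_cont_on_compact[OF compact_K f] by blast
    show ?thesis
      unfolding S_def[abs_def]
      by (rule Weierstrass_m_test[of K _ "\<lambda>n. B * W n"]) (auto intro: term_bound[OF f B] summable_mult W)
  qed
  have v_cont: "continuous_on K (v f n)" if f: "continuous_on K f" for f n
    unfolding v_def using z0 by (intro continuous_intros iter_cont f) auto
  have sum_cont: "continuous_on K (\<lambda>x. \<Sum>n<N. v f n x / z)" if f: "continuous_on K f" for f N
    using z0 by (intro continuous_intros v_cont f) auto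
  have S_cont: "continuous_on K (S f)" if f: "continuous_on K f" for f
    by (rule uniform_limit_theorem[OF _ S_lim[OF f]]) (simp_all add: sum_cont[OF f])
  have T_v: "T (\<lambda>x. v f n x / z) x = v f (Suc n) x" if f: "continuous_on K f" and x: "x \<in> K" for f n x
    using T_cmult[OF iter_cont[OF f] x, of "1 / (z ^ n * z)" n] by (simp add: v_def mult.commute)
  have T_sum: "T (\<lambda>x. \<Sum>n<N. v f n x / z) x = (\<Sum>n<N. v f (Suc n) x)"
    if f: "continuous_on K f" and x: "x \<in> K" for f N x
  proof (induction N)
    case 0
    show ?case using x by (simp add: T_zero)
  next
    case (Suc N)
    have "T (\<lambda>x. (\<Sum>n<N. v f n x / z) + v f N x / z) x
      = T (\<lambda>x. \<Sum>n<N. v f n x / z) x + T (\<lambda>x. v f N x / z) x"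
      using z0 by (intro T_add sum_cont[OF f] x continuous_intros v_cont f) auto
    then show ?case using Suc T_v[OF f x] by simp
  qed
  define R where "R f = (\<lambda>x\<in>K. S f x)" for f
  have R_cont: "R f \<in> cont_space K" if "continuous_on K f" for f
    using S_cont[OF that] by (simp add: R_def cont_space_def cong: continuous_on_cong)
  have right: "(\<lambda>x\<in>K. z * R f x - T (R f) x) = f" if f: "f \<in> cont_space K" for f
  proof (rule extensionalityI[of _ K])
    show "f \<in> extensional K" using f by (simp add: cont_space_def)
    have fc: "continuous_on K f" using f by (simp add: cont_space_def)
    fix x assume x: "x \<in> K"
    have TR: "T (R f) = T (S f)"
      by (rule T_cong) (simp add: R_def)
    have "(\<lambda>N. z * (\<Sum>n<N. v f n x / z) - T (\<lambda>x. \<Sum>n<N. v f n x / z) x) \<longlonglongrightarrow> z * S f x - T (S f) x"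
      by (intro tendsto_intros tendsto_uniform_limitI[OF S_lim[OF fc] x] T_tendsto[OF S_lim[OF fc] _ x] sum_cont fc)
    moreover have "z * (\<Sum>n<N. v f n x / z) - T (\<lambda>x. \<Sum>n<N. v f n x / z) x = v f 0 x - v f N x" for N
    proof -
      have "z * (\<Sum>n<N. v f n x / z) = (\<Sum>n<N. v f n x)"
        using z0 by (simp add: sum_distrib_left)
      then show ?thesis
        unfolding T_sum[OF fc x] using sum_lessThan_telescope'[of "\<lambda>n. v f n x" N]
        by (simp add: sum_subtractf)
    qed
    moreover have "(\<lambda>N. v f 0 x - v f N x) \<longlonglongrightarrow> v f 0 x - 0"
      by (intro tendsto_intros v_lim fc x)
    ultimately have "z * S f x - T (S f) x = v f 0 x - 0"
      by (metis (no_types, lifting) LIMSEQ_unique ext)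
    then show "(\<lambda>x\<in>K. z * R f x - T (R f) x) x = f x"
      using x unfolding TR by (simp add: R_def v_def)
  qed simp
  have left: "R (\<lambda>x\<in>K. z * f x - T f x) = f" if f: "f \<in> cont_space K" for f
  proof (rule extensionalityI[of _ K])
    show "f \<in> extensional K" using f by (simp add: cont_space_def)
    have fc: "continuous_on K f" using f by (simp add: cont_space_def)
    show "R (\<lambda>x\<in>K. z * f x - T f x) \<in> extensional K" by (simp add: R_def)
    fix x assume x: "x \<in> K"
    have step: "v (\<lambda>x\<in>K. z * f x - T f x) n x / z = v f n x - v f (Suc n) x" for n
    proof -
      have "(T ^^ n) (\<lambda>x\<in>K. z * f x - T f x) x = (T ^^ n) (\<lambda>x. z * f x + (- 1) * T f x) x"
        by (rule iter_cong[OF _ x]) simp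
      also have "\<dots> = (T ^^ n) (\<lambda>x. z * f x) x + (T ^^ n) (\<lambda>x. (- 1) * T f x) x"
        by (intro iter_add continuous_intros fc T_cont x)
      also have "\<dots> = z * (T ^^ n) f x - (T ^^ Suc n) f x"
        using iter_cmult[OF fc x, of n z] iter_cmult[OF T_cont[OF fc] x, of n "- 1"]
        by (simp add: funpow_swap1)
      finally show ?thesis
        using z0 by (simp add: v_def field_simps)
    qed
    have "(\<lambda>n. v f n x - v f (Suc n) x) sums (v f 0 x - 0)"
      by (rule telescope_sums'[OF v_lim[OF fc x]])
    then show "R (\<lambda>x\<in>K. z * f x - T f x) x = f x"
      using x by (simp add: R_def S_def step sums_unique[symmetric] v_def[of f 0])
  qed
  have bound: "sup_norm K (R f) \<le> suminf W * sup_norm K f" if f: "f \<in> cont_space K" for f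
  proof -
    have fc: "continuous_on K f" using f by (simp add: cont_space_def)
    have le: "cmod (f x) \<le> sup_norm K f" if "x \<in> K" for x
      unfolding sup_norm_def
    proof (rule cSUP_upper[OF that])
      show "bdd_above ((\<lambda>x. cmod (f x)) ` K)"
        using bounded_cont_on_compact[OF compact_K fc] by (metis bdd_aboveI2)
    qed
    obtain x0 where "x0 \<in> K" using K_ne by blast
    then have pos: "0 \<le> sup_norm K f"
      using le[of x0] norm_ge_zero[of "f x0"] by linarith
    have "cmod (R f x) \<le> suminf W * sup_norm K f" if x: "x \<in> K" for x
    proof -
      have sW: "summable (\<lambda>n. sup_norm K f * W n)" by (intro summable_mult W)
      have "cmod (S f x) \<le> (\<Sum>n. sup_norm K f * W n)"
        unfolding S_def by (rule norm_suminf_le[OF term_bound[OF fc pos le x] sW])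
      also have "\<dots> = sup_norm K f * suminf W" by (rule suminf_mult[OF W])
      finally show ?thesis using x by (simp add: R_def mult.commute)
    qed
    then show ?thesis
      unfolding sup_norm_def[of K "R f"] by (intro cSUP_least K_ne)
  qed
  show ?thesis
    unfolding spectrum_def using R_cont right left bound
    by (auto simp: cont_space_def intro!: exI[of _ R] exI[of _ "suminf W"])
qed

lemma spectral_radius_eq: "spectral_radius K (ruelle K s p) = l"
  unfolding spectral_radius_def
proof (rule cSup_eq_maximum)
  show "l \<in> cmod ` spectrum K (ruelle K s p)"
    using eigenvalue_in_spectrum l by (intro image_eqI[of _ _ "complex_of_real l"]) auto
  show "y \<le> l" if "y \<in> cmod ` spectrum K (ruelle K s p)" for y
    using that not_in_spectrum by force
qed

lemma eigenmeasure:
  obtains \<mu> k where "prob_space \<mu>" "finite_borel K \<mu>" "k \<in> cont_space K" "\<And>x. x \<in> K \<Longrightarrow> 0 < k x"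
    "\<And>x. x \<in> K \<Longrightarrow> T k x = l * k x" "(\<integral>x. k x \<partial>\<mu>) = 1"
    "\<And>f. continuous_on K f \<Longrightarrow> (\<integral>x. T f x \<partial>\<mu>) = l * (\<integral>x. f x \<partial>\<mu>)"
    "\<And>f. continuous_on K f \<Longrightarrow> uniform_limit K (\<lambda>n x. (1 / l ^ n) * (T ^^ n) f x)
      (\<lambda>x. (\<integral>y. f y \<partial>\<mu>) * k x) sequentially"
proof -
  define Z where "Z = functional (\<lambda>x. 1)"
  obtain b where b: "0 < b" "\<And>x. x \<in> K \<Longrightarrow> h x \<le> b" using h_bounds by metis
  have "functional h \<le> functional (\<lambda>x. b * 1)"
    using b by (intro L_mono h_cont) auto
  then have "1 \<le> b * Z"
    using L_cmult[of "\<lambda>x. 1" b] by (simp add: functional_h Z_def)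
  then have Z: "0 < Z"
    using b by (smt (verit, best) mult_nonneg_nonpos)
  have M: "finite_borel K repr_measure"
    by (simp add: finite_borel_def finite_repr_measure sets_repr_measure)
  define \<mu> where "\<mu> = scale_measure (ennreal (1 / Z)) repr_measure"
  define k where "k = (\<lambda>x\<in>K. Z * h x)"
  have \<mu>: "finite_borel K \<mu>"
    unfolding \<mu>_def by (rule finite_borel_scale[OF M])
  have int: "(\<integral>x. f x \<partial>\<mu>) = functional f / Z" if "continuous_on K f" for f
    using integral_scale[of "1 / Z" f repr_measure] Z measurable_repr_measure[OF that] integral_eq[OF that]
    by (simp add: \<mu>_def)
  interpret fin: finite_measure \<mu> using \<mu> by (simp add: finite_borel_def)
  show ?thesis
  proof (rule that[of \<mu> k])
    have "measure \<mu> (space \<mu>) = 1"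
      using int[of "\<lambda>x. 1"] Z by (simp add: Z_def)
    then show "prob_space \<mu>"
      by (intro prob_spaceI) (simp add: fin.emeasure_eq_measure)
    show "finite_borel K \<mu>" by (rule \<mu>)
    show "k \<in> cont_space K"
      using continuous_on_mult_left[OF h_cont, of Z]
      by (simp add: cont_space_def k_def cong: continuous_on_cong)
    show "0 < k x" if "x \<in> K" for x using that Z h_pos[OF that] by (simp add: k_def)
    show "T k x = l * k x" if "x \<in> K" for x
    proof -
      have "T k = T (\<lambda>x. Z * h x)" by (rule T_cong) (simp add: k_def)
      then show ?thesis using T_cmult[OF h_cont that, of Z] T_h[OF that] that by (simp add: k_def)
    qed
    have "(\<integral>x. k x \<partial>\<mu>) = (\<integral>x. Z * h x \<partial>\<mu>)"
      using space_finite_borel[OF \<mu>] by (intro Bochner_Integration.integral_cong) (auto simp: k_def)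
    then show "(\<integral>x. k x \<partial>\<mu>) = 1"
      using int[OF h_cont] Z by (simp add: functional_h)
    show "(\<integral>x. T f x \<partial>\<mu>) = l * (\<integral>x. f x \<partial>\<mu>)" if f: "continuous_on K f" for f
      using int[OF f] int[OF T_cont[OF f]] functional_T[OF f] by simp
    show "uniform_limit K (\<lambda>n x. (1 / l ^ n) * (T ^^ n) f x) (\<lambda>x. (\<integral>y. f y \<partial>\<mu>) * k x) sequentially"
      if f: "continuous_on K f" for f
    proof (rule uniform_limit_cong'[THEN iffD1, OF _ _ iter_limit[OF f]])
      show "functional f * h x = (\<integral>y. f y \<partial>\<mu>) * k x" if "x \<in> K" for x
        using Z that by (simp add: int[OF f] k_def)
    qed simp
  qed
qed

end

context ruelle_system
begin

lemma positive_operator_T: "positive_operator K (T :: ('a \<Rightarrow> real) \<Rightarrow> 'a \<Rightarrow> real)"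
proof
  show "compact K" by (rule compact_K)
  show "continuous_on K (T f)" if "continuous_on K f" for f :: "'a \<Rightarrow> real"
    by (rule T_cont[OF that])
  show "T (\<lambda>x. f x + c * g x) x = T f x + c * T g x"
    if "continuous_on K f" "continuous_on K g" "x \<in> K" for f g :: "'a \<Rightarrow> real" and c x
    using that T_add[of f "\<lambda>x. c * g x" x] T_cmult[of g x c] by (simp add: continuous_on_mult_left)
  show "0 \<le> T f x" if "continuous_on K f" "\<And>x. x \<in> K \<Longrightarrow> 0 \<le> f x" "x \<in> K" for f :: "'a \<Rightarrow> real" and x
    using T_mono[of "\<lambda>x. 0" f x] that by (simp add: T_zero)
qed

text \<open>
  For another eigenpair \<open>(h', \<mu>')\<close> the sequence \<open>\<rho>\<^sup>-\<^sup>n T\<^sup>n h'\<close> is constant, so \<open>h' = \<langle>\<mu>, h'\<rangle> h\<close>; and the integrals of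
  \<open>\<rho>\<^sup>-\<^sup>n T\<^sup>n f\<close> with respect to \<open>\<mu>'\<close> are constant, so \<open>\<langle>\<mu>', f\<rangle> = \<langle>\<mu>, f\<rangle> \<langle>\<mu>', h\<rangle>\<close>. The normalisations then force
  equality.
\<close>

theorem ruelle_perron_frobenius:
  assumes \<rho>: "\<rho> = spectral_radius K (ruelle K s p)"
  shows "\<exists>h \<mu>. ruelle_eigenpair K s p \<rho> h \<mu> \<and>
    (\<forall>h' \<mu>'. ruelle_eigenpair K s p \<rho> h' \<mu>' \<longrightarrow> h' = h \<and> \<mu>' = \<mu>) \<and>
    (\<forall>f\<in>cont_space K.
       uniform_limit K (\<lambda>n x. (1 / \<rho> ^ n) * (ruelle K s p ^^ n) f x)
         (\<lambda>x. (\<integral>y. f y \<partial>\<mu>) * h x) sequentially) \<and>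
    (\<forall>\<xi>\<in>signed_measures K.
       weakly_converges K (\<lambda>n A. (1 / \<rho> ^ n) * (dual_op K (ruelle K s p) ^^ n) \<xi> A)
         (\<lambda>A. pairing K \<xi> h * measure \<mu> A))"
proof -
  obtain h0 where h0: "0 < \<rho>" "continuous_on K h0" "\<And>x. x \<in> K \<Longrightarrow> 0 < h0 x" "\<And>x. x \<in> K \<Longrightarrow> T h0 x = \<rho> * h0 x"
  proof -
    obtain l and h0 :: "'a \<Rightarrow> real" where h0: "0 < l" "continuous_on K h0" "\<And>x. x \<in> K \<Longrightarrow> 0 < h0 x"
      "\<And>x. x \<in> K \<Longrightarrow> T h0 x = l * h0 x"
      using eigenfunction by blast
    interpret ruelle_eigen K s p r V C l h0
      by unfold_locales (use h0 in auto)
    have "l = \<rho>" using spectral_radius_eq \<rho> by simp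
    then show ?thesis using that h0 by blast
  qed
  interpret ruelle_eigen K s p r V C \<rho> h0
    by unfold_locales (use h0 in auto)
  obtain \<mu> h where \<mu>: "prob_space \<mu>" "finite_borel K \<mu>" and h: "h \<in> cont_space K" "\<And>x. x \<in> K \<Longrightarrow> 0 < h x"
    "\<And>x. x \<in> K \<Longrightarrow> T h x = \<rho> * h x" "(\<integral>x. h x \<partial>\<mu>) = 1"
    and dual: "\<And>f. continuous_on K f \<Longrightarrow> (\<integral>x. T f x \<partial>\<mu>) = \<rho> * (\<integral>x. f x \<partial>\<mu>)"
    and lim: "\<And>f. continuous_on K f \<Longrightarrow> uniform_limit K (\<lambda>n x. (1 / \<rho> ^ n) * (T ^^ n) f x)
      (\<lambda>x. (\<integral>y. f y \<partial>\<mu>) * h x) sequentially"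
    using eigenmeasure by blast
  interpret op: positive_operator K "ruelle K s p :: ('a \<Rightarrow> real) \<Rightarrow> 'a \<Rightarrow> real"
    by (rule positive_operator_T)
  let ?T = "ruelle K s p :: ('a \<Rightarrow> real) \<Rightarrow> 'a \<Rightarrow> real"
  have cD: "continuous_on K f" if "f \<in> cont_space K" for f :: "'a \<Rightarrow> real"
    using that by (simp add: cont_space_def)
  have T_space: "?T f \<in> cont_space K" if "f \<in> cont_space K" for f
    by (rule T_cont_space[OF cD[OF that]])
  have iter_space: "(?T ^^ n) f \<in> cont_space K" if "f \<in> cont_space K" for f n
    by (induction n) (use that T_space in auto)
  have pair: "pairing K (measure \<nu>) f = (\<integral>x. f x \<partial>\<nu>)" if "finite_borel K \<nu>" "continuous_on K f" for \<nu> f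
    by (rule pairing_measure[OF compact_K that])
  have eigen: "ruelle_eigenpair K s p \<rho> h \<mu>"
    unfolding ruelle_eigenpair_def
  proof (intro conjI ballI h \<mu>)
    show "sets \<mu> = sets (borel_on K)" using \<mu> by (simp add: finite_borel_def)
    show "ruelle K s p h = (\<lambda>x\<in>K. \<rho> * h x)"
      using h(3) T_space[OF h(1)] by (intro extensionalityI[of _ K]) (auto simp: cont_space_def)
    show "dual_op K (ruelle K s p) (measure \<mu>) = (\<lambda>A. \<rho> * measure \<mu> A)"
    proof (rule signed_measure_eqI[OF compact_K])
      show "dual_op K (ruelle K s p) (measure \<mu>) \<in> signed_measures K"
        by (intro op.dual_op_signed measure_signed \<mu>)
      show "(\<lambda>A. \<rho> * measure \<mu> A) \<in> signed_measures K"
        by (intro signed_cmult measure_signed \<mu>)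
      show "pairing K (dual_op K (ruelle K s p) (measure \<mu>)) f = pairing K (\<lambda>A. \<rho> * measure \<mu> A) f"
        if f: "f \<in> cont_space K" for f
        using op.pairing_dual_op[OF measure_signed[OF \<mu>(2)] f] pairing_cmult[OF compact_K measure_signed[OF \<mu>(2)] cD[OF f], of \<rho>]
          pair[OF \<mu>(2) cD[OF f]] pair[OF \<mu>(2) T_cont[OF cD[OF f]]] dual[OF cD[OF f]] by simp
    qed
  qed auto
  have unique: "h' = h \<and> \<mu>' = \<mu>" if "ruelle_eigenpair K s p \<rho> h' \<mu>'" for h' \<mu>'
  proof -
    from that have h': "h' \<in> cont_space K" "?T h' = (\<lambda>x\<in>K. \<rho> * h' x)" and h'\<mu>': "(\<integral>x. h' x \<partial>\<mu>') = 1"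
      and prob: "prob_space \<mu>'" and sets: "sets \<mu>' = sets (borel_on K)"
      and dual': "dual_op K ?T (measure \<mu>') = (\<lambda>A. \<rho> * measure \<mu>' A)"
      unfolding ruelle_eigenpair_def by auto
    have \<mu>': "finite_borel K \<mu>'"
      using prob sets by (simp add: finite_borel_def prob_space_def)
    have Th': "T h' x = \<rho> * h' x" if "x \<in> K" for x
      using fun_cong[OF h'(2), of x] that by simp
    have iter': "(1 / \<rho> ^ n) * (?T ^^ n) h' x = h' x" if "x \<in> K" for n x
    proof -
      have "(?T ^^ n) h' x = \<rho> ^ n * h' x"
        using that
      proof (induction n arbitrary: x)
        case (Suc n)
        have "?T ((?T ^^ n) h') = ?T (\<lambda>x. \<rho> ^ n * h' x)"
          by (rule T_cong) (rule Suc.IH)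
        then show ?case
          using T_cmult[OF cD[OF h'(1)] Suc.prems, of "\<rho> ^ n"] Th'[OF Suc.prems] by simp
      qed simp
      then show ?thesis using h0(1) by simp
    qed
    have h'_eq: "h' x = (\<integral>y. h' y \<partial>\<mu>) * h x" if "x \<in> K" for x
      using tendsto_uniform_limitI[OF lim[OF cD[OF h'(1)]] that] iter'[OF that]
      by (simp add: LIMSEQ_const_iff)
    have step: "(\<integral>x. ?T f x \<partial>\<mu>') = \<rho> * (\<integral>x. f x \<partial>\<mu>')" if f: "f \<in> cont_space K" for f
      using op.pairing_dual_op[OF measure_signed[OF \<mu>'] f] pairing_cmult[OF compact_K measure_signed[OF \<mu>'] cD[OF f], of \<rho>]
        pair[OF \<mu>' cD[OF f]] pair[OF \<mu>' T_cont[OF cD[OF f]]] unfolding dual' by simp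
    have steps: "(\<integral>x. (1 / \<rho> ^ n) * (?T ^^ n) f x \<partial>\<mu>') = (\<integral>x. f x \<partial>\<mu>')" if f: "f \<in> cont_space K" for f n
    proof -
      have "(\<integral>x. (?T ^^ n) f x \<partial>\<mu>') = \<rho> ^ n * (\<integral>x. f x \<partial>\<mu>')"
        by (induction n) (simp_all add: step iter_space f)
      then show ?thesis using h0(1) by simp
    qed
    have proportional: "(\<integral>x. f x \<partial>\<mu>') = (\<integral>x. f x \<partial>\<mu>) * (\<integral>x. h x \<partial>\<mu>')" if f: "f \<in> cont_space K" for f
    proof -
      let ?F = "\<lambda>n x. (1 / \<rho> ^ n) * (?T ^^ n) f x"
      have F_cont: "continuous_on K (?F n)" for n
        by (intro continuous_intros iter_cont cD f)
      have "(\<lambda>n. pairing K (measure \<mu>') (?F n)) \<longlonglongrightarrow> pairing K (measure \<mu>') (\<lambda>x. (\<integral>y. f y \<partial>\<mu>) * h x)"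
        by (rule pairing_tendsto[OF compact_K measure_signed[OF \<mu>'] lim[OF cD[OF f]] F_cont])
      then have "(\<lambda>n. \<integral>x. f x \<partial>\<mu>') \<longlonglongrightarrow> (\<integral>y. f y \<partial>\<mu>) * (\<integral>x. h x \<partial>\<mu>')"
        unfolding pairing_scale[of K _ "\<integral>y. f y \<partial>\<mu>"] pair[OF \<mu>' cD[OF h(1)]] pair[OF \<mu>' F_cont] steps[OF f] .
      then show ?thesis by (simp add: LIMSEQ_const_iff)
    qed
    have "(\<integral>x. h x \<partial>\<mu>') = 1"
    proof -
      let ?one = "\<lambda>x\<in>K. 1 :: real"
      have one: "?one \<in> cont_space K" by (simp add: cont_space_def cong: continuous_on_cong)
      have "(\<integral>x. ?one x \<partial>\<nu>) = 1" if "prob_space \<nu>" "finite_borel K \<nu>" for \<nu>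
      proof -
        have "(\<integral>x. ?one x \<partial>\<nu>) = (\<integral>x. 1 \<partial>\<nu>)"
          using space_finite_borel[OF that(2)] by (intro Bochner_Integration.integral_cong) auto
        then show ?thesis using prob_space.prob_space[OF that(1)] by simp
      qed
      then show ?thesis using proportional[OF one] \<mu> \<mu>' prob by simp
    qed
    then have int_eq: "(\<integral>x. f x \<partial>\<mu>') = (\<integral>x. f x \<partial>\<mu>)" if "f \<in> cont_space K" for f :: "'a \<Rightarrow> real"
      using proportional[OF that] by simp
    have "measure \<mu>' = measure \<mu>"
      using int_eq pair[OF \<mu>'] pair[OF \<mu>(2)]
      by (intro signed_measure_eqI[OF compact_K] measure_signed \<mu> \<mu>') (simp add: cD)
    then have "\<mu>' = \<mu>"
      using prob \<mu> sets
      by (intro measure_eqI) (simp_all add: finite_borel_def finite_measure.emeasure_eq_measure prob_space_def)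
    moreover have "h' = h"
      using h'(1) h(1) h'_eq int_eq[OF h'(1)] h'\<mu>'
      by (intro extensionalityI[of _ K]) (auto simp: cont_space_def)
    ultimately show ?thesis by simp
  qed
  have weak: "weakly_converges K (\<lambda>n A. (1 / \<rho> ^ n) * (dual_op K ?T ^^ n) \<xi> A)
    (\<lambda>A. pairing K \<xi> h * measure \<mu> A)" if \<xi>: "\<xi> \<in> signed_measures K" for \<xi>
    unfolding weakly_converges_def
  proof
    fix f :: "'a \<Rightarrow> real" assume f: "f \<in> cont_space K"
    have signed: "(dual_op K ?T ^^ n) \<xi> \<in> signed_measures K" for n
      by (induction n) (use \<xi> op.dual_op_signed in auto)
    have adj: "pairing K ((dual_op K ?T ^^ n) \<xi>) g = pairing K \<xi> ((?T ^^ n) g)" if "g \<in> cont_space K" for n g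
      using that
    proof (induction n arbitrary: g)
      case (Suc n)
      then show ?case
        using op.pairing_dual_op[OF signed Suc.prems, of n] Suc.IH[OF T_space[OF Suc.prems]]
        by (simp add: funpow_swap1)
    qed simp
    let ?F = "\<lambda>n x. (1 / \<rho> ^ n) * (?T ^^ n) f x"
    have F_cont: "continuous_on K (?F n)" for n
      by (intro continuous_intros iter_cont cD f)
    have "(\<lambda>n. pairing K \<xi> (?F n)) \<longlonglongrightarrow> pairing K \<xi> (\<lambda>x. (\<integral>y. f y \<partial>\<mu>) * h x)"
      by (rule pairing_tendsto[OF compact_K \<xi> lim[OF cD[OF f]] F_cont])
    moreover have "pairing K (\<lambda>A. (1 / \<rho> ^ n) * (dual_op K ?T ^^ n) \<xi> A) f = pairing K \<xi> (?F n)" for n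
      unfolding pairing_cmult[OF compact_K signed cD[OF f]] adj[OF f] pairing_scale ..
    moreover have "pairing K (\<lambda>A. pairing K \<xi> h * measure \<mu> A) f = pairing K \<xi> (\<lambda>x. (\<integral>y. f y \<partial>\<mu>) * h x)"
      unfolding pairing_cmult[OF compact_K measure_signed[OF \<mu>(2)] cD[OF f]] pairing_scale pair[OF \<mu>(2) cD[OF f]]
      by simp
    ultimately show "(\<lambda>n. pairing K (\<lambda>A. (1 / \<rho> ^ n) * (dual_op K ?T ^^ n) \<xi> A) f)
      \<longlonglongrightarrow> pairing K (\<lambda>A. pairing K \<xi> h * measure \<mu> A) f"
      by simp
  qed
  show ?thesis
    using eigen unique lim cD weak by blast
qed

end

section \<open>Dini systems have summable distortion\<close>

lemma log_modulus_mono: "t \<le> u \<Longrightarrow> log_modulus U0 p t \<le> log_modulus U0 p u"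
  unfolding log_modulus_def by (intro SUP_mono' SUP_subset_mono) auto

lemma log_modulus_upper:
  assumes "x \<in> U0" "y \<in> U0" "dist x y \<le> t"
  shows "ennreal \<bar>ln (p j x) - ln (p j y)\<bar> \<le> log_modulus U0 p t"
  unfolding log_modulus_def
  by (rule SUP_upper2[of j], simp, rule SUP_upper2[of "(x, y)"]) (use assms in auto)

lemma divide_ennreal_ge:
  fixes a :: ennreal
  assumes "0 < u" "u \<le> v"
  shows "a * ennreal (1 / v) \<le> a / ennreal u"
proof -
  have "ennreal (1 / v) \<le> ennreal (1 / u)"
    using assms by (intro ennreal_leI) (simp add: frac_le)
  also have "\<dots> = inverse (ennreal u)"
    using assms by (simp add: inverse_ennreal inverse_eq_divide)
  finally show ?thesis
    unfolding divide_ennreal_def by (rule mult_left_mono) simp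
qed

context
  fixes U0 :: "(real^'n) set" and p :: "nat \<Rightarrow> real^'n \<Rightarrow> real"
  assumes Dini: "uniformly_Dini U0 p"
begin

lemma Dini_integral: "(\<integral>\<^sup>+t. log_modulus U0 p t / ennreal t * indicator {0<..1} t \<partial>lborel) < top"
  using Dini unfolding uniformly_Dini_def by simp

text \<open>
  The modulus is increasing, so an infinite value at \<open>t < 1\<close> would make the integrand infinite on a
  set of positive length. The integral does not control the value at 1.
\<close>

lemma log_modulus_finite:
  assumes "t < 1"
  shows "log_modulus U0 p t < top"
proof -
  \<comment> \<open>The integrand is controlled only at positive arguments.\<close>
  define u where "u = max t (1/2)"
  have u: "t \<le> u" "0 < u" "u < 1" using assms by (auto simp: u_def)
  have "log_modulus U0 p u * ennreal (1 - u) = (\<integral>\<^sup>+v. log_modulus U0 p u * indicator {u<..1} v \<partial>lborel)"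
    using u by (subst nn_integral_cmult_indicator) auto
  also have "\<dots> \<le> (\<integral>\<^sup>+t. log_modulus U0 p t / ennreal t * indicator {0<..1} t \<partial>lborel)"
  proof (rule nn_integral_mono)
    fix v :: real
    have "log_modulus U0 p u \<le> log_modulus U0 p v / ennreal v" if "v \<in> {u<..1}"
      using divide_ennreal_ge[of v 1 "log_modulus U0 p v"] log_modulus_mono[of u v U0 p] that u
      by (auto intro: order_trans)
    then show "log_modulus U0 p u * indicator {u<..1} v \<le> log_modulus U0 p v / ennreal v * indicator {0<..1} v"
      using u by (auto simp: indicator_def)
  qed
  also have "\<dots> < top" by (rule Dini_integral)
  finally have "log_modulus U0 p u < top"
    using u by (auto simp: ennreal_mult_less_top less_top[symmetric])
  then show ?thesis
    using log_modulus_mono[OF u(1), of U0 p] by (rule le_less_trans[rotated])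
qed

definition modulus :: "real \<Rightarrow> real" where
  "modulus t = enn2real (log_modulus U0 p t)"

lemma modulus_nonneg: "0 \<le> modulus t"
  by (simp add: modulus_def)

lemma modulus_mono: "t \<le> u \<Longrightarrow> u < 1 \<Longrightarrow> modulus t \<le> modulus u"
  unfolding modulus_def by (intro enn2real_mono log_modulus_mono log_modulus_finite)

lemma modulus_upper:
  assumes "x \<in> U0" "y \<in> U0" "dist x y \<le> t" "t < 1"
  shows "\<bar>ln (p j x) - ln (p j y)\<bar> \<le> modulus t"
proof -
  have "enn2real (ennreal \<bar>ln (p j x) - ln (p j y)\<bar>) \<le> modulus t"
    unfolding modulus_def using assms by (intro enn2real_mono log_modulus_upper log_modulus_finite)
  then show ?thesis by simp
qed

text \<open>
  On the interval from \<open>r\<^sup>k\<^sup>+\<^sup>1\<close> to \<open>r\<^sup>k\<close> the Dini integrand is at least the modulus at \<open>r\<^sup>k\<^sup>+\<^sup>1\<close> divided by \<open>r\<^sup>k\<close>, so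
  this interval contributes at least \<open>1 - r\<close> times the modulus at \<open>r\<^sup>k\<^sup>+\<^sup>1\<close> to the integral.
\<close>

lemma modulus_summable:
  assumes r: "0 < r" "r < 1"
  shows "summable (\<lambda>k. modulus (r ^ Suc k))"
proof -
  let ?a = "\<lambda>k. log_modulus U0 p (r ^ Suc k)"
  define J where "J k = {r ^ Suc k<..r ^ k}" for k
  have J_disj: "j = k" if "t \<in> J j" "t \<in> J k" for t j k
  proof -
    have False if "t \<in> J j" "t \<in> J k" "j < k" for j k
    proof -
      have "r ^ k \<le> r ^ Suc j" using that r by (intro power_decreasing) auto
      then show False using that by (auto simp: J_def)
    qed
    then show ?thesis using that by (metis linorder_neqE_nat)
  qed
  have le: "(\<Sum>k. ?a k * ennreal (1 / r ^ k) * indicator (J k) t)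
    \<le> log_modulus U0 p t / ennreal t * indicator {0<..1} t" for t :: real
  proof (cases "\<exists>k. t \<in> J k")
    case True
    then obtain k where k: "t \<in> J k" ..
    have t: "0 < t" "t \<le> r ^ k" "r ^ Suc k \<le> t"
      using k zero_less_power[OF r(1), of "Suc k"] by (auto simp: J_def)
    have "t \<le> 1" using t(2) power_le_one[of r k] r by linarith
    have "(\<Sum>k. ?a k * ennreal (1 / r ^ k) * indicator (J k) t)
      = (\<Sum>i\<in>{k}. ?a i * ennreal (1 / r ^ i) * indicator (J i) t)"
      using J_disj k by (intro suminf_finite) (auto simp: indicator_def)
    also have "\<dots> = ?a k * ennreal (1 / r ^ k)" using k by simp
    also have "\<dots> \<le> log_modulus U0 p t * ennreal (1 / r ^ k)"
      by (intro mult_right_mono log_modulus_mono t) simp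
    also have "\<dots> \<le> log_modulus U0 p t / ennreal t"
      by (intro divide_ennreal_ge t)
    finally show ?thesis using t \<open>t \<le> 1\<close> by simp
  qed simp
  have "(\<Sum>k. ?a k) * ennreal (1 - r) = (\<Sum>k. ?a k * ennreal (1 - r))"
    by simp
  also have "\<dots> = (\<Sum>k. \<integral>\<^sup>+t. ?a k * ennreal (1 / r ^ k) * indicator (J k) t \<partial>lborel)"
  proof (intro suminf_cong)
    fix k
    have "r ^ Suc k \<le> r ^ k" using r by (intro power_decreasing) auto
    then have "emeasure lborel (J k) = ennreal (r ^ k - r ^ Suc k)"
      by (simp add: J_def)
    moreover have "ennreal (1 / r ^ k) * ennreal (r ^ k - r ^ Suc k) = ennreal (1 - r)"
      using r by (subst ennreal_mult'[symmetric]) (auto simp: field_simps)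
    ultimately show "?a k * ennreal (1 - r) = (\<integral>\<^sup>+t. ?a k * ennreal (1 / r ^ k) * indicator (J k) t \<partial>lborel)"
      by (subst nn_integral_cmult_indicator) (auto simp: J_def mult.assoc)
  qed
  also have "\<dots> = (\<integral>\<^sup>+t. (\<Sum>k. ?a k * ennreal (1 / r ^ k) * indicator (J k) t) \<partial>lborel)"
    by (rule nn_integral_suminf[symmetric]) (auto simp: J_def)
  also have "\<dots> \<le> (\<integral>\<^sup>+t. log_modulus U0 p t / ennreal t * indicator {0<..1} t \<partial>lborel)"
    by (intro nn_integral_mono le)
  also have "\<dots> < top" by (rule Dini_integral)
  finally have "(\<Sum>k. ?a k) < top"
    using r by (auto simp: ennreal_mult_less_top less_top[symmetric])
  moreover have "?a k = ennreal (modulus (r ^ Suc k))" for k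
  proof -
    have "r ^ Suc k < 1" using r by (intro power_Suc_less_one) auto
    then show ?thesis using log_modulus_finite by (simp add: modulus_def ennreal_enn2real)
  qed
  ultimately show ?thesis
    by (intro summable_suminf_not_top modulus_nonneg) auto
qed

end

lemma limit_set_invariant:
  assumes "\<And>j. s j ` X \<subseteq> X" "x \<in> limit_set X s"
  shows "s j x \<in> limit_set X s"
proof -
  obtain w where w: "\<And>n. n \<ge> 1 \<Longrightarrow> x \<in> prefix_map s w n ` X"
    using assms(2) by (auto simp: limit_set_def)
  have shift: "prefix_map s (case_nat j w) (Suc n) = s j \<circ> prefix_map s w n" for n
  proof (induction n)
    case (Suc n)
    have "prefix_map s (case_nat j w) (Suc (Suc n)) = prefix_map s (case_nat j w) (Suc n) \<circ> s (w n)"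
      by simp
    also have "\<dots> = s j \<circ> prefix_map s w (Suc n)"
      unfolding Suc by (simp add: comp_assoc)
    finally show ?case .
  qed simp
  have "x \<in> s (w 0) ` X" using w[of 1] by simp
  then have "x \<in> X" using assms(1) by blast
  have "s j x \<in> prefix_map s (case_nat j w) m ` X" if m: "m \<ge> 1" for m
  proof -
    obtain n where n: "m = Suc n" using m by (cases m) auto
    show ?thesis
    proof (cases n)
      case 0
      then show ?thesis using \<open>x \<in> X\<close> n by simp
    next
      case (Suc k)
      then show ?thesis unfolding n shift using w[of n] by (auto simp: image_comp[symmetric])
    qed
  qed
  then show ?thesis
    unfolding limit_set_def by blast
qed

lemma limit_set_subset:
  assumes "\<And>j. s j ` X \<subseteq> X"
  shows "limit_set X s \<subseteq> X"
proof
  fix x assume "x \<in> limit_set X s"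
  then obtain w where "\<And>n. n \<ge> 1 \<Longrightarrow> x \<in> prefix_map s w n ` X"
    by (auto simp: limit_set_def)
  from this[of 1] show "x \<in> X" using assms by auto
qed

lemma limit_set_nonempty:
  fixes X :: "'a::heine_borel set"
  assumes X: "compact X" "X \<noteq> {}" and s: "\<And>j. s j ` X \<subseteq> X" "\<And>j. continuous_on X (s j)"
  shows "limit_set X s \<noteq> {}"
proof -
  define w where "w = (\<lambda>_::nat. 0::nat)"
  have sub: "prefix_map s w n ` X \<subseteq> X" and cont: "continuous_on X (prefix_map s w n)" for n
  proof (induction n)
    case (Suc n)
    { case 1 then show ?case using Suc(1) s(1)[of "w n"] by (auto simp: image_subset_iff) }
    { case 2 show ?case
        unfolding prefix_map.simps
        by (rule continuous_on_compose[OF s(2) continuous_on_subset[OF Suc(2) s(1)]]) }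
  qed auto
  have "(\<Inter>n. prefix_map s w n ` X) \<noteq> {}"
  proof (rule compact_nest)
    show "compact (prefix_map s w n ` X)" for n
      by (intro compact_continuous_image cont X)
    show "prefix_map s w n ` X \<noteq> {}" for n using X by simp
    have "prefix_map s w (Suc n) ` X \<subseteq> prefix_map s w n ` X" for n
      using s(1)[of "w n"] by (auto simp: image_subset_iff)
    then show "prefix_map s w n ` X \<subseteq> prefix_map s w m ` X" if "m \<le> n" for m n
      by (rule lift_Suc_antimono_le[OF _ that])
  qed
  then show ?thesis
    unfolding limit_set_def by blast
qed

text \<open>
  The largest distance from \<open>x\<close> to a point of \<open>X\<close> is attained, and in the open set \<open>U0\<close> the point can
  still be moved further away from \<open>x\<close>.
\<close>

lemma dist_bound_less_one:
  fixes X U0 :: "'a::euclidean_space set"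
  assumes X: "compact X" "X \<subseteq> U0" "X \<noteq> {}" and U0: "open U0" "bounded U0" "diameter U0 \<le> 1" and x: "x \<in> X"
  obtains d where "d < 1" "\<And>y. y \<in> X \<Longrightarrow> dist x y \<le> d"
proof -
  have "continuous_on X (dist x)" by (intro continuous_intros)
  then obtain y where y: "y \<in> X" "\<And>z. z \<in> X \<Longrightarrow> dist x z \<le> dist x y"
    using continuous_attains_sup[OF X(1) X(3)] by blast
  have "dist x y < 1"
  proof (rule ccontr)
    assume "\<not> dist x y < 1"
    then have ge: "1 \<le> dist x y" and pos: "0 < dist x y" by linarith+
    obtain e where e: "0 < e" "ball y e \<subseteq> U0"
      using U0(1) X(2) y(1) by (meson open_contains_ball subsetD)
    define c where "c = e / (2 * dist x y)"
    have c: "0 < c" using e pos by (simp add: c_def)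
    define y' where "y' = y + c *\<^sub>R (y - x)"
    have "dist y y' = c * dist x y"
      using c by (simp add: y'_def dist_norm norm_minus_commute)
    also have "\<dots> < e" using e pos by (simp add: c_def)
    finally have "y' \<in> U0" using e by auto
    have "y' - x = (1 + c) *\<^sub>R (y - x)"
      by (simp add: y'_def algebra_simps)
    then have "norm (y' - x) = (1 + c) * dist x y"
      using c by (simp add: dist_norm norm_minus_commute)
    then have "dist x y' = (1 + c) * dist x y"
      by (simp add: dist_norm norm_minus_commute)
    also have "\<dots> > 1 * 1"
      using c ge by (intro mult_less_le_imp_less) auto
    finally have "1 < dist x y'" by simp
    moreover have "dist x y' \<le> diameter U0"
      using U0 x X(2) \<open>y' \<in> U0\<close> by (intro diameter_bounded_bound) auto
    ultimately show False using U0 by simp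
  qed
  then show ?thesis using that y by blast
qed

text \<open>
  The distortion function is the sum of the moduli at \<open>r * d, r\<^sup>2 * d, \<dots>\<close> with \<open>d = dist x y\<close>. One step
  of the system replaces \<open>d\<close> by at most \<open>r * d\<close>, that is, it shifts this series by one term, and the
  weights of that step differ by at most the term that is shifted out. Convergence of the sum of the
  weights \<open>p j (s j x)\<close> is transferred from that of \<open>p j x\<close>; the points \<open>x\<close> and \<open>s j x\<close> are not close, so
  this uses the modulus at the largest distance from \<open>x\<close> to a point of \<open>X\<close>, which is less than 1.
\<close>

lemma contractive_Dini_ruelle_system:
  fixes X U0 :: "(real^'n) set" and s :: "nat \<Rightarrow> real^'n \<Rightarrow> real^'n" and p :: "nat \<Rightarrow> real^'n \<Rightarrow> real"
  assumes X: "compact X" "X \<noteq> {}" "X \<subseteq> U0" and U0: "open U0" "bounded U0" "diameter U0 \<le> 1"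
    and s: "\<And>j. s j ` X \<subseteq> X" and r: "0 < r" "r < 1"
    and contr: "\<And>j x y. x \<in> X \<Longrightarrow> y \<in> X \<Longrightarrow> dist (s j x) (s j y) \<le> r * dist x y"
    and Dini: "uniformly_Dini U0 p"
  shows "\<exists>V C. ruelle_system (closure (limit_set X s)) s p r V C"
proof -
  let ?K = "closure (limit_set X s)"
  let ?A = "modulus U0 p"
  have s_cont: "continuous_on X (s j)" for j
    using contr by (rule continuous_on_contraction[OF r(2)])
  have K_X: "?K \<subseteq> X"
    using limit_set_subset[OF s] X by (intro closure_minimal compact_imp_closed)
  have K_U0: "x \<in> U0" if "x \<in> ?K" for x using that K_X X by blast
  have A_sum: "summable (\<lambda>k. ?A (r ^ Suc k))"
    by (rule modulus_summable[OF Dini r])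
  have r_less: "r ^ Suc k < 1" for k
    using r by (intro power_Suc_less_one) auto
  have dist1: "dist x y \<le> 1" if "x \<in> X" "y \<in> X" for x y
    using diameter_bounded_bound[OF U0(2) subsetD[OF X(3) that(1)] subsetD[OF X(3) that(2)]] U0(3)
    by linarith
  define V where "V x y = (\<Sum>k. ?A (r ^ Suc k * dist x y))" for x y :: "real^'n"
  have A_le: "?A (r ^ Suc k * t) \<le> ?A (r ^ Suc k)" if "0 \<le> t" "t \<le> 1" for k t
    using that r by (intro modulus_mono[OF Dini] r_less) (simp add: mult_left_le)
  have V_sum: "summable (\<lambda>k. ?A (r ^ Suc k * t))" if "0 \<le> t" "t \<le> 1" for t
    using A_sum by (rule summable_comparison_test') (simp add: modulus_nonneg[OF Dini] A_le that del: power_Suc)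
  have "ruelle_system ?K s p r V (\<Sum>k. ?A (r ^ Suc k))"
  proof
    show "compact ?K" using X K_X by (metis closed_closure compact_Int_closed inf.absorb_iff2)
    show "?K \<noteq> {}" using limit_set_nonempty[OF X(1,2) s s_cont] by simp
    show "s j x \<in> ?K" if "x \<in> ?K" for j x
    proof -
      have "s j ` ?K \<subseteq> ?K"
        using limit_set_invariant[of s X, OF s] closure_subset[of "limit_set X s"]
        by (intro image_closure_subset continuous_on_subset[OF s_cont K_X]) auto
      then show ?thesis using that by blast
    qed
    show "dist (s j x) (s j y) \<le> r * dist x y" if "x \<in> ?K" "y \<in> ?K" for j x y
      using that K_X by (intro contr) auto
    show "0 < p j x" if "x \<in> ?K" for j x
      using Dini K_U0[OF that] by (simp add: uniformly_Dini_def)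
    show "summable (\<lambda>j. p j (s j x))" if x: "x \<in> ?K" for x
    proof -
      have xX: "x \<in> X" using x K_X by blast
      obtain d where d: "d < 1" "\<And>y. y \<in> X \<Longrightarrow> dist x y \<le> d"
        using dist_bound_less_one[OF X(1,3,2) U0 xX] by blast
      have "summable (\<lambda>j. exp (?A d) * p j x)"
        using Dini K_U0[OF x] by (intro summable_mult) (simp add: uniformly_Dini_def)
      then show ?thesis
      proof (rule summable_comparison_test')
        fix j
        have sX: "s j x \<in> X" using s xX by blast
        then have pos: "0 < p j (s j x)" "0 < p j x"
          using Dini X xX by (auto simp: uniformly_Dini_def)
        have "\<bar>ln (p j x) - ln (p j (s j x))\<bar> \<le> ?A d"
          using X xX sX d by (intro modulus_upper[OF Dini]) auto
        then have "ln (p j (s j x)) \<le> ?A d + ln (p j x)" by (simp add: abs_le_iff)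
        then have "exp (ln (p j (s j x))) \<le> exp (?A d + ln (p j x))" by simp
        then show "norm (p j (s j x)) \<le> exp (?A d) * p j x"
          using pos by (simp add: exp_add)
      qed
    qed
    show "0 \<le> V x y" if "x \<in> ?K" "y \<in> ?K" for x y
      unfolding V_def using that K_X dist1 by (intro suminf_nonneg V_sum modulus_nonneg[OF Dini]) auto
    show "V x y \<le> (\<Sum>k. ?A (r ^ Suc k))" if "x \<in> ?K" "y \<in> ?K" for x y
      unfolding V_def using that K_X dist1 by (intro suminf_le V_sum A_sum A_le) auto
    show "\<exists>d>0. \<forall>x\<in>?K. \<forall>y\<in>?K. dist x y < d \<longrightarrow> V x y < e" if e: "0 < e" for e
    proof -
      obtain N where N: "norm (\<Sum>k. ?A (r ^ Suc (k + N))) < e"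
        using suminf_exist_split[OF e A_sum] by blast
      have "V x y < e" if "x \<in> ?K" "y \<in> ?K" "dist x y < r ^ N" for x y
      proof -
        have "V x y \<le> (\<Sum>k. ?A (r ^ Suc (k + N)))"
          unfolding V_def
        proof (intro suminf_le V_sum)
          show "dist x y \<le> 1" using that K_X by (intro dist1) auto
          show "summable (\<lambda>k. ?A (r ^ Suc (k + N)))"
            using A_sum summable_iff_shift[of "\<lambda>k. ?A (r ^ Suc k)" N] by simp
          show "?A (r ^ Suc k * dist x y) \<le> ?A (r ^ Suc (k + N))" for k
          proof (rule modulus_mono[OF Dini _ r_less])
            have "r ^ Suc k * dist x y \<le> r ^ Suc k * r ^ N"
              using that r by (intro mult_left_mono) auto
            then show "r ^ Suc k * dist x y \<le> r ^ Suc (k + N)"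
              by (simp add: power_add mult.assoc)
          qed
        qed simp
        then show ?thesis using N by simp
      qed
      then show ?thesis using r by (intro exI[of _ "r ^ N"]) auto
    qed
    show "p j (s j x) * exp (V (s j x) (s j y)) \<le> exp (V x y) * p j (s j y)"
      if xy: "x \<in> ?K" "y \<in> ?K" for j x y
    proof -
      let ?d = "dist x y"
      have X': "x \<in> X" "y \<in> X" using xy K_X by auto
      have sX: "s j x \<in> X" "s j y \<in> X" using s X' by auto
      have pos: "0 < p j (s j x)" "0 < p j (s j y)"
        using Dini X sX by (auto simp: uniformly_Dini_def)
      have rd: "r * ?d < 1"
        using r dist1[OF X'] mult_left_le[of ?d r] by linarith
      have "\<bar>ln (p j (s j x)) - ln (p j (s j y))\<bar> \<le> ?A (r * ?d)"
        using X sX contr[OF X'] rd by (intro modulus_upper[OF Dini]) auto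
      then have 1: "ln (p j (s j x)) \<le> ?A (r * ?d) + ln (p j (s j y))"
        by (simp add: abs_le_iff)
      have V_split: "(\<Sum>k. ?A (r ^ Suc (Suc k) * ?d)) = V x y - ?A (r * ?d)"
        using suminf_split_head[OF V_sum[of ?d]] dist1[OF X'] by (simp add: V_def)
      have "V (s j x) (s j y) \<le> (\<Sum>k. ?A (r ^ Suc (Suc k) * ?d))"
        unfolding V_def
      proof (intro suminf_le V_sum)
        show "dist (s j x) (s j y) \<le> 1" using sX by (rule dist1)
        show "summable (\<lambda>k. ?A (r ^ Suc (Suc k) * ?d))"
          using V_sum[of ?d] dist1[OF X'] summable_Suc_iff[of "\<lambda>k. ?A (r ^ Suc k * ?d)"] by simp
        show "?A (r ^ Suc k * dist (s j x) (s j y)) \<le> ?A (r ^ Suc (Suc k) * ?d)" for k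
        proof (rule modulus_mono[OF Dini])
          have "r ^ Suc k * dist (s j x) (s j y) \<le> r ^ Suc k * (r * ?d)"
            using contr[OF X'] r by (intro mult_left_mono) auto
          then show "r ^ Suc k * dist (s j x) (s j y) \<le> r ^ Suc (Suc k) * ?d"
            by (simp add: mult_ac)
          have "r ^ Suc (Suc k) * ?d \<le> r ^ Suc (Suc k) * 1"
            using dist1[OF X'] r by (intro mult_left_mono) auto
          then show "r ^ Suc (Suc k) * ?d < 1"
            using r_less[of "Suc k"] by linarith
        qed
      qed simp
      then have "ln (p j (s j x)) + V (s j x) (s j y) \<le> V x y + ln (p j (s j y))"
        using 1 V_split by linarith
      then have "exp (ln (p j (s j x)) + V (s j x) (s j y)) \<le> exp (V x y + ln (p j (s j y)))"
        by simp
      then show ?thesis using pos by (simp add: exp_add)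
    qed
  qed (use r in auto)
  then show ?thesis by blast
qed

section \<open>The Ruelle--Perron--Frobenius theorem for conformal Dini systems\<close>

theorem theorem1p1:
  fixes X U0 K :: "(real^'n) set"
    and s :: "nat \<Rightarrow> real^'n \<Rightarrow> real^'n"
    and p :: "nat \<Rightarrow> real^'n \<Rightarrow> real"
    and \<rho> :: real
  assumes "infinite_conformal_Dini_IFS U0 X s p"
    and "K = closure (limit_set X s)"
    and "\<rho> = spectral_radius K (ruelle K s p)"
  shows "\<exists>h \<mu>. ruelle_eigenpair K s p \<rho> h \<mu> \<and>
    (\<forall>h' \<mu>'. ruelle_eigenpair K s p \<rho> h' \<mu>' \<longrightarrow> h' = h \<and> \<mu>' = \<mu>) \<and>
    (\<forall>f\<in>cont_space K.
       uniform_limit K (\<lambda>n x. (1 / \<rho> ^ n) * (ruelle K s p ^^ n) f x)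
         (\<lambda>x. (\<integral>y. f y \<partial>\<mu>) * h x) sequentially) \<and>
    (\<forall>\<xi>\<in>signed_measures K.
       weakly_converges K (\<lambda>n A. (1 / \<rho> ^ n) * (dual_op K (ruelle K s p) ^^ n) \<xi> A)
         (\<lambda>A. pairing K \<xi> h * measure \<mu> A))"
proof -
  have ifs: "infinite_conformal_IFS U0 X s" and Dini: "uniformly_Dini U0 p"
    using assms(1) by (simp_all add: infinite_conformal_Dini_IFS_def)
  obtain r where r: "0 < r" "r < 1"
    and contr: "\<And>j x y. x \<in> X \<Longrightarrow> y \<in> X \<Longrightarrow> dist (s j x) (s j y) \<le> r * dist x y"
    using ifs unfolding infinite_conformal_IFS_def by blast
  have X: "compact X" "X \<noteq> {}" "X \<subseteq> U0" and U0: "open U0" "bounded U0" "diameter U0 \<le> 1"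
    using ifs unfolding infinite_conformal_IFS_def by blast+
  have s: "s j ` X \<subseteq> X" for j
    using ifs unfolding infinite_conformal_IFS_def conformal_self_map_def by blast
  have "\<exists>V C. ruelle_system K s p r V C"
    unfolding assms(2)
    by (rule contractive_Dini_ruelle_system[of X U0 s]) (fact X U0 s r contr Dini)+
  then obtain V C where "ruelle_system K s p r V C"
    by blast
  then show ?thesis
    by (rule ruelle_system.ruelle_perron_frobenius[OF _ assms(3)])
qed

end
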